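(* Let $H$ be a compact Lie group. Then for all sufficiently large $n$ there exist a finite-dimensional linear representation $V$ of $SU(n)$ and a vector $v \in V$ whose stabilizer subgroup $\{g \in SU(n) : g\cdot v = v\}$ is isomorphic to $H$.
   Context: Lie groups may be zero-dimensional (e.g. finite groups). *)

theory Defs
  imports "HOL-Analysis.Analysis" "HOL-Algebra.Group"
begin

text \<open>R^d is modelled as the functions nat => real vanishing from index d on,
  with the (product) topology inherited from nat => real, which on this set is
  the usual Euclidean topology.  d = 0 is allowed (R^0 is a point).\<close>

definition Rd :: "nat \<Rightarrow> (nat \<Rightarrow> real) set" where
  "Rd d = {x. \<forall>i\<ge>d. x i = 0}"

definition open_Rd :: "nat \<Rightarrow> (nat \<Rightarrow> real) set \<Rightarrow> bool" where
  "open_Rd d U \<longleftrightarrow> U \<subseteq> Rd d \<and> openin (top_of_set (Rd d)) U"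

fun pds :: "nat list \<Rightarrow> ((nat \<Rightarrow> real) \<Rightarrow> real) \<Rightarrow> (nat \<Rightarrow> real) \<Rightarrow> real" where
  "pds [] f = f"
| "pds (i # is) f = (\<lambda>x. deriv (\<lambda>t. pds is f (x(i := t))) (x i))"

definition smooth_fun_on :: "nat \<Rightarrow> (nat \<Rightarrow> real) set \<Rightarrow> ((nat \<Rightarrow> real) \<Rightarrow> real) \<Rightarrow> bool" where
  "smooth_fun_on d U f \<longleftrightarrow>
     (\<forall>is. set is \<subseteq> {..<d} \<longrightarrow>
        continuous_on U (pds is f) \<and>
        (\<forall>i<d. \<forall>x\<in>U. (\<lambda>t. pds is f (x(i := t))) differentiable (at (x i))))"

definition smooth_map_on :: "nat \<Rightarrow> nat \<Rightarrow> (nat \<Rightarrow> real) set \<Rightarrow> ((nat \<Rightarrow> real) \<Rightarrow> (nat \<Rightarrow> real)) \<Rightarrow> bool" where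
  "smooth_map_on d k U F \<longleftrightarrow> (\<forall>j<k. smooth_fun_on d U (\<lambda>x. F x j))"

definition pair_coords :: "nat \<Rightarrow> (nat \<Rightarrow> real) \<Rightarrow> (nat \<Rightarrow> real) \<Rightarrow> (nat \<Rightarrow> real)" where
  "pair_coords d x y = (\<lambda>i. if i < d then x i else y (i - d))"

definition fst_coords :: "nat \<Rightarrow> (nat \<Rightarrow> real) \<Rightarrow> (nat \<Rightarrow> real)" where
  "fst_coords d z = (\<lambda>i. if i < d then z i else 0)"

definition snd_coords :: "nat \<Rightarrow> (nat \<Rightarrow> real) \<Rightarrow> (nat \<Rightarrow> real)" where
  "snd_coords d z = (\<lambda>i. if i < d then z (i + d) else 0)"

definition is_chart :: "'a topology \<Rightarrow> nat \<Rightarrow> 'a set \<Rightarrow> ('a \<Rightarrow> nat \<Rightarrow> real) \<Rightarrow> bool" where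
  "is_chart T d U \<phi> \<longleftrightarrow> openin T U \<and> open_Rd d (\<phi> ` U) \<and>
     homeomorphic_map (subtopology T U) (top_of_set (\<phi> ` U)) \<phi>"

definition smooth_atlas :: "'a topology \<Rightarrow> nat \<Rightarrow> ('a set \<times> ('a \<Rightarrow> nat \<Rightarrow> real)) set \<Rightarrow> bool" where
  "smooth_atlas T d A \<longleftrightarrow>
     (\<forall>(U, \<phi>)\<in>A. is_chart T d U \<phi>) \<and>
     (\<Union>(U, \<phi>)\<in>A. U) = topspace T \<and>
     (\<forall>(U, \<phi>)\<in>A. \<forall>(W, \<psi>)\<in>A.
        smooth_map_on d d (\<phi> ` (U \<inter> W)) (\<lambda>x. \<psi> (inv_into U \<phi> x)))"

definition lie_group :: "'a monoid \<Rightarrow> 'a topology \<Rightarrow> bool" where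
  "lie_group G T \<longleftrightarrow>
     group G \<and> topspace T = carrier G \<and> Hausdorff_space T \<and> second_countable T \<and>
     continuous_map (prod_topology T T) T (\<lambda>(x, y). x \<otimes>\<^bsub>G\<^esub> y) \<and>
     continuous_map T T (\<lambda>x. inv\<^bsub>G\<^esub> x) \<and>
     (\<exists>d A. smooth_atlas T d A \<and>
        (\<forall>(U1, \<phi>1)\<in>A. \<forall>(U2, \<phi>2)\<in>A. \<forall>(W, \<psi>)\<in>A.
           smooth_map_on (2 * d) d
             {pair_coords d x y | x y. x \<in> \<phi>1 ` U1 \<and> y \<in> \<phi>2 ` U2 \<and>
                 inv_into U1 \<phi>1 x \<otimes>\<^bsub>G\<^esub> inv_into U2 \<phi>2 y \<in> W}
             (\<lambda>z. \<psi> (inv_into U1 \<phi>1 (fst_coords d z) \<otimes>\<^bsub>G\<^esub> inv_into U2 \<phi>2 (snd_coords d z)))) \<and>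
        (\<forall>(U, \<phi>)\<in>A. \<forall>(W, \<psi>)\<in>A.
           smooth_map_on d d {x \<in> \<phi> ` U. inv\<^bsub>G\<^esub> (inv_into U \<phi> x) \<in> W}
             (\<lambda>x. \<psi> (inv\<^bsub>G\<^esub> (inv_into U \<phi> x)))))"

definition compact_lie_group :: "'a monoid \<Rightarrow> 'a topology \<Rightarrow> bool" where
  "compact_lie_group G T \<longleftrightarrow> lie_group G T \<and> compact_space T"

text \<open>An n x n complex matrix is a function nat => nat => complex vanishing
  outside {..<n} x {..<n}.  The topology is the one inherited from the product
  topology on nat => nat => complex, i.e. the Euclidean topology on C^(n x n).\<close>

type_synonym cmat = "nat \<Rightarrow> nat \<Rightarrow> complex"

definition is_mat :: "nat \<Rightarrow> cmat \<Rightarrow> bool" where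
  "is_mat n A \<longleftrightarrow> (\<forall>i j. (n \<le> i \<or> n \<le> j) \<longrightarrow> A i j = 0)"

definition mat_mult :: "nat \<Rightarrow> cmat \<Rightarrow> cmat \<Rightarrow> cmat" where
  "mat_mult n A B = (\<lambda>i j. if i < n \<and> j < n then (\<Sum>k<n. A i k * B k j) else 0)"

definition mat_one :: "nat \<Rightarrow> cmat" where
  "mat_one n = (\<lambda>i j. if i < n \<and> j = i then 1 else 0)"

definition mat_adj :: "cmat \<Rightarrow> cmat" where
  "mat_adj A = (\<lambda>i j. cnj (A j i))"

definition mat_det :: "nat \<Rightarrow> cmat \<Rightarrow> complex" where
  "mat_det n A = (\<Sum>p\<in>{p. p permutes {..<n}}. of_int (sign p) * (\<Prod>i<n. A i (p i)))"

definition SU :: "nat \<Rightarrow> cmat set" where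
  "SU n = {A. is_mat n A \<and> mat_mult n A (mat_adj A) = mat_one n \<and> mat_det n A = 1}"

definition SU_rep :: "nat \<Rightarrow> nat \<Rightarrow> (cmat \<Rightarrow> cmat) \<Rightarrow> bool" where
  "SU_rep n m \<rho> \<longleftrightarrow>
     (\<forall>g\<in>SU n. is_mat m (\<rho> g)) \<and>
     (\<forall>g\<in>SU n. \<forall>h\<in>SU n. \<rho> (mat_mult n g h) = mat_mult m (\<rho> g) (\<rho> h)) \<and>
     \<rho> (mat_one n) = mat_one m \<and>
     continuous_on (SU n) \<rho>"

definition stabilizer :: "nat \<Rightarrow> nat \<Rightarrow> (cmat \<Rightarrow> cmat) \<Rightarrow> (nat \<Rightarrow> complex) \<Rightarrow> cmat set" where
  "stabilizer n m \<rho> v = {g \<in> SU n. \<forall>i<m. (\<Sum>j<m. \<rho> g i j * v j) = v i}"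

definition mat_group :: "nat \<Rightarrow> cmat set \<Rightarrow> cmat monoid" where
  "mat_group n S = \<lparr>carrier = S, mult = mat_mult n, one = mat_one n\<rparr>"

end

theory Submission
  imports Defs "HOL-Library.Function_Algebras" "Jordan_Normal_Form.Determinant"
begin

text \<open>
  Peter--Weyl: for \<open>g \<noteq> \<one>\<close> a convolution operator on the continuous real functions on \<open>H\<close> has a
  finite-dimensional eigenspace, stable under right translations, on which \<open>g\<close> acts nontrivially. As
  \<open>H\<close> has no small subgroups, finitely many of these spaces give a faithful orthogonal representation
  \<open>\<pi>\<close>, and \<open>\<pi> \<oplus> \<pi> \<oplus> 1\<close> embeds \<open>H\<close> as a closed subgroup \<open>K\<close> of \<open>SU(n)\<close>.

  The real polynomials in the matrix entries that vanish on \<open>K\<close> and are invariant under right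
  translation by \<open>K\<close> have no common zero in \<open>U(n)\<close> outside \<open>K\<close> (Stone--Weierstrass, followed by
  averaging over \<open>K\<close>). By Hilbert's basis theorem finitely many of them, \<open>q\<^sub>1, \<dots>, q\<^sub>r\<close>, suffice, and
  \<open>F = \<Sum> q\<^sub>i\<^sup>2\<close> is \<open>K\<close>-invariant with zero set \<open>K\<close>. Hence the stabilizer of \<open>F\<close> under right
  translation is \<open>K\<close>, and \<open>F\<close> lies in a finite-dimensional space of polynomials stable under right
  translation.
\<close>

section \<open>Averages and the Haar integral of a compact group\<close>

text \<open>Every integral used here, on \<open>H\<close> and on the unitary group, is von
  Neumann's: averages of finitely many right translates of a continuous function come uniformly
  close to a constant. It is defined on continuous functions only and no function space is
  completed, so eigenfunctions come from maximising a quadratic form; passing to the square of the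
  operator ensures that the eigenvalue found is positive. Real functions yield real orthogonal
  matrices, and they make a sum of squares vanish only where every summand does. That invariant
  polynomials cut out K is not enough, because a single vector has to be stabilized. Hence the
  infinite family is made finite and then condensed into one \<open>F\<close>: if g fixes
  \<open>F\<close>, evaluation at the identity shows that \<open>F\<close> vanishes at g, so g lies
  in K. The second half takes place in the unitary group, where no determinant has to be carried
  along, and is restricted to \<open>SU n\<close> at the end. The trivial summand of the embedding
  takes up any surplus in n, so twice the degree of \<pi> is a sufficient bound.\<close>

definition avg :: "'a list \<Rightarrow> ('a \<Rightarrow> real) \<Rightarrow> real" where
  "avg as h = (\<Sum>a\<leftarrow>as. h a) / real (length as)"

lemma avg_add: "avg as (\<lambda>a. f a + g a) = avg as f + avg as g"
  by (simp add: avg_def sum_list_addf add_divide_distrib)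

lemma avg_cmult: "avg as (\<lambda>a. c * f a) = c * avg as f"
  by (simp add: avg_def sum_list_const_mult)

lemma avg_const: "as \<noteq> [] \<Longrightarrow> avg as (\<lambda>a. c) = c"
  by (simp add: avg_def sum_list_triv)

lemma avg_mono:
  assumes "\<And>a. a \<in> set as \<Longrightarrow> f a \<le> g a"
  shows "avg as f \<le> avg as g"
  unfolding avg_def by (intro divide_right_mono sum_list_mono assms) auto

lemma avg_cong: "(\<And>a. a \<in> set as \<Longrightarrow> f a = g a) \<Longrightarrow> avg as f = avg as g"
  by (intro antisym avg_mono) auto

lemma avg_near:
  assumes "as \<noteq> []" and "\<And>a. a \<in> set as \<Longrightarrow> \<bar>f a - c\<bar> \<le> e"
  shows "\<bar>avg as f - c\<bar> \<le> e"
proof -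
  have "avg as f \<le> avg as (\<lambda>a. c + e)" "avg as (\<lambda>a. c - e) \<le> avg as f"
    using assms(2) by (fastforce intro!: avg_mono)+
  then show ?thesis using assms(1) by (simp add: avg_const)
qed

text \<open>A single value lying d below the common bound already costs the average d divided by the
  length. This is the gain in \<open>near_rmean_shrink\<close>; applied to -f it gives the positive
  lower bound in \<open>haar_pos\<close>.\<close>

lemma avg_le_drop:
  assumes "b \<in> set bs" "h b \<le> u - d" "\<And>x. x \<in> set bs \<Longrightarrow> h x \<le> u"
  shows "avg bs h \<le> u - d / real (length bs)"
proof -
  obtain xs ys where bs: "bs = xs @ b # ys" using assms(1) split_list by metis
  have "(\<Sum>x\<leftarrow>xs. h x) \<le> (\<Sum>x\<leftarrow>xs. u)" "(\<Sum>x\<leftarrow>ys. h x) \<le> (\<Sum>x\<leftarrow>ys. u)"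
    using assms(3) bs by (auto intro!: sum_list_mono)
  then have "(\<Sum>x\<leftarrow>bs. h x) \<le> real (length bs) * u - d"
    using assms(2) by (simp add: bs sum_list_triv algebra_simps)
  then have "avg bs h \<le> (real (length bs) * u - d) / real (length bs)"
    unfolding avg_def by (rule divide_right_mono) simp
  also have "\<dots> = u - d / real (length bs)" using bs by (simp add: diff_divide_distrib)
  finally show ?thesis .
qed

lemma avg_map: "avg (map g as) h = avg as (\<lambda>a. h (g a))"
  by (simp add: avg_def o_def)

text \<open>Lists count repetitions, so an average of averages is one average over all pairs, even
  where the products of different pairs coincide. Finite sets would lack this.\<close>

lemma avg_product: "avg (List.product as bs) (\<lambda>(a, b). h a b) = avg as (\<lambda>a. avg bs (h a))"
proof -
  have 1: "(\<Sum>(a, b)\<leftarrow>List.product as bs. h a b) = (\<Sum>a\<leftarrow>as. \<Sum>b\<leftarrow>bs. h a b)"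
    by (induction as) (simp_all add: o_def)
  have 2: "(\<Sum>a\<leftarrow>as. k a / real (length bs)) = (\<Sum>a\<leftarrow>as. k a) / real (length bs)" for k
    by (induction as) (simp_all add: add_divide_distrib)
  show ?thesis
    by (simp add: avg_def 1 2 length_product)
qed

lemma avg_swap: "avg as (\<lambda>a. avg bs (h a)) = avg bs (\<lambda>b. avg as (\<lambda>a. h a b))"
proof -
  have 1: "(\<Sum>a\<leftarrow>as. \<Sum>b\<leftarrow>bs. h a b) = (\<Sum>b\<leftarrow>bs. \<Sum>a\<leftarrow>as. h a b)"
    by (induction as) (simp_all add: sum_list_addf)
  have 2: "(\<Sum>a\<leftarrow>as. k a / real l) = (\<Sum>a\<leftarrow>as. k a) / real l" for k l and as :: "'z list"
    by (induction as) (simp_all add: add_divide_distrib)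
  show ?thesis
    by (simp add: avg_def 1 2)
qed

text \<open>\<open>X\<close> carries no metric, so uniformity in y comes from the tube lemma: the
  open set of pairs where F differs by less than e from its value over x0 contains the slice over
  x0, hence a tube around it.\<close>

lemma uniform_on_compact:
  fixes F :: "'a \<Rightarrow> 'b \<Rightarrow> real"
  assumes F: "continuous_map (prod_topology X Y) euclideanreal (\<lambda>(x, y). F x y)"
    and Y: "compact_space Y" and x0: "x0 \<in> topspace X" and e: "e > 0"
  obtains U where "openin X U" "x0 \<in> U" "\<And>x y. x \<in> U \<Longrightarrow> y \<in> topspace Y \<Longrightarrow> \<bar>F x y - F x0 y\<bar> < e"
proof -
  have F': "continuous_map (prod_topology X Y) euclideanreal (\<lambda>z. F (fst z) (snd z))"
    using F by (simp add: case_prod_unfold)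
  have "continuous_map (prod_topology X Y) (prod_topology X Y) (\<lambda>z. (x0, snd z))"
    using x0 by (intro continuous_intros) auto
  from continuous_map_compose[OF this F']
  have "continuous_map (prod_topology X Y) euclideanreal (\<lambda>z. F x0 (snd z))"
    by (simp add: o_def)
  then have "continuous_map (prod_topology X Y) euclideanreal (\<lambda>z. \<bar>F (fst z) (snd z) - F x0 (snd z)\<bar>)"
    by (intro continuous_intros F')
  then have W: "openin (prod_topology X Y)
      {z \<in> topspace (prod_topology X Y). \<bar>F (fst z) (snd z) - F x0 (snd z)\<bar> \<in> {..<e}}" (is "openin _ ?W")
    by (rule openin_continuous_map_preimage) auto
  have cY: "compactin Y (topspace Y)" using Y by (simp add: compact_space_def)
  have sub: "{x0} \<times> topspace Y \<subseteq> ?W" using x0 e by auto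
  obtain U V where UV: "openin X U" "openin Y V" "x0 \<in> U" "topspace Y \<subseteq> V" "U \<times> V \<subseteq> ?W"
    using tube_lemma_right[OF W cY x0 sub] by (elim exE conjE)
  have "\<bar>F x y - F x0 y\<bar> < e" if "x \<in> U" "y \<in> topspace Y" for x y
    using subsetD[OF UV(5), of "(x, y)"] UV(4) that by auto
  then show ?thesis using that UV by blast
qed

lemma continuous_map_fst': "continuous_map X (prod_topology Y Z) f \<Longrightarrow> continuous_map X Y (\<lambda>x. fst (f x))"
  using continuous_map_fst_of[of X Y Z f] by (simp add: o_def)

lemma continuous_map_snd': "continuous_map X (prod_topology Y Z) f \<Longrightarrow> continuous_map X Z (\<lambda>x. snd (f x))"
  using continuous_map_snd_of[of X Y Z f] by (simp add: o_def)

lemma continuous_map_realI: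
  fixes f :: "'a \<Rightarrow> real"
  assumes "\<And>x e. x \<in> topspace X \<Longrightarrow> e > 0 \<Longrightarrow> \<exists>U. openin X U \<and> x \<in> U \<and> (\<forall>y\<in>U. \<bar>f y - f x\<bar> < e)"
  shows "continuous_map X euclideanreal f"
  unfolding mtopology_is_euclidean[symmetric] Met_TC.continuous_map_to_metric
  using assms by (auto simp: dist_real_def abs_minus_commute)

section \<open>Compact groups and coverings by translates\<close>

locale compact_group = group G for G :: "('a, 'b) monoid_scheme" (structure) +
  fixes T :: "'a topology"
  assumes topspace [simp]: "topspace T = carrier G"
    and compact: "compact_space T"
    and hausdorff: "Hausdorff_space T"
    and mult_cont: "continuous_map (prod_topology T T) T (\<lambda>(x, y). x \<otimes> y)"
    and inv_cont: "continuous_map T T (\<lambda>x. inv x)"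
begin

abbreviation C :: "('a \<Rightarrow> real) \<Rightarrow> bool" where
  "C f \<equiv> continuous_map T euclideanreal f"

lemma continuous_map_mult [continuous_intros]:
  assumes "continuous_map X T f" "continuous_map X T g"
  shows "continuous_map X T (\<lambda>x. f x \<otimes> g x)"
  using continuous_map_compose[OF continuous_map_pairedI[OF assms] mult_cont] by (simp add: o_def)

lemma continuous_map_inv [continuous_intros]:
  "continuous_map X T f \<Longrightarrow> continuous_map X T (\<lambda>x. inv (f x))"
  using continuous_map_compose[OF _ inv_cont] by (auto simp add: o_def)

lemma C_comp: "C f \<Longrightarrow> continuous_map X T g \<Longrightarrow> continuous_map X euclideanreal (\<lambda>x. f (g x))"
  using continuous_map_compose[of X T g euclideanreal f] by (simp add: o_def)

lemma C_rtrans: "C f \<Longrightarrow> a \<in> carrier G \<Longrightarrow> C (\<lambda>x. f (x \<otimes> a))"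
  by (rule C_comp, assumption) (intro continuous_intros, auto)

lemma C_ltrans: "C f \<Longrightarrow> a \<in> carrier G \<Longrightarrow> C (\<lambda>x. f (a \<otimes> x))"
  by (rule C_comp, assumption) (intro continuous_intros, auto)

lemma C_inv: "C f \<Longrightarrow> C (\<lambda>x. f (inv x))"
  by (rule C_comp[OF _ inv_cont])

lemma C_bounded:
  assumes "C f"
  obtains K where "K > 0" "\<And>x. x \<in> carrier G \<Longrightarrow> \<bar>f x\<bar> \<le> K"
proof -
  have "compact (f ` carrier G)"
    using image_compactin[OF _ assms, of "carrier G"] compact by (simp add: compact_space_def)
  then obtain K where "\<forall>y\<in>f ` carrier G. norm y \<le> K"
    using compact_imp_bounded bounded_iff by metis
  then show ?thesis by (intro that[of "max K 1"]) (auto simp: le_max_iff_disj)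
qed

lemma finite_subcover:
  assumes "\<And>x. x \<in> carrier G \<Longrightarrow> openin T (U x) \<and> x \<in> U x"
  obtains X where "finite X" "X \<subseteq> carrier G" "carrier G \<subseteq> (\<Union>x\<in>X. U x)"
proof -
  have "\<forall>W\<in>U ` carrier G. openin T W" "carrier G \<subseteq> \<Union>(U ` carrier G)" using assms by auto
  then obtain \<F> where F: "finite \<F>" "\<F> \<subseteq> U ` carrier G" "carrier G \<subseteq> \<Union>\<F>"
    using compact unfolding compact_space_alt by (metis topspace)
  from finite_subset_image[OF F(1,2)] obtain X where "X \<subseteq> carrier G" "finite X" "\<F> = U ` X"
    by blast
  with F(3) show ?thesis by (intro that[of X]) auto
qed

text \<open>Right translation by \<open>inv x \<otimes> u\<close> moves x to u and a neighbourhood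
  of x into U; compactness leaves finitely many such elements. One finite set for all x is what
  makes averages improve uniformly.\<close>

lemma translates_cover:
  assumes "openin T U" "u \<in> U"
  obtains B where "finite B" "B \<subseteq> carrier G" "\<And>x. x \<in> carrier G \<Longrightarrow> \<exists>b\<in>B. x \<otimes> b \<in> U"
proof -
  have u: "u \<in> carrier G" using assms openin_subset by fastforce
  let ?b = "\<lambda>x. inv x \<otimes> u"
  let ?V = "\<lambda>x. {y \<in> carrier G. y \<otimes> ?b x \<in> U}"
  have "openin T (?V x) \<and> x \<in> ?V x" if x: "x \<in> carrier G" for x
  proof -
    have "continuous_map T T (\<lambda>y. y \<otimes> ?b x)"
      using x u by (intro continuous_intros) auto
    from openin_continuous_map_preimage[OF this assms(1)]
    show ?thesis using x u assms(2) by (simp add: inv_solve_left m_assoc[symmetric])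
  qed
  then obtain X where X: "finite X" "X \<subseteq> carrier G" "carrier G \<subseteq> (\<Union>x\<in>X. ?V x)"
    using finite_subcover[of ?V] by blast
  show ?thesis
    by (rule that[of "?b ` X"]) (use X u in auto)
qed

section \<open>Von Neumann's approximate means\<close>

definition near_rmean :: "('a \<Rightarrow> real) \<Rightarrow> real \<Rightarrow> real \<Rightarrow> bool" where
  "near_rmean f c e \<longleftrightarrow> (\<exists>as. as \<noteq> [] \<and> set as \<subseteq> carrier G \<and>
     (\<forall>x\<in>carrier G. \<bar>avg as (\<lambda>a. f (x \<otimes> a)) - c\<bar> \<le> e))"

definition near_lmean :: "('a \<Rightarrow> real) \<Rightarrow> real \<Rightarrow> real \<Rightarrow> bool" where
  "near_lmean f c e \<longleftrightarrow> (\<exists>as. as \<noteq> [] \<and> set as \<subseteq> carrier G \<and>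
     (\<forall>x\<in>carrier G. \<bar>avg as (\<lambda>a. f (a \<otimes> x)) - c\<bar> \<le> e))"

lemma near_rmean_mono: "near_rmean f c e \<Longrightarrow> \<bar>c - d\<bar> + e \<le> e' \<Longrightarrow> near_rmean f d e'"
  unfolding near_rmean_def by force

lemma near_lmean_mono: "near_lmean f c e \<Longrightarrow> \<bar>c - d\<bar> + e \<le> e' \<Longrightarrow> near_lmean f d e'"
  unfolding near_lmean_def by force

lemma near_rmean_cong:
  assumes "\<And>x. x \<in> carrier G \<Longrightarrow> f x = g x"
  shows "near_rmean f c e \<longleftrightarrow> near_rmean g c e"
proof -
  have "avg as (\<lambda>a. f (x \<otimes> a)) = avg as (\<lambda>a. g (x \<otimes> a))" if "x \<in> carrier G" "set as \<subseteq> carrier G" for x as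
    using that assms by (intro avg_cong) auto
  then show ?thesis unfolding near_rmean_def by (intro ex_cong1) (auto simp: Ball_def)
qed

lemma near_lmean_cong:
  assumes "\<And>x. x \<in> carrier G \<Longrightarrow> f x = g x"
  shows "near_lmean f c e \<longleftrightarrow> near_lmean g c e"
proof -
  have "avg as (\<lambda>a. f (a \<otimes> x)) = avg as (\<lambda>a. g (a \<otimes> x))" if "x \<in> carrier G" "set as \<subseteq> carrier G" for x as
    using that assms by (intro avg_cong) auto
  then show ?thesis unfolding near_lmean_def by (intro ex_cong1) (auto simp: Ball_def)
qed

text \<open>If all right averages \<open>g\<close> of \<open>f\<close> oscillate by at least \<open>r\<close>, equicontinuity gives one list of
  translations that lowers the maximum of every such \<open>g\<close> by a fixed proportion of its oscillation.\<close>
lemma near_rmean_shrink: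
  assumes f: "C f" and r: "r > 0"
  obtains q where "0 \<le> q" "q < 1" "\<And>s c. s \<ge> r \<Longrightarrow> near_rmean f c s \<Longrightarrow> \<exists>c'. near_rmean f c' (q * s)"
proof -
  have FC: "continuous_map (prod_topology T T) euclideanreal (\<lambda>(x, a). f (x \<otimes> a))"
    using C_comp[OF f mult_cont] by (simp add: case_prod_unfold)
  have "\<exists>U. openin T U \<and> z \<in> U \<and> (\<forall>x\<in>U. \<forall>a\<in>carrier G. \<bar>f (x \<otimes> a) - f (z \<otimes> a)\<bar> \<le> r / 4)"
    if z: "z \<in> carrier G" for z
  proof -
    have "z \<in> topspace T" "r / 4 > 0" using z r by auto
    from uniform_on_compact[OF FC compact this] show ?thesis by (metis less_imp_le topspace)
  qed
  then obtain U where U: "\<And>z. z \<in> carrier G \<Longrightarrow> openin T (U z) \<and> z \<in> U z"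
    and Ua: "\<And>z x a. z \<in> carrier G \<Longrightarrow> x \<in> U z \<Longrightarrow> a \<in> carrier G \<Longrightarrow> \<bar>f (x \<otimes> a) - f (z \<otimes> a)\<bar> \<le> r / 4"
    by metis
  obtain X where X: "finite X" "X \<subseteq> carrier G" "carrier G \<subseteq> (\<Union>x\<in>X. U x)"
    using finite_subcover U by blast
  have "\<exists>B. finite B \<and> B \<subseteq> carrier G \<and> (\<forall>x\<in>carrier G. \<exists>b\<in>B. x \<otimes> b \<in> U z)" if z: "z \<in> X" for z
  proof -
    have "openin T (U z)" "z \<in> U z" using U X z by auto
    from translates_cover[OF this] show ?thesis by metis
  qed
  then obtain B where B: "\<And>z. z \<in> X \<Longrightarrow> finite (B z)" "\<And>z. z \<in> X \<Longrightarrow> B z \<subseteq> carrier G"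
      "\<And>z x. z \<in> X \<Longrightarrow> x \<in> carrier G \<Longrightarrow> \<exists>b\<in>B z. x \<otimes> b \<in> U z"
    by metis
  have "finite (\<Union>z\<in>X. B z)" using X B by auto
  then obtain bs where bs: "set bs = (\<Union>z\<in>X. B z)" using finite_list by blast
  have bsG: "set bs \<subseteq> carrier G" using bs B by auto
  have bs1: "bs \<noteq> []"
  proof -
    have "\<one> \<in> (\<Union>x\<in>X. U x)" using X one_closed by blast
    then obtain z where "z \<in> X" by blast
    then show ?thesis using B(3)[of z \<one>] bs by fastforce
  qed
  define N where "N = real (length bs)"
  have N: "N \<ge> 1" using bs1 by (simp add: N_def Suc_le_eq)
  \<comment> \<open>Lowering the upper end of [c - s, c + s] by (s / 2) / N leaves an interval with
    centre c - s / (4 * N) and half-length q * s.\<close>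
  define q where "q = 1 - 1 / (4 * N)"
  have q: "0 \<le> q" "q < 1" "q \<ge> 3/4" using N by (auto simp: q_def field_simps)
  have "\<exists>c'. near_rmean f c' (q * s)" if s: "s \<ge> r" and near: "near_rmean f c s" for s c
  proof -
    obtain as where as: "as \<noteq> []" "set as \<subseteq> carrier G"
      and asf: "\<And>x. x \<in> carrier G \<Longrightarrow> \<bar>avg as (\<lambda>a. f (x \<otimes> a)) - c\<bar> \<le> s"
      using near unfolding near_rmean_def by blast
    define g where "g = (\<lambda>x. avg as (\<lambda>a. f (x \<otimes> a)))"
    have gU: "\<bar>g x - g z\<bar> \<le> r / 4" if "z \<in> carrier G" "x \<in> U z" for x z
    proof -
      have "g x - g z = avg as (\<lambda>a. f (x \<otimes> a) - f (z \<otimes> a))"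
        using avg_add[of as "\<lambda>a. f (x \<otimes> a)" "\<lambda>a. (-1) * f (z \<otimes> a)"]
        unfolding g_def avg_cmult by simp
      then show ?thesis
        using avg_near[of as "\<lambda>a. f (x \<otimes> a) - f (z \<otimes> a)" 0 "r/4"] Ua that as by force
    qed
    show ?thesis
    proof (cases "\<exists>x\<in>carrier G. g x \<le> c")
      \<comment> \<open>Here g stays above c, so the interval is halved without any new translation;
        q \<ge> 3/4 covers the factor 1/2.\<close>
      case False
      have "near_rmean f (c + s/2) (s/2)"
        unfolding near_rmean_def
      proof (intro exI[of _ as] conjI as(1) as(2) ballI)
        fix x assume "x \<in> carrier G"
        then have "c \<le> g x" "g x \<le> c + s" using False asf[of x] by (auto simp: g_def)
        then show "\<bar>avg as (\<lambda>a. f (x \<otimes> a)) - (c + s/2)\<bar> \<le> s/2"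
          unfolding g_def abs_le_iff by linarith
      qed
      moreover have "s / 2 \<le> q * s" using mult_right_mono[OF q(3), of s] s r by linarith
      ultimately show ?thesis using near_rmean_mono[of f "c + s / 2" "s / 2" "c + s / 2" "q * s"] by auto
    next
      case True
      then obtain y where y: "y \<in> carrier G" "g y \<le> c" by blast
      obtain z where z: "z \<in> X" "y \<in> U z" using X y by blast
      have zG: "z \<in> carrier G" using z X by auto
      \<comment> \<open>Both x and y lie in U z, so g x exceeds g y by at most r / 4 + r / 4 \<le> s
        / 2. This is where s \<ge> r enters.\<close>
      have low: "g x \<le> c + s / 2" if "x \<in> U z" for x
        using gU[OF zG that] gU[OF zG z(2)] y s r by linarith
      have "near_rmean f (c - s / (4 * N)) (q * s)"
        unfolding near_rmean_def
      proof (intro exI conjI ballI)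
        fix x assume x: "x \<in> carrier G"
        let ?h = "\<lambda>b. g (x \<otimes> b)"
        have eq: "avg (List.product bs as) (\<lambda>(b, a). f (x \<otimes> (b \<otimes> a))) = avg bs ?h"
          unfolding avg_product g_def using x bsG as by (intro avg_cong) (auto simp: m_assoc subset_iff)
        have h: "c - s \<le> ?h b" "?h b \<le> c + s" if "b \<in> set bs" for b
          using asf[of "x \<otimes> b"] x bsG that by (force simp: g_def abs_le_iff)+
        obtain b where b: "b \<in> B z" "x \<otimes> b \<in> U z" using B(3)[OF z(1) x] by blast
        have "avg bs ?h \<le> c + s - (s / 2) / real (length bs)"
          using h(2) low[OF b(2)] b(1) z(1) bs s r by (intro avg_le_drop[of b]) auto
        moreover have "c - s \<le> avg bs ?h"
          using avg_mono[of bs "\<lambda>_. c - s" ?h] h(1) bs1 by (simp add: avg_const)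
        ultimately have "\<bar>avg bs ?h - (c - s / (4 * N))\<bar> \<le> q * s"
          by (simp add: N_def[symmetric] q_def abs_le_iff algebra_simps)
        then show "\<bar>avg (map (\<lambda>(b, a). b \<otimes> a) (List.product bs as)) (\<lambda>a. f (x \<otimes> a)) - (c - s / (4 * N))\<bar> \<le> q * s"
          using eq by (simp add: avg_map case_prod_unfold)
      next
        show "map (\<lambda>(b, a). b \<otimes> a) (List.product bs as) \<noteq> []"
          using as bs1 by (cases as; cases bs) auto
        show "set (map (\<lambda>(b, a). b \<otimes> a) (List.product bs as)) \<subseteq> carrier G"
          using as bsG by auto
      qed
      then show ?thesis by blast
    qed
  qed
  then show ?thesis using that q by blast
qed

text \<open>The factor q depends only on the threshold e. If no mean with error e existed, all
  errors would stay at or above the threshold and the shrinking could be repeated forever, although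
  \<open>q ^ n * K\<close> tends to 0.\<close>

lemma near_rmean_exists:
  assumes f: "C f" and e: "e > 0"
  shows "\<exists>c. near_rmean f c e"
proof (rule ccontr)
  assume no: "\<not> (\<exists>c. near_rmean f c e)"
  obtain q where q: "0 \<le> q" "q < 1" "\<And>s c. s \<ge> e \<Longrightarrow> near_rmean f c s \<Longrightarrow> \<exists>c'. near_rmean f c' (q * s)"
    using near_rmean_shrink[OF f e] by metis
  obtain K where K: "K > 0" "\<And>x. x \<in> carrier G \<Longrightarrow> \<bar>f x\<bar> \<le> K" using C_bounded[OF f] by metis
  have large: "s \<ge> e" if "near_rmean f c s" for c s
    using no near_rmean_mono[OF that, of c e] by force
  have "\<exists>c. near_rmean f c (q ^ n * K)" for n
  proof (induction n)
    case 0
    have "near_rmean f 0 K"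
      unfolding near_rmean_def using K by (intro exI[of _ "[\<one>]"]) (auto simp: avg_def)
    then show ?case by auto
  next
    case (Suc n)
    then obtain c where "near_rmean f c (q ^ n * K)" by blast
    from q(3)[OF large[OF this] this] show ?case by (simp add: mult.assoc)
  qed
  then have "q ^ n * K \<ge> e" for n using large by blast
  moreover have "(\<lambda>n. q ^ n * K) \<longlonglongrightarrow> 0 * K"
    using q by (intro tendsto_mult_right LIMSEQ_realpow_zero)
  ultimately have "e \<le> 0"
    by (intro LIMSEQ_le_const[of "\<lambda>n. q ^ n * K" "0"]) auto
  then show False using e by simp
qed

lemma near_lmean_inv:
  assumes "near_rmean f c e"
  shows "near_lmean (\<lambda>x. f (inv x)) c e"
proof -
  obtain as where as: "as \<noteq> []" "set as \<subseteq> carrier G"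
      "\<And>x. x \<in> carrier G \<Longrightarrow> \<bar>avg as (\<lambda>a. f (x \<otimes> a)) - c\<bar> \<le> e"
    using assms unfolding near_rmean_def by blast
  have "avg (map (\<lambda>a. inv a) as) (\<lambda>a. f (inv (a \<otimes> x))) = avg as (\<lambda>a. f (inv x \<otimes> a))"
    if "x \<in> carrier G" for x
    unfolding avg_map using that as(2) by (intro avg_cong) (simp add: inv_mult_group subset_iff)
  then show ?thesis
    unfolding near_lmean_def using as by (intro exI[of _ "map (\<lambda>a. inv a) as"]) auto
qed

lemma near_lmean_exists:
  assumes "C f" "e > 0"
  shows "\<exists>c. near_lmean f c e"
proof -
  obtain c where "near_rmean (\<lambda>x. f (inv x)) c e"
    using near_rmean_exists[OF C_inv[OF assms(1)] assms(2)] by blast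
  from near_lmean_inv[OF this] have "near_lmean (\<lambda>x. f (inv (inv x))) c e" .
  then show ?thesis using near_lmean_cong[of "\<lambda>x. f (inv (inv x))" f] by auto
qed

text \<open>Averaging \<open>f (b \<otimes> a)\<close> over both lists gives one number, near c when
  a is averaged first and near d when b is. So left and right means share their limit; uniqueness
  and two-sided invariance come from here.\<close>

lemma near_rmean_lmean:
  assumes "near_rmean f c e" "near_lmean f d e'"
  shows "\<bar>c - d\<bar> \<le> e + e'"
proof -
  obtain as where as: "as \<noteq> []" "set as \<subseteq> carrier G"
      "\<And>x. x \<in> carrier G \<Longrightarrow> \<bar>avg as (\<lambda>a. f (x \<otimes> a)) - c\<bar> \<le> e"
    using assms(1) unfolding near_rmean_def by blast
  obtain bs where bs: "bs \<noteq> []" "set bs \<subseteq> carrier G"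
      "\<And>x. x \<in> carrier G \<Longrightarrow> \<bar>avg bs (\<lambda>b. f (b \<otimes> x)) - d\<bar> \<le> e'"
    using assms(2) unfolding near_lmean_def by blast
  have "\<bar>avg bs (\<lambda>b. avg as (\<lambda>a. f (b \<otimes> a))) - c\<bar> \<le> e"
    using as bs by - (rule avg_near, auto)
  moreover have "\<bar>avg as (\<lambda>a. avg bs (\<lambda>b. f (b \<otimes> a))) - d\<bar> \<le> e'"
    using as bs by - (rule avg_near, auto)
  ultimately show ?thesis using avg_swap[of bs as "\<lambda>b a. f (b \<otimes> a)"] by linarith
qed

section \<open>The invariant integral on continuous functions\<close>

definition haar :: "('a \<Rightarrow> real) \<Rightarrow> real" where
  "haar f = Sup {c - e | c e. near_rmean f c e}"

text \<open>Every left mean bounds, up to its error, the set whose supremum is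
  \<open>haar f\<close>. The supremum is therefore squeezed between right and left means, and no
  sequence of approximations has to be chosen.\<close>

lemma haar_rmean:
  assumes "C f" "near_rmean f c e"
  shows "\<bar>haar f - c\<bar> \<le> e"
proof -
  let ?S = "{c - e | c e. near_rmean f c e}"
  have ub: "x \<le> d + e'" if "x \<in> ?S" "near_lmean f d e'" for x d e'
    using that near_rmean_lmean by fastforce
  obtain d1 where "near_lmean f d1 1" using near_lmean_exists[OF assms(1), of 1] by auto
  then have bdd: "bdd_above ?S" using ub by (meson bdd_aboveI)
  have "c - e \<in> ?S" using assms(2) by blast
  then have lo: "c - e \<le> haar f" unfolding haar_def using bdd by (rule cSup_upper)
  have "haar f \<le> c + e + 2 * h" if h: "h > 0" for h
  proof -
    obtain d where d: "near_lmean f d h" using near_lmean_exists[OF assms(1) h] by auto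
    have "haar f \<le> d + h" unfolding haar_def using \<open>c - e \<in> ?S\<close> ub d by (intro cSup_least) blast+
    also have "\<dots> \<le> c + e + 2 * h" using near_rmean_lmean[OF assms(2) d] by linarith
    finally show ?thesis .
  qed
  then have "haar f \<le> c + e"
    using field_le_epsilon[of "haar f" "c + e"] by (metis half_gt_zero mult_2 field_sum_of_halves)
  with lo show ?thesis by linarith
qed

lemma haar_near_rmean:
  assumes "C f" "e > 0"
  shows "near_rmean f (haar f) e"
proof -
  obtain c where c: "near_rmean f c (e / 2)" using near_rmean_exists[OF assms(1), of "e / 2"] assms(2) by auto
  show ?thesis using near_rmean_mono[OF c] haar_rmean[OF assms(1) c] by (simp add: abs_minus_commute)
qed

lemma haar_lmean:
  assumes "C f" "near_lmean f d e"
  shows "\<bar>haar f - d\<bar> \<le> e"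
proof (rule field_le_epsilon)
  fix h :: real assume "h > 0"
  from near_rmean_lmean[OF haar_near_rmean[OF assms(1) this] assms(2)]
  show "\<bar>haar f - d\<bar> \<le> e + h" by simp
qed

lemma haar_near_lmean:
  assumes "C f" "e > 0"
  shows "near_lmean f (haar f) e"
proof -
  obtain c where c: "near_lmean f c (e / 2)" using near_lmean_exists[OF assms(1), of "e / 2"] assms(2) by auto
  show ?thesis using near_lmean_mono[OF c] haar_lmean[OF assms(1) c] by (simp add: abs_minus_commute)
qed

lemma abs_le_all_imp_eq: "(\<And>e. e > 0 \<Longrightarrow> \<bar>a - b\<bar> \<le> e) \<Longrightarrow> a = (b::real)"
  using field_le_epsilon[of "\<bar>a - b\<bar>" 0] by simp

lemma haar_eqI_rmean:
  assumes "C f" "\<And>e. e > 0 \<Longrightarrow> near_rmean f c (k * e)"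
  shows "haar f = c"
proof (rule abs_le_all_imp_eq)
  fix e :: real assume e: "e > 0"
  define h where "h = e / (\<bar>k\<bar> + 1)"
  have h: "h > 0" "(\<bar>k\<bar> + 1) * h = e" using e by (auto simp: h_def)
  have "\<bar>haar f - c\<bar> \<le> k * h" using haar_rmean assms h(1) by blast
  also have "\<dots> \<le> (\<bar>k\<bar> + 1) * h" using h(1) by (intro mult_right_mono) auto
  finally show "\<bar>haar f - c\<bar> \<le> e" using h by simp
qed

lemma haar_eqI_lmean:
  assumes "C f" "\<And>e. e > 0 \<Longrightarrow> near_lmean f c e"
  shows "haar f = c"
  using haar_lmean[OF assms(1,2)] by (rule abs_le_all_imp_eq)

lemma haar_cong:
  assumes "\<And>x. x \<in> carrier G \<Longrightarrow> f x = g x"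
  shows "haar f = haar g"
  using near_rmean_cong[of f g] assms by (simp add: haar_def)

lemma C_avg:
  assumes "\<And>a. a \<in> set as \<Longrightarrow> C (\<lambda>x. F x a)"
  shows "C (\<lambda>x. avg as (F x))"
proof -
  have "C (\<lambda>x. \<Sum>a\<leftarrow>as. F x a)"
    using assms by (induction as) (auto intro!: continuous_intros)
  then have "C (\<lambda>x. (\<Sum>a\<leftarrow>as. F x a) * inverse (real (length as)))"
    by (rule continuous_map_real_mult_right)
  then show ?thesis by (simp add: avg_def divide_inverse)
qed

text \<open>Left averages commute with right averages, so a list whose left average makes f nearly
  constant does the same for a right average of f, with the same constant.\<close>

lemma haar_ravg:
  assumes f: "C f" and as: "as \<noteq> []" "set as \<subseteq> carrier G"
  shows "haar (\<lambda>x. avg as (\<lambda>a. f (x \<otimes> a))) = haar f"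
proof (rule haar_eqI_lmean)
  show "C (\<lambda>x. avg as (\<lambda>a. f (x \<otimes> a)))" using f as by (intro C_avg C_rtrans) auto
  fix e :: real assume "e > 0"
  from haar_near_lmean[OF f this] obtain bs where bs: "bs \<noteq> []" "set bs \<subseteq> carrier G"
      "\<And>x. x \<in> carrier G \<Longrightarrow> \<bar>avg bs (\<lambda>b. f (b \<otimes> x)) - haar f\<bar> \<le> e"
    unfolding near_lmean_def by blast
  have "\<bar>avg bs (\<lambda>b. avg as (\<lambda>a. f (b \<otimes> x \<otimes> a))) - haar f\<bar> \<le> e" if x: "x \<in> carrier G" for x
  proof -
    have "avg bs (\<lambda>b. avg as (\<lambda>a. f (b \<otimes> x \<otimes> a))) = avg as (\<lambda>a. avg bs (\<lambda>b. f (b \<otimes> (x \<otimes> a))))"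
      unfolding avg_swap[of bs as] using x as bs(2) by (intro avg_cong) (simp add: m_assoc subset_iff)
    also have "\<bar>\<dots> - haar f\<bar> \<le> e" using as bs x by - (rule avg_near, auto)
    finally show ?thesis .
  qed
  then show "near_lmean (\<lambda>x. avg as (\<lambda>a. f (x \<otimes> a))) (haar f) e"
    unfolding near_lmean_def using bs by blast
qed

text \<open>A list that is good for f need not be good for g. So \<open>as\<close> is chosen for f,
  then \<open>bs\<close> for the \<open>as\<close>-average of g, which by \<open>haar_ravg\<close>
  has the integral of g; averaging over \<open>bs\<close> cannot spoil the estimate for f, which
  holds at every point.\<close>

lemma haar_add:
  assumes f: "C f" and g: "C g"
  shows "haar (\<lambda>x. f x + g x) = haar f + haar g"
proof (rule haar_eqI_rmean[where k = 2])
  show "C (\<lambda>x. f x + g x)" using f g by (intro continuous_intros)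
  fix e :: real assume e: "e > 0"
  from haar_near_rmean[OF f e] obtain as where as: "as \<noteq> []" "set as \<subseteq> carrier G"
      "\<And>x. x \<in> carrier G \<Longrightarrow> \<bar>avg as (\<lambda>a. f (x \<otimes> a)) - haar f\<bar> \<le> e"
    unfolding near_rmean_def by blast
  let ?g = "\<lambda>x. avg as (\<lambda>a. g (x \<otimes> a))"
  have "C ?g" using g as by (intro C_avg C_rtrans) auto
  from haar_near_rmean[OF this e] obtain bs where bs: "bs \<noteq> []" "set bs \<subseteq> carrier G"
      "\<And>x. x \<in> carrier G \<Longrightarrow> \<bar>avg bs (\<lambda>b. ?g (x \<otimes> b)) - haar g\<bar> \<le> e"
    unfolding near_rmean_def haar_ravg[OF g as(1,2)] by blast
  let ?cs = "map (\<lambda>(b, a). b \<otimes> a) (List.product bs as)"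
  have eq: "avg ?cs (\<lambda>c. h (x \<otimes> c)) = avg bs (\<lambda>b. avg as (\<lambda>a. h (x \<otimes> b \<otimes> a)))"
    if "x \<in> carrier G" for x and h :: "'a \<Rightarrow> real"
  proof -
    have "avg ?cs (\<lambda>c. h (x \<otimes> c)) = avg (List.product bs as) (\<lambda>(b, a). h (x \<otimes> (b \<otimes> a)))"
      by (simp add: avg_map case_prod_unfold)
    also have "\<dots> = avg bs (\<lambda>b. avg as (\<lambda>a. h (x \<otimes> b \<otimes> a)))"
      unfolding avg_product using that as(2) bs(2) by (intro avg_cong) (simp add: m_assoc subset_iff)
    finally show ?thesis .
  qed
  show "near_rmean (\<lambda>x. f x + g x) (haar f + haar g) (2 * e)"
    unfolding near_rmean_def
  proof (intro exI[of _ ?cs] conjI ballI)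
    show "?cs \<noteq> []" using as(1) bs(1) by (cases as; cases bs) auto
    show "set ?cs \<subseteq> carrier G" using as(2) bs(2) by auto
    fix x assume x: "x \<in> carrier G"
    have "\<bar>avg bs (\<lambda>b. avg as (\<lambda>a. f (x \<otimes> b \<otimes> a))) - haar f\<bar> \<le> e"
      using as bs x by - (rule avg_near, auto)
    then show "\<bar>avg ?cs (\<lambda>c. f (x \<otimes> c) + g (x \<otimes> c)) - (haar f + haar g)\<bar> \<le> 2 * e"
      using bs(3)[OF x] eq[OF x, of f] eq[OF x, of g] unfolding avg_add by linarith
  qed
qed

lemma haar_cmult:
  assumes f: "C f"
  shows "haar (\<lambda>x. c * f x) = c * haar f"
proof (rule haar_eqI_rmean[where k = "\<bar>c\<bar>"])
  show "C (\<lambda>x. c * f x)" using f by (rule continuous_map_real_mult_left)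
  fix e :: real assume e: "e > 0"
  have "\<bar>c * y - c * haar f\<bar> \<le> \<bar>c\<bar> * e" if "\<bar>y - haar f\<bar> \<le> e" for y
    using mult_left_mono[OF that, of "\<bar>c\<bar>"] by (simp add: abs_mult[symmetric] right_diff_distrib)
  then show "near_rmean (\<lambda>x. c * f x) (c * haar f) (\<bar>c\<bar> * e)"
    using haar_near_rmean[OF f e] unfolding near_rmean_def avg_cmult by blast
qed

lemma haar_const [simp]: "haar (\<lambda>x. c) = c"
proof (rule haar_eqI_rmean[where k = 1])
  fix e :: real assume "e > 0"
  then show "near_rmean (\<lambda>x. c) c (1 * e)"
    unfolding near_rmean_def by (intro exI[of _ "[\<one>]"]) (auto simp: avg_def)
qed auto

lemma haar_nonneg:
  assumes f: "C f" and "\<And>x. x \<in> carrier G \<Longrightarrow> 0 \<le> f x"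
  shows "0 \<le> haar f"
proof (rule field_le_epsilon)
  fix e :: real assume "e > 0"
  from haar_near_rmean[OF f this] obtain as where as: "as \<noteq> []" "set as \<subseteq> carrier G"
      "\<And>x. x \<in> carrier G \<Longrightarrow> \<bar>avg as (\<lambda>a. f (x \<otimes> a)) - haar f\<bar> \<le> e"
    unfolding near_rmean_def by blast
  have "avg as (\<lambda>_. 0) \<le> avg as (\<lambda>a. f (\<one> \<otimes> a))"
    using as assms(2) by (intro avg_mono) auto
  then have "0 \<le> avg as (\<lambda>a. f (\<one> \<otimes> a))"
    using as(1) by (simp add: avg_const)
  then show "0 \<le> haar f + e" using as(3)[of \<one>] by auto
qed

lemma haar_diff:
  assumes "C f" "C g"
  shows "haar (\<lambda>x. f x - g x) = haar f - haar g"
  using haar_add[OF assms(1) continuous_map_real_mult_left[OF assms(2)], of "-1"]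
    haar_cmult[OF assms(2), of "-1"] by simp

lemma haar_mono:
  assumes "C f" "C g" "\<And>x. x \<in> carrier G \<Longrightarrow> f x \<le> g x"
  shows "haar f \<le> haar g"
  using haar_nonneg[of "\<lambda>x. g x - f x"] haar_diff[OF assms(2,1)] assms by (force intro: continuous_intros)

lemma haar_abs_le:
  assumes f: "C f" and "\<And>x. x \<in> carrier G \<Longrightarrow> \<bar>f x\<bar> \<le> K"
  shows "\<bar>haar f\<bar> \<le> K"
proof -
  have "haar f \<le> haar (\<lambda>_. K)" "haar (\<lambda>_. - K) \<le> haar f"
    using assms by (intro haar_mono; force simp: abs_le_iff)+
  then show ?thesis by simp
qed

lemma haar_sum:
  assumes "finite I" "\<And>i. i \<in> I \<Longrightarrow> C (f i)"
  shows "haar (\<lambda>x. \<Sum>i\<in>I. f i x) = (\<Sum>i\<in>I. haar (f i))"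
  using assms
proof (induction I rule: finite_induct)
  case (insert i I)
  then show ?case using haar_add[of "f i" "\<lambda>x. \<Sum>i\<in>I. f i x"] by (simp add: continuous_map_sum)
qed simp

lemma haar_rtrans:
  assumes f: "C f" and a: "a \<in> carrier G"
  shows "haar (\<lambda>x. f (x \<otimes> a)) = haar f"
  using haar_ravg[OF f, of "[a]"] a by (simp add: avg_def)

lemma haar_ltrans:
  assumes f: "C f" and a: "a \<in> carrier G"
  shows "haar (\<lambda>x. f (a \<otimes> x)) = haar f"
proof (rule haar_eqI_rmean[where k = 1])
  show "C (\<lambda>x. f (a \<otimes> x))" using f a by (rule C_ltrans)
  fix e :: real assume e: "e > 0"
  from haar_near_rmean[OF f e] obtain as where as: "as \<noteq> []" "set as \<subseteq> carrier G"
      "\<And>x. x \<in> carrier G \<Longrightarrow> \<bar>avg as (\<lambda>a. f (x \<otimes> a)) - haar f\<bar> \<le> e"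
    unfolding near_rmean_def by blast
  have "avg as (\<lambda>b. f (a \<otimes> (x \<otimes> b))) = avg as (\<lambda>b. f ((a \<otimes> x) \<otimes> b))" if "x \<in> carrier G" for x
    using that a as(2) by (intro avg_cong) (simp add: m_assoc subset_iff)
  then show "near_rmean (\<lambda>x. f (a \<otimes> x)) (haar f) (1 * e)"
    unfolding near_rmean_def using as a by (intro exI[of _ as]) auto
qed

text \<open>Every point can be moved by one of finitely many translations into the open set where f
  exceeds f y / 2. Hence some right average of f, which has the same integral, is bounded below by a
  positive constant.\<close>

lemma haar_pos:
  assumes f: "C f" and nn: "\<And>x. x \<in> carrier G \<Longrightarrow> 0 \<le> f x" and y: "y \<in> carrier G" "f y > 0"
  shows "haar f > 0"
proof -
  have U: "openin T {x \<in> topspace T. f x \<in> {f y / 2 <..}}" (is "openin T ?U")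
    by (rule openin_continuous_map_preimage[OF f]) auto
  have yU: "y \<in> ?U" using y by auto
  obtain B where B: "finite B" "B \<subseteq> carrier G" "\<And>x. x \<in> carrier G \<Longrightarrow> \<exists>b\<in>B. x \<otimes> b \<in> ?U"
    using translates_cover[OF U yU] by metis
  obtain bs where bs: "set bs = B" using finite_list B by blast
  have bs1: "bs \<noteq> []" using B(3)[OF one_closed] bs by auto
  have "0 < (f y / 2) / real (length bs)" using y bs1 by simp
  also have "\<dots> = haar (\<lambda>_. (f y / 2) / real (length bs))" by simp
  also have "\<dots> \<le> haar (\<lambda>x. avg bs (\<lambda>b. f (x \<otimes> b)))"
  proof (rule haar_mono)
    show "C (\<lambda>x. avg bs (\<lambda>b. f (x \<otimes> b)))" using f bs B by (intro C_avg C_rtrans) auto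
    fix x assume x: "x \<in> carrier G"
    obtain b where b: "b \<in> B" "f (x \<otimes> b) > f y / 2" using B(3)[OF x] by auto
    \<comment> \<open>\<open>avg_le_drop\<close> bounds from above, hence the sign; the common bound
      is 0 because f is nonnegative.\<close>
    have "avg bs (\<lambda>b. - 1 * f (x \<otimes> b)) \<le> 0 - (f y / 2) / real (length bs)"
      using b bs B(2) x nn by (intro avg_le_drop[of b]) auto
    then show "(f y / 2) / real (length bs) \<le> avg bs (\<lambda>b. f (x \<otimes> b))"
      unfolding avg_cmult by linarith
  qed auto
  also have "\<dots> = haar f" using haar_ravg[OF f bs1] bs B by simp
  finally show ?thesis .
qed

lemma haar_eq_0_imp:
  assumes "C f" "\<And>x. x \<in> carrier G \<Longrightarrow> 0 \<le> f x" "haar f = 0" "x \<in> carrier G"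
  shows "f x = 0"
  using haar_pos[OF assms(1,2), of x] assms by force

text \<open>Invariance allows J to be evaluated on a right average of f, and that average lies
  between \<open>haar f - e\<close> and \<open>haar f + e\<close>. This reduces Fubini's theorem to
  checking five properties of an iterated integral.\<close>

lemma haar_unique:
  assumes add: "\<And>f g. C f \<Longrightarrow> C g \<Longrightarrow> J (\<lambda>x. f x + g x) = J f + J g"
    and cmult: "\<And>f c. C f \<Longrightarrow> J (\<lambda>x. c * f x) = c * J f"
    and mono: "\<And>f g. C f \<Longrightarrow> C g \<Longrightarrow> (\<And>x. x \<in> carrier G \<Longrightarrow> f x \<le> g x) \<Longrightarrow> J f \<le> J g"
    and one: "J (\<lambda>x. 1) = 1"
    and rtrans: "\<And>f a. C f \<Longrightarrow> a \<in> carrier G \<Longrightarrow> J (\<lambda>x. f (x \<otimes> a)) = J f"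
    and f: "C f"
  shows "J f = haar f"
proof -
  have const: "J (\<lambda>x. c) = c" for c using cmult[of "\<lambda>x. 1" c] one by simp
  have sl: "J (\<lambda>x. \<Sum>a\<leftarrow>as. f (x \<otimes> a)) = (\<Sum>a\<leftarrow>as. J f)" "C (\<lambda>x. \<Sum>a\<leftarrow>as. f (x \<otimes> a))"
    if "set as \<subseteq> carrier G" for as
    using that by (induction as) (auto simp: const add rtrans f C_rtrans intro!: continuous_intros)
  have J: "J (\<lambda>x. avg as (\<lambda>a. f (x \<otimes> a))) = J f" if as: "set as \<subseteq> carrier G" "as \<noteq> []" for as
    using cmult[OF sl(2)[OF as(1)], of "inverse (real (length as))"] sl(1)[OF as(1)] as(2)
    by (simp add: avg_def divide_inverse sum_list_triv mult.commute)
  show ?thesis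
  proof (rule abs_le_all_imp_eq)
    fix e :: real assume that: "e > 0"
    from haar_near_rmean[OF f that] obtain as where as: "as \<noteq> []" "set as \<subseteq> carrier G"
        "\<And>x. x \<in> carrier G \<Longrightarrow> \<bar>avg as (\<lambda>a. f (x \<otimes> a)) - haar f\<bar> \<le> e"
      unfolding near_rmean_def by blast
    have Ca: "C (\<lambda>x. avg as (\<lambda>a. f (x \<otimes> a)))" using f as by (intro C_avg C_rtrans) auto
    have "J (\<lambda>x. avg as (\<lambda>a. f (x \<otimes> a))) \<le> J (\<lambda>x. haar f + e)"
      using as(3) Ca by (intro mono) (auto simp: abs_le_iff algebra_simps)
    moreover have "J (\<lambda>x. haar f - e) \<le> J (\<lambda>x. avg as (\<lambda>a. f (x \<otimes> a)))"
      using as(3) Ca by (intro mono) (auto simp: abs_le_iff algebra_simps)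
    ultimately show "\<bar>J f - haar f\<bar> \<le> e" unfolding J[OF as(2,1)] const by linarith
  qed
qed

lemma C_haar:
  assumes F: "continuous_map (prod_topology X T) euclideanreal (\<lambda>(x, y). F x y)"
  shows "continuous_map X euclideanreal (\<lambda>x. haar (F x))"
proof (rule continuous_map_realI)
  fix x e assume x: "x \<in> topspace X" and e: "e > (0::real)"
  have Fx: "C (F z)" if "z \<in> topspace X" for z
  proof -
    have "continuous_map T (prod_topology X T) (\<lambda>y. (z, y))" using that by (intro continuous_intros) auto
    from continuous_map_compose[OF this F] show ?thesis by (simp add: o_def)
  qed
  obtain U where U: "openin X U" "x \<in> U" "\<And>z y. z \<in> U \<Longrightarrow> y \<in> topspace T \<Longrightarrow> \<bar>F z y - F x y\<bar> < e / 2"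
    using uniform_on_compact[OF F compact x, of "e / 2"] e by auto
  have "\<bar>haar (F z) - haar (F x)\<bar> < e" if z: "z \<in> U" for z
  proof -
    have "z \<in> topspace X" using z U(1) openin_subset by fastforce
    then have "\<bar>haar (\<lambda>y. F z y - F x y)\<bar> \<le> e / 2"
      using U(3)[OF z] Fx x by (intro haar_abs_le continuous_intros) (auto simp: less_imp_le)
    then show ?thesis using haar_diff Fx x \<open>z \<in> topspace X\<close> e by simp
  qed
  with U show "\<exists>U. openin X U \<and> x \<in> U \<and> (\<forall>z\<in>U. \<bar>haar (F z) - haar (F x)\<bar> < e)" by blast
qed

section \<open>Product groups and Fubini's theorem\<close>

lemma compact_group_prod: "compact_group (G \<times>\<times> G) (prod_topology T T)"
proof -
  interpret GG: group "G \<times>\<times> G" by (intro DirProd_group is_group)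
  show ?thesis
  proof
    show "topspace (prod_topology T T) = carrier (G \<times>\<times> G)" by simp
    show "compact_space (prod_topology T T)" using compact by (simp add: compact_space_prod_topology)
    show "Hausdorff_space (prod_topology T T)" using hausdorff by (simp add: Hausdorff_space_prod_topology)
    show "continuous_map (prod_topology (prod_topology T T) (prod_topology T T)) (prod_topology T T)
        (\<lambda>(x, y). x \<otimes>\<^bsub>G \<times>\<times> G\<^esub> y)"
      unfolding mult_DirProd' case_prod_unfold
      by (intro continuous_intros continuous_map_fst'[OF continuous_map_fst] continuous_map_snd'[OF continuous_map_fst]
          continuous_map_fst'[OF continuous_map_snd] continuous_map_snd'[OF continuous_map_snd])
    have "continuous_map (prod_topology T T) (prod_topology T T) (\<lambda>x. (inv (fst x), inv (snd x)))"
      by (intro continuous_intros)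
    then show "continuous_map (prod_topology T T) (prod_topology T T) (\<lambda>x. inv\<^bsub>G \<times>\<times> G\<^esub> x)"
      by (rule continuous_map_eq) (auto simp: is_group)
  qed
qed

text \<open>The iterated integral is a normalised monotone linear functional, and translation by a
  pair acts on one variable at a time; uniqueness on the product group does the rest.\<close>

lemma haar_prod:
  assumes F: "continuous_map (prod_topology T T) euclideanreal F"
  shows "haar (\<lambda>x. haar (\<lambda>y. F (x, y))) = compact_group.haar (G \<times>\<times> G) F"
proof -
  interpret P: compact_group "G \<times>\<times> G" "prod_topology T T" by (rule compact_group_prod)
  have id: "continuous_map (prod_topology T T) euclideanreal (\<lambda>(x, y). f (x, y))" if "P.C f" for f
    using that by simp
  have sec: "C (\<lambda>y. f (x, y))" if "P.C f" "x \<in> carrier G" for f x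
  proof -
    have "continuous_map T (prod_topology T T) (\<lambda>y. (x, y))" using that by (auto intro!: continuous_intros)
    from continuous_map_compose[OF this that(1)] show ?thesis by (simp add: o_def)
  qed
  note [continuous_intros] = C_haar[OF id]
  show ?thesis
  proof (rule P.haar_unique[where J = "\<lambda>f. haar (\<lambda>x. haar (\<lambda>y. f (x, y)))"])
    fix f g :: "'a \<times> 'a \<Rightarrow> real" and c assume f: "P.C f"
    show "haar (\<lambda>x. haar (\<lambda>y. c * f (x, y))) = c * haar (\<lambda>x. haar (\<lambda>y. f (x, y)))"
      using f by (subst haar_cmult[symmetric]) (auto intro!: continuous_intros haar_cong haar_cmult sec)
    assume g: "P.C g"
    show "haar (\<lambda>x. haar (\<lambda>y. f (x, y) + g (x, y))) = haar (\<lambda>x. haar (\<lambda>y. f (x, y))) + haar (\<lambda>x. haar (\<lambda>y. g (x, y)))"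
      using f g by (subst haar_add[symmetric]) (auto intro!: continuous_intros haar_cong haar_add sec)
    assume "\<And>x. x \<in> carrier (G \<times>\<times> G) \<Longrightarrow> f x \<le> g x"
    then show "haar (\<lambda>x. haar (\<lambda>y. f (x, y))) \<le> haar (\<lambda>x. haar (\<lambda>y. g (x, y)))"
      using f g by (intro haar_mono continuous_intros sec) auto
  next
    fix f :: "'a \<times> 'a \<Rightarrow> real" and a assume f: "P.C f" and "a \<in> carrier (G \<times>\<times> G)"
    then obtain a1 a2 where a: "a = (a1, a2)" "a1 \<in> carrier G" "a2 \<in> carrier G" by auto
    have "haar (\<lambda>x. haar (\<lambda>y. f ((x, y) \<otimes>\<^bsub>G \<times>\<times> G\<^esub> a))) = haar (\<lambda>x. haar (\<lambda>y. f (x \<otimes> a1, y)))"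
      unfolding a mult_DirProd
      by (intro haar_cong haar_rtrans[where f = "\<lambda>y. f (_, y)"] sec f) (use a in auto)
    also have "\<dots> = haar (\<lambda>x. haar (\<lambda>y. f (x, y)))"
      by (rule haar_rtrans[where f = "\<lambda>x. haar (\<lambda>y. f (x, y))"]) (use a f in \<open>auto intro!: continuous_intros\<close>)
    finally show "haar (\<lambda>x. haar (\<lambda>y. f ((x, y) \<otimes>\<^bsub>G \<times>\<times> G\<^esub> a))) = haar (\<lambda>x. haar (\<lambda>y. f (x, y)))" .
  qed (use F in auto)
qed

text \<open>Exchanging coordinates is an automorphism of the product group, so by uniqueness it
  preserves the integral there, to which both iterated integrals are equal.\<close>

lemma haar_swap:
  assumes F: "continuous_map (prod_topology T T) euclideanreal (\<lambda>(x, y). F x y)"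
  shows "haar (\<lambda>x. haar (\<lambda>y. F x y)) = haar (\<lambda>y. haar (\<lambda>x. F x y))"
proof -
  interpret P: compact_group "G \<times>\<times> G" "prod_topology T T" by (rule compact_group_prod)
  let ?s = "\<lambda>f z. f (snd z, fst z)"
  have sw: "P.C (?s f)" if "P.C f" for f :: "'a \<times> 'a \<Rightarrow> real"
    using continuous_map_compose[OF continuous_map_pairedI[OF continuous_map_snd continuous_map_fst] that]
    by (simp add: o_def)
  have "P.haar (?s f) = P.haar f" if "P.C f" for f
  proof (rule P.haar_unique[where J = "\<lambda>f. P.haar (?s f)"])
    fix f g :: "'a \<times> 'a \<Rightarrow> real" and c assume f: "P.C f"
    show "P.haar (\<lambda>z. c * ?s f z) = c * P.haar (?s f)" by (rule P.haar_cmult[OF sw[OF f]])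
    assume g: "P.C g"
    show "P.haar (\<lambda>z. ?s f z + ?s g z) = P.haar (?s f) + P.haar (?s g)"
      by (rule P.haar_add[OF sw[OF f] sw[OF g]])
    assume "\<And>z. z \<in> carrier (G \<times>\<times> G) \<Longrightarrow> f z \<le> g z"
    then show "P.haar (?s f) \<le> P.haar (?s g)" by (intro P.haar_mono[OF sw[OF f] sw[OF g]]) auto
  next
    fix f :: "'a \<times> 'a \<Rightarrow> real" and a assume f: "P.C f" and a: "a \<in> carrier (G \<times>\<times> G)"
    have "P.haar (?s (\<lambda>z. f (z \<otimes>\<^bsub>G \<times>\<times> G\<^esub> a))) = P.haar (\<lambda>z. ?s f (z \<otimes>\<^bsub>G \<times>\<times> G\<^esub> (snd a, fst a)))"
      by (intro P.haar_cong) (simp add: mult_DirProd')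
    also have "\<dots> = P.haar (?s f)" using a by (intro P.haar_rtrans sw f) auto
    finally show "P.haar (?s (\<lambda>z. f (z \<otimes>\<^bsub>G \<times>\<times> G\<^esub> a))) = P.haar (?s f)" .
  qed (use that in auto)
  from this[OF F] haar_prod[OF F] haar_prod[OF sw[OF F]] show ?thesis by simp
qed

end

section \<open>The theorem of Peter and Weyl\<close>

lemma compact_PiE_UNIV:
  fixes S :: "'i \<Rightarrow> 'b::topological_space set"
  assumes "\<And>i. compact (S i)"
  shows "compact (PiE UNIV S)"
proof -
  have "compactin (product_topology (\<lambda>_::'i. euclidean) UNIV) (PiE UNIV S)"
    unfolding compactin_PiE using assms by simp
  then show ?thesis by (simp add: euclidean_product_topology)
qed

context compact_group
begin

text \<open>\<open>G\<close> need not be second countable, so only a uniform cluster point of the sequence is obtained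
  (by Tychonoff's theorem), not a uniformly convergent subsequence.\<close>
lemma Arzela_Ascoli_cluster:
  assumes bound: "\<And>n x. x \<in> carrier G \<Longrightarrow> \<bar>F n x\<bar> \<le> (K::real)"
    and equi: "\<And>x e. x \<in> carrier G \<Longrightarrow> e > 0 \<Longrightarrow>
      \<exists>U. openin T U \<and> x \<in> U \<and> (\<forall>n. \<forall>y\<in>U. \<bar>F n y - F n x\<bar> \<le> e)"
  obtains \<phi> where "C \<phi>" "\<And>e N. e > 0 \<Longrightarrow> \<exists>n\<ge>(N::nat). \<forall>x\<in>carrier G. \<bar>F n x - \<phi> x\<bar> \<le> e"
proof -
  \<comment> \<open>Extension by 0 puts the sequence into a product of intervals over the whole
    type; 0 belongs to [-K, K] because K \<ge> 0.\<close>
  define F' where "F' n x = (if x \<in> carrier G then F n x else 0)" for n x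
  have K: "K \<ge> 0" using bound[OF one_closed, of 0] by linarith
  have "F' n \<in> PiE UNIV (\<lambda>_. {-K..K})" for n
    using bound K by (auto simp: F'_def abs_le_iff minus_le_iff)
  then have "eventually (\<lambda>g. g \<in> PiE UNIV (\<lambda>_. {-K..K})) (filtermap F' sequentially)"
    by (simp add: eventually_filtermap)
  moreover have "filtermap F' sequentially \<noteq> bot" by (simp add: filtermap_bot_iff)
  ultimately obtain \<phi> where \<phi>: "inf (nhds \<phi>) (filtermap F' sequentially) \<noteq> bot"
    using compact_PiE_UNIV[of "\<lambda>_::'a. {-K..K}", OF compact_Icc] unfolding compact_filter by blast
  \<comment> \<open>Neighbourhoods in the product topology see finitely many points only, so
    approximation is first obtained on finite sets; equicontinuity and a finite subcover make it
    uniform.\<close>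
  have cluster: "\<exists>n\<ge>N. \<forall>x\<in>X. \<bar>F n x - \<phi> x\<bar> < e" if X: "finite X" "X \<subseteq> carrier G" and e: "e > 0" for X e N
  proof (rule ccontr)
    assume no: "\<not> (\<exists>n\<ge>N. \<forall>x\<in>X. \<bar>F n x - \<phi> x\<bar> < e)"
    let ?W = "\<Inter>x\<in>X. {g. \<bar>g x - \<phi> x\<bar> < e}"
    have "open {g. \<bar>g x - \<phi> x\<bar> < e}" for x
      by (intro open_Collect_less continuous_intros continuous_on_product_coordinates)
    then have "open ?W" using X by (intro open_INT) auto
    moreover have "\<phi> \<in> ?W" using e by auto
    ultimately have "eventually (\<lambda>g. g \<in> ?W) (nhds \<phi>)" by (rule eventually_nhds_in_open)
    moreover have "eventually (\<lambda>g. g \<notin> ?W) (filtermap F' sequentially)"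
      unfolding eventually_filtermap eventually_sequentially
      using no X(2) by (intro exI[of _ N]) (auto simp: F'_def subset_iff)
    ultimately have "eventually (\<lambda>_. False) (inf (nhds \<phi>) (filtermap F' sequentially))"
      unfolding eventually_inf by blast
    then show False using \<phi> by (simp add: trivial_limit_def)
  qed
  have equi\<phi>: "\<bar>\<phi> y - \<phi> x\<bar> \<le> 2 * e"
    if xy: "x \<in> carrier G" "y \<in> carrier G" and e: "e > 0" and Fe: "\<And>n. \<bar>F n y - F n x\<bar> \<le> e" for x y e
  proof -
    have "finite {x, y}" "{x, y} \<subseteq> carrier G" "e / 2 > 0" using xy e by auto
    from cluster[OF this, of 0] obtain n where "\<bar>F n x - \<phi> x\<bar> < e / 2" "\<bar>F n y - \<phi> y\<bar> < e / 2" by blast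
    then show ?thesis using Fe[of n] by linarith
  qed
  have sub: "U \<subseteq> carrier G" if "openin T U" for U using openin_subset[OF that] by simp
  have "C \<phi>"
  proof (rule continuous_map_realI)
    fix x e assume "x \<in> topspace T" and e: "e > (0::real)"
    then have x: "x \<in> carrier G" and e4: "e / 4 > 0" by auto
    from equi[OF this] obtain U where U: "openin T U" "x \<in> U" "\<And>n y. y \<in> U \<Longrightarrow> \<bar>F n y - F n x\<bar> \<le> e / 4" by blast
    have "\<bar>\<phi> y - \<phi> x\<bar> < e" if "y \<in> U" for y
    proof -
      have "y \<in> carrier G" using sub[OF U(1)] that by blast
      from equi\<phi>[OF x this e4 U(3)[OF that]] show ?thesis using e by linarith
    qed
    with U show "\<exists>U. openin T U \<and> x \<in> U \<and> (\<forall>y\<in>U. \<bar>\<phi> y - \<phi> x\<bar> < e)" by blast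
  qed
  moreover have "\<exists>n\<ge>N. \<forall>x\<in>carrier G. \<bar>F n x - \<phi> x\<bar> \<le> e" if e: "e > 0" for e N
  proof -
    have "\<forall>x\<in>carrier G. \<exists>U. openin T U \<and> x \<in> U \<and> (\<forall>n. \<forall>y\<in>U. \<bar>F n y - F n x\<bar> \<le> e / 4)"
      using equi[of _ "e / 4"] e by (metis divide_pos_pos zero_less_numeral)
    then obtain U where U: "\<And>x. x \<in> carrier G \<Longrightarrow> openin T (U x) \<and> x \<in> U x"
      and Ue: "\<And>x n y. x \<in> carrier G \<Longrightarrow> y \<in> U x \<Longrightarrow> \<bar>F n y - F n x\<bar> \<le> e / 4"
      by metis
    obtain X where X: "finite X" "X \<subseteq> carrier G" "carrier G \<subseteq> (\<Union>x\<in>X. U x)"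
      using finite_subcover[of U, OF U] by metis
    have e4: "e / 4 > 0" using e by simp
    from cluster[OF X(1,2) e4, of N] obtain n where n: "n \<ge> N" "\<forall>x\<in>X. \<bar>F n x - \<phi> x\<bar> < e / 4" by blast
    have "\<bar>F n y - \<phi> y\<bar> \<le> e" if y: "y \<in> carrier G" for y
    proof -
      obtain x where x: "x \<in> X" "y \<in> U x" using X(3) y by auto
      have xG: "x \<in> carrier G" using x X(2) by blast
      have "\<bar>\<phi> y - \<phi> x\<bar> \<le> 2 * (e / 4)" by (rule equi\<phi>[OF xG y e4 Ue[OF xG x(2)]])
      moreover have "\<bar>F n x - \<phi> x\<bar> < e / 4" using n(2) x(1) by blast
      ultimately show ?thesis using Ue[OF xG x(2), of n] by linarith
    qed
    with n(1) show ?thesis by blast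
  qed
  ultimately show ?thesis using that by blast
qed

section \<open>Inner product and orthonormal sets of continuous functions\<close>

definition ip :: "('a \<Rightarrow> real) \<Rightarrow> ('a \<Rightarrow> real) \<Rightarrow> real" where
  "ip f g = haar (\<lambda>x. f x * g x)"

lemma ip_commute: "ip f g = ip g f"
  by (simp add: ip_def mult.commute)

lemma ip_add_left: "C f \<Longrightarrow> C g \<Longrightarrow> C h \<Longrightarrow> ip (\<lambda>x. f x + g x) h = ip f h + ip g h"
  unfolding ip_def by (subst haar_add[symmetric]) (auto intro!: continuous_intros simp: algebra_simps)

lemma ip_diff_left: "C f \<Longrightarrow> C g \<Longrightarrow> C h \<Longrightarrow> ip (\<lambda>x. f x - g x) h = ip f h - ip g h"
  unfolding ip_def by (subst haar_diff[symmetric]) (auto intro!: continuous_intros simp: algebra_simps)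

lemma ip_cmult_left: "C f \<Longrightarrow> C h \<Longrightarrow> ip (\<lambda>x. c * f x) h = c * ip f h"
  unfolding ip_def by (subst haar_cmult[symmetric]) (auto intro!: continuous_intros simp: algebra_simps)

lemma ip_add_right: "C f \<Longrightarrow> C g \<Longrightarrow> C h \<Longrightarrow> ip h (\<lambda>x. f x + g x) = ip h f + ip h g"
  using ip_add_left[of f g h] by (simp add: ip_commute[of h])

lemma ip_diff_right: "C f \<Longrightarrow> C g \<Longrightarrow> C h \<Longrightarrow> ip h (\<lambda>x. f x - g x) = ip h f - ip h g"
  using ip_diff_left[of f g h] by (simp add: ip_commute[of h])

lemma ip_cmult_right: "C f \<Longrightarrow> C h \<Longrightarrow> ip h (\<lambda>x. c * f x) = c * ip h f"
  using ip_cmult_left[of f h c] by (simp add: ip_commute[of h])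

lemma ip_sum_left:
  assumes "finite I" "\<And>i. i \<in> I \<Longrightarrow> C (f i)" "C h"
  shows "ip (\<lambda>x. \<Sum>i\<in>I. c i * f i x) h = (\<Sum>i\<in>I. c i * ip (f i) h)"
proof -
  have "ip (\<lambda>x. \<Sum>i\<in>I. c i * f i x) h = haar (\<lambda>x. \<Sum>i\<in>I. c i * (f i x * h x))"
    unfolding ip_def by (simp add: sum_distrib_right mult.assoc)
  also have "\<dots> = (\<Sum>i\<in>I. haar (\<lambda>x. c i * (f i x * h x)))"
    using assms by (intro haar_sum) (auto intro!: continuous_intros)
  also have "\<dots> = (\<Sum>i\<in>I. c i * ip (f i) h)"
    unfolding ip_def using assms by (intro sum.cong refl haar_cmult) (auto intro!: continuous_intros)
  finally show ?thesis .
qed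

lemma ip_cong:
  "(\<And>x. x \<in> carrier G \<Longrightarrow> f x = f' x) \<Longrightarrow> (\<And>x. x \<in> carrier G \<Longrightarrow> g x = g' x) \<Longrightarrow> ip f g = ip f' g'"
  unfolding ip_def by (intro haar_cong) simp

lemma ip_nonneg: "C f \<Longrightarrow> 0 \<le> ip f f"
  unfolding ip_def by (intro haar_nonneg continuous_intros) auto

lemma ip_eq_0: "C f \<Longrightarrow> ip f f = 0 \<Longrightarrow> x \<in> carrier G \<Longrightarrow> f x = 0"
  using haar_eq_0_imp[of "\<lambda>x. f x * f x" x] by (auto simp: ip_def intro: continuous_intros)

lemma ip_le_square:
  assumes "C f" "\<And>x. x \<in> carrier G \<Longrightarrow> \<bar>f x\<bar> \<le> K"
  shows "ip f f \<le> K\<^sup>2"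
proof -
  have "\<bar>f x * f x\<bar> \<le> K\<^sup>2" if "x \<in> carrier G" for x
    using power_mono[OF assms(2)[OF that], of 2] by (simp add: power2_eq_square)
  then have "\<bar>ip f f\<bar> \<le> K\<^sup>2" unfolding ip_def using assms(1) by (intro haar_abs_le continuous_intros)
  then show ?thesis by linarith
qed

lemma ip_rtrans:
  assumes "C f" "C h" "g \<in> carrier G"
  shows "ip (\<lambda>x. f (x \<otimes> g)) (\<lambda>x. h (x \<otimes> g)) = ip f h"
  unfolding ip_def using assms haar_rtrans[of "\<lambda>x. f x * h x" g] by (auto intro: continuous_intros)

lemma ip_Cauchy_Schwarz:
  assumes f: "C f" and g: "C g"
  shows "(ip f g)\<^sup>2 \<le> ip f f * ip g g"
proof (cases "ip g g = 0")
  case True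
  then have "ip f g = ip f (\<lambda>x. 0 * g x)" using ip_eq_0[OF g] by (intro ip_cong) auto
  then show ?thesis using True ip_cmult_right[OF g f, of 0] by simp
next
  case False
  then have pos: "ip g g > 0" using ip_nonneg[OF g] by simp
  define t where "t = ip f g / ip g g"
  have tg: "C (\<lambda>x. t * g x)" using g by (rule continuous_map_real_mult_left)
  have "0 \<le> ip (\<lambda>x. f x - t * g x) (\<lambda>x. f x - t * g x)"
    by (rule ip_nonneg[OF continuous_map_diff[OF f tg]])
  also have "\<dots> = ip f f - t * ip f g - (t * ip f g - t * (t * ip g g))"
    using f g tg by (simp add: ip_diff_left ip_diff_right ip_cmult_left ip_cmult_right continuous_map_diff ip_commute[of g f])
  also have "\<dots> = ip f f - (ip f g)\<^sup>2 / ip g g"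
    using pos by (simp add: t_def power2_eq_square)
  finally show ?thesis using pos by (simp add: field_simps)
qed

definition orthonormal_set :: "('a \<Rightarrow> real) set \<Rightarrow> bool" where
  "orthonormal_set E \<longleftrightarrow> finite E \<and> (\<forall>e\<in>E. C e) \<and> (\<forall>e\<in>E. \<forall>e'\<in>E. ip e e' = (if e = e' then 1 else 0))"

definition proj :: "('a \<Rightarrow> real) set \<Rightarrow> ('a \<Rightarrow> real) \<Rightarrow> 'a \<Rightarrow> real" where
  "proj E f x = (\<Sum>e\<in>E. ip f e * e x)"

text \<open>Agreement is asked on the carrier only, since the values of a function off the group are
  arbitrary.\<close>

definition spanned :: "('a \<Rightarrow> real) set \<Rightarrow> ('a \<Rightarrow> real) \<Rightarrow> bool" where
  "spanned B f \<longleftrightarrow> (\<exists>c. \<forall>x\<in>carrier G. f x = (\<Sum>b\<in>B. c b * b x))"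

lemma C_proj: "orthonormal_set E \<Longrightarrow> C (proj E f)"
  unfolding proj_def orthonormal_set_def by (auto intro!: continuous_intros)

lemma ip_proj:
  assumes "orthonormal_set E" "C h"
  shows "ip (proj E f) h = (\<Sum>e\<in>E. ip f e * ip e h)"
  unfolding proj_def using assms by (intro ip_sum_left) (auto simp: orthonormal_set_def)

lemma ip_orthonormal_sum:
  assumes "orthonormal_set E" "e \<in> E"
  shows "(\<Sum>e'\<in>E. c e' * ip e' e) = c e"
proof -
  have "(\<Sum>e'\<in>E. c e' * ip e' e) = (\<Sum>e'\<in>E. if e' = e then c e' else 0)"
    using assms by (intro sum.cong) (auto simp: orthonormal_set_def)
  then show ?thesis using assms by (simp add: orthonormal_set_def)
qed

lemma ip_residual:
  assumes "orthonormal_set E" "C f" "e \<in> E"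
  shows "ip (\<lambda>x. f x - proj E f x) e = 0"
  using assms ip_orthonormal_sum[of E e "ip f"] by (auto simp: ip_diff_left C_proj ip_proj orthonormal_set_def)

lemma ip_residual_self:
  assumes E: "orthonormal_set E" and f: "C f"
  shows "ip (\<lambda>x. f x - proj E f x) (\<lambda>x. f x - proj E f x) = ip f f - (\<Sum>e\<in>E. (ip f e)\<^sup>2)"
proof -
  let ?r = "\<lambda>x. f x - proj E f x"
  have r: "C ?r" using f C_proj[OF E] by (intro continuous_intros)
  have "ip ?r ?r = ip ?r f - ip (proj E f) ?r"
    using f r C_proj[OF E] by (simp add: ip_diff_right ip_commute)
  also have "ip (proj E f) ?r = 0"
    unfolding ip_proj[OF E r] using ip_residual[OF E f] by (simp add: ip_commute)
  also have "ip ?r f = ip f f - (\<Sum>e\<in>E. (ip f e)\<^sup>2)"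
  proof -
    have "(\<Sum>e\<in>E. ip f e * ip e f) = (\<Sum>e\<in>E. (ip f e)\<^sup>2)"
      by (intro sum.cong refl) (metis power2_eq_square ip_commute)
    then show ?thesis using f C_proj[OF E] by (simp add: ip_diff_left ip_proj[OF E f])
  qed
  finally show ?thesis by simp
qed

lemma Bessel:
  assumes "orthonormal_set E" "C f"
  shows "(\<Sum>e\<in>E. (ip f e)\<^sup>2) \<le> ip f f"
  using ip_residual_self[OF assms] ip_nonneg[of "\<lambda>x. f x - proj E f x"] C_proj[OF assms(1)] assms(2)
  by (simp add: continuous_map_diff)

lemma spanned_orthonormal:
  assumes E: "orthonormal_set E" and f: "C f" and s: "spanned E f" and x: "x \<in> carrier G"
  shows "f x = proj E f x"
proof -
  obtain c where c: "\<And>x. x \<in> carrier G \<Longrightarrow> f x = (\<Sum>e\<in>E. c e * e x)" using s unfolding spanned_def by blast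
  have "ip f e = c e" if "e \<in> E" for e
  proof -
    have "ip f e = ip (\<lambda>x. \<Sum>e\<in>E. c e * e x) e" using c by (intro ip_cong) auto
    also have "\<dots> = (\<Sum>e'\<in>E. c e' * ip e' e)" using E that by (intro ip_sum_left) (auto simp: orthonormal_set_def)
    also have "\<dots> = c e" by (rule ip_orthonormal_sum[OF E that])
    finally show ?thesis .
  qed
  then show ?thesis using c[OF x] by (simp add: proj_def)
qed

lemma spanned_proj: "(\<And>x. x \<in> carrier G \<Longrightarrow> f x = proj E f x) \<Longrightarrow> spanned E f"
  unfolding spanned_def proj_def by blast

lemma spanned_mono:
  assumes "spanned A f" "A \<subseteq> B" "finite B"
  shows "spanned B f"
proof -
  obtain c where c: "\<And>x. x \<in> carrier G \<Longrightarrow> f x = (\<Sum>b\<in>A. c b * b x)" using assms(1) unfolding spanned_def by blast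
  have "(\<Sum>b\<in>B. (if b \<in> A then c b else 0) * b x) = (\<Sum>b\<in>A. c b * b x)" for x
    using assms(2,3) by (intro sum.mono_neutral_cong_right) auto
  then show ?thesis unfolding spanned_def
    by (intro exI[of _ "\<lambda>b. if b \<in> A then c b else 0"]) (simp add: c)
qed

lemma spanned_add:
  assumes "spanned B f" "spanned B g"
  shows "spanned B (\<lambda>x. f x + g x)"
proof -
  obtain c where "\<And>x. x \<in> carrier G \<Longrightarrow> f x = (\<Sum>b\<in>B. c b * b x)"
    using assms(1) unfolding spanned_def by blast
  moreover obtain d where "\<And>x. x \<in> carrier G \<Longrightarrow> g x = (\<Sum>b\<in>B. d b * b x)"
    using assms(2) unfolding spanned_def by blast
  ultimately show ?thesis unfolding spanned_def by (intro exI[of _ "\<lambda>b. c b + d b"]) (simp add: distrib_right sum.distrib)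
qed

lemma spanned_cmult:
  assumes "spanned B f"
  shows "spanned B (\<lambda>x. a * f x)"
proof -
  obtain c where "\<And>x. x \<in> carrier G \<Longrightarrow> f x = (\<Sum>b\<in>B. c b * b x)"
    using assms unfolding spanned_def by blast
  then show ?thesis unfolding spanned_def by (intro exI[of _ "\<lambda>b. a * c b"]) (simp add: sum_distrib_left mult.assoc)
qed

lemma spanned_zero: "spanned B (\<lambda>x. 0)"
  unfolding spanned_def by (intro exI[of _ "\<lambda>_. 0"]) simp

lemma spanned_cong: "spanned B f \<Longrightarrow> (\<And>x. x \<in> carrier G \<Longrightarrow> f x = g x) \<Longrightarrow> spanned B g"
  unfolding spanned_def by simp

lemma spanned_sum:
  "finite I \<Longrightarrow> (\<And>i. i \<in> I \<Longrightarrow> spanned B (f i)) \<Longrightarrow> spanned B (\<lambda>x. \<Sum>i\<in>I. c i * f i x)"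
  by (induction I rule: finite_induct) (auto intro!: spanned_zero spanned_add spanned_cmult)

lemma spanned_self: "finite B \<Longrightarrow> b \<in> B \<Longrightarrow> spanned B b"
  unfolding spanned_def by (intro exI[of _ "\<lambda>b'. if b' = b then 1 else 0"]) (simp add: if_distrib[of "\<lambda>c. c * _"] cong: if_cong)

lemma spanned_trans:
  assumes "spanned A f" "finite A" "\<And>a. a \<in> A \<Longrightarrow> spanned B a"
  shows "spanned B f"
proof -
  obtain c where c: "\<And>x. x \<in> carrier G \<Longrightarrow> f x = (\<Sum>b\<in>A. c b * b x)" using assms(1) unfolding spanned_def by blast
  have "spanned B (\<lambda>x. \<Sum>a\<in>A. c a * a x)" using assms by (intro spanned_sum) auto
  then show ?thesis by (rule spanned_cong) (simp add: c)
qed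

lemma orthonormal_insert_residual:
  assumes E: "orthonormal_set E" and f: "C f" and nz: "ip (\<lambda>x. f x - proj E f x) (\<lambda>x. f x - proj E f x) \<noteq> 0"
  defines "u \<equiv> \<lambda>x. inverse (sqrt (ip (\<lambda>x. f x - proj E f x) (\<lambda>x. f x - proj E f x))) * (f x - proj E f x)"
  shows "orthonormal_set (insert u E)" "u \<notin> E" "spanned (insert u E) f"
proof -
  let ?r = "\<lambda>x. f x - proj E f x"
  let ?s = "sqrt (ip ?r ?r)"
  have r: "C ?r" using f C_proj[OF E] by (intro continuous_intros)
  have pos: "ip ?r ?r > 0" using nz ip_nonneg[OF r] by simp
  have u: "C u" unfolding u_def using r by (rule continuous_map_real_mult_left)
  have ue: "ip u e = 0" if "e \<in> E" for e
    unfolding u_def using ip_residual[OF E f that] r E that by (simp add: ip_cmult_left orthonormal_set_def)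
  have scale: "inverse (sqrt p) * (inverse (sqrt p) * p) = 1" if "p > 0" for p
    using that by (simp add: field_simps)
  have uu: "ip u u = 1"
  proof -
    have "ip u u = inverse ?s * (inverse ?s * ip ?r ?r)"
      unfolding u_def using r u by (simp add: ip_cmult_left ip_cmult_right continuous_map_real_mult_left)
    also have "\<dots> = 1" using pos by (intro scale) simp
    finally show ?thesis .
  qed
  show nin: "u \<notin> E" using ue uu by fastforce
  have "ip e u = 0" if "e \<in> E" for e using ue[OF that] by (simp add: ip_commute)
  then show "orthonormal_set (insert u E)" using E u ue uu nin by (auto simp: orthonormal_set_def)
  have fin: "finite E" using E by (simp add: orthonormal_set_def)
  have "spanned (insert u E) (\<lambda>x. ?s * u x + proj E f x)"
  proof -
    have 1: "spanned (insert u E) u" using fin by (intro spanned_self) auto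
    have "spanned E (proj E f)" unfolding spanned_def proj_def by blast
    then have 2: "spanned (insert u E) (proj E f)" by (rule spanned_mono) (use fin in auto)
    show ?thesis by (rule spanned_add[OF spanned_cmult[OF 1] 2])
  qed
  then show "spanned (insert u E) f" 
  proof (rule spanned_cong)
    have "sqrt p * (inverse (sqrt p) * t) = t" if "p > 0" for p t :: real
      using that by simp
    from this[OF pos] show "?s * u x + proj E f x = f x" for x by (simp only: u_def diff_add_cancel)
  qed
qed

lemma Gram_Schmidt:
  assumes "finite B" "\<And>b. b \<in> B \<Longrightarrow> C b"
  shows "\<exists>E. orthonormal_set E \<and> (\<forall>b\<in>B. spanned E b)"
  using assms
proof (induction B rule: finite_induct)
  case empty
  have "orthonormal_set {}" by (simp add: orthonormal_set_def)
  then show ?case by blast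
next
  case (insert b B)
  then obtain E where E: "orthonormal_set E" "\<forall>b\<in>B. spanned E b" by auto
  have b: "C b" using insert.prems by simp
  let ?r = "\<lambda>x. b x - proj E b x"
  show ?case
  proof (cases "ip ?r ?r = 0")
    case True
    have "C ?r" using b C_proj[OF E(1)] by (intro continuous_intros)
    from ip_eq_0[OF this True] have "spanned E b" by (intro spanned_proj) auto
    with E show ?thesis by blast
  next
    case False
    define u where "u = (\<lambda>x. inverse (sqrt (ip ?r ?r)) * (b x - proj E b x))"
    note u = orthonormal_insert_residual[OF E(1) b False, folded u_def]
    have "spanned (insert u E) c" if "c \<in> B" for c
      using spanned_mono[of E c "insert u E"] E that by (auto simp: orthonormal_set_def)
    with u show ?thesis by (intro exI[of _ "insert u E"]) auto
  qed
qed

text \<open>Double counting of \<open>(ip u e)\<^sup>2\<close>: summed over e it is 1, because E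
  spans u; summed over u it is at most 1, by Bessel. This takes the place of a comparison of
  dimensions.\<close>

lemma card_orthonormal_le:
  assumes E: "orthonormal_set E" and F: "orthonormal_set F" and s: "\<And>u. u \<in> F \<Longrightarrow> spanned E u"
  shows "card F \<le> card E"
proof -
  have "ip u u = (\<Sum>e\<in>E. (ip u e)\<^sup>2)" if u: "u \<in> F" for u
  proof -
    have Cu: "C u" using F u by (simp add: orthonormal_set_def)
    have "ip u u = ip (proj E u) u" using spanned_orthonormal[OF E Cu s[OF u]] by (intro ip_cong) auto
    also have "\<dots> = (\<Sum>e\<in>E. (ip u e)\<^sup>2)"
      unfolding ip_proj[OF E Cu] by (intro sum.cong refl) (metis power2_eq_square ip_commute)
    finally show ?thesis .
  qed
  then have "(\<Sum>u\<in>F. ip u u) = (\<Sum>u\<in>F. \<Sum>e\<in>E. (ip u e)\<^sup>2)" by simp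
  also have "\<dots> = (\<Sum>e\<in>E. \<Sum>u\<in>F. (ip e u)\<^sup>2)" by (subst sum.swap) (simp only: ip_commute)
  also have "\<dots> \<le> (\<Sum>e\<in>E. ip e e)" using E by (intro sum_mono Bessel[OF F]) (auto simp: orthonormal_set_def)
  finally show ?thesis using E F by (simp add: orthonormal_set_def)
qed

section \<open>Finite-dimensional spaces of translates\<close>

definition subsp :: "('a \<Rightarrow> real) set \<Rightarrow> bool" where
  "subsp V \<longleftrightarrow> (\<forall>f\<in>V. C f) \<and> (\<forall>f\<in>V. \<forall>g\<in>V. (\<lambda>x. f x + g x) \<in> V) \<and> (\<forall>f\<in>V. \<forall>c. (\<lambda>x. c * f x) \<in> V) \<and> (\<lambda>x. 0) \<in> V"

lemma subsp_sum:
  assumes "subsp V" "finite I" "\<And>i. i \<in> I \<Longrightarrow> f i \<in> V"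
  shows "(\<lambda>x. \<Sum>i\<in>I. c i * f i x) \<in> V"
  using assms(2,3) by (induction I rule: finite_induct) (use assms(1) in \<open>auto simp: subsp_def\<close>)

text \<open>An orthonormal subset of V of the largest cardinality spans V, for otherwise a
  normalised residual would enlarge it. Finite dimension is expressed as a bound on orthonormal sets
  because that is what Bessel's inequality delivers.\<close>

lemma orthonormal_basis:
  assumes V: "subsp V" and bound: "\<And>E. orthonormal_set E \<Longrightarrow> E \<subseteq> V \<Longrightarrow> card E \<le> N"
  obtains E where "orthonormal_set E" "E \<subseteq> V" "\<And>f. f \<in> V \<Longrightarrow> spanned E f"
proof -
  let ?P = "\<lambda>n. \<exists>E. orthonormal_set E \<and> E \<subseteq> V \<and> card E = n"
  have "?P 0" by (intro exI[of _ "{}"]) (simp add: orthonormal_set_def)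
  moreover have "n \<le> N" if "?P n" for n using bound that by blast
  ultimately have "?P (Greatest ?P)" "\<And>k. ?P k \<Longrightarrow> k \<le> Greatest ?P"
    using GreatestI_nat[of ?P 0 N] Greatest_le_nat[of ?P _ N] by blast+
  then obtain n where n: "?P n" "\<And>k. ?P k \<Longrightarrow> k \<le> n" by blast
  then obtain E where E: "orthonormal_set E" "E \<subseteq> V" "card E = n" by blast
  have "spanned E f" if f: "f \<in> V" for f
  proof (rule ccontr)
    assume ns: "\<not> spanned E f"
    have Cf: "C f" using V f by (simp add: subsp_def)
    let ?r = "\<lambda>x. f x - proj E f x"
    have Cr: "C ?r" using Cf C_proj[OF E(1)] by (intro continuous_intros)
    have nz: "ip ?r ?r \<noteq> 0"
    proof
      assume "ip ?r ?r = 0"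
      from ip_eq_0[OF Cr this] have "spanned E f" by (intro spanned_proj) auto
      with ns show False by simp
    qed
    define u where "u = (\<lambda>x. inverse (sqrt (ip ?r ?r)) * (f x - proj E f x))"
    have "(\<lambda>x. \<Sum>e\<in>E. ip f e * e x) \<in> V" using E by (intro subsp_sum V) (auto simp: orthonormal_set_def)
    then have pV: "proj E f \<in> V" by (simp add: proj_def[abs_def])
    have m: "(\<lambda>x. c * h x) \<in> V" if "h \<in> V" for h c using V that by (simp add: subsp_def)
    have p: "(\<lambda>x. h x + k x) \<in> V" if "h \<in> V" "k \<in> V" for h k using V that by (simp add: subsp_def)
    have "(\<lambda>x. f x + (-1) * proj E f x) \<in> V" by (intro p m f pV)
    then have "u \<in> V" unfolding u_def by (intro m) simp
    then have "?P (card (insert u E))"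
      using orthonormal_insert_residual(1)[OF E(1) Cf nz] E(2) unfolding u_def by blast
    moreover have "card (insert u E) = Suc n"
      using orthonormal_insert_residual(2)[OF E(1) Cf nz] E unfolding u_def by (simp add: orthonormal_set_def)
    ultimately have "?P (Suc n)" by simp
    from n(2)[OF this] show False by simp
  qed
  from that[OF E(1,2) this] show ?thesis .
qed

text \<open>The rule \<open>agree\<close> identifies functions that coincide on the group:
  associativity, which turns an iterated translate into a single one, holds only there.\<close>

inductive_set tspan :: "('a \<Rightarrow> real) set \<Rightarrow> ('a \<Rightarrow> real) set" for \<Phi> where
  transl: "\<phi> \<in> \<Phi> \<Longrightarrow> g \<in> carrier G \<Longrightarrow> (\<lambda>x. \<phi> (x \<otimes> g)) \<in> tspan \<Phi>"
| zero: "(\<lambda>x. 0) \<in> tspan \<Phi>"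
| add: "f \<in> tspan \<Phi> \<Longrightarrow> h \<in> tspan \<Phi> \<Longrightarrow> (\<lambda>x. f x + h x) \<in> tspan \<Phi>"
| cmult: "f \<in> tspan \<Phi> \<Longrightarrow> (\<lambda>x. c * f x) \<in> tspan \<Phi>"
| agree: "f \<in> tspan \<Phi> \<Longrightarrow> C h \<Longrightarrow> (\<And>x. x \<in> carrier G \<Longrightarrow> f x = h x) \<Longrightarrow> h \<in> tspan \<Phi>"

lemma subsp_tspan:
  assumes "\<And>\<phi>. \<phi> \<in> \<Phi> \<Longrightarrow> C \<phi>"
  shows "subsp (tspan \<Phi>)"
proof -
  have "C f" if "f \<in> tspan \<Phi>" for f
    using that
  proof induction
    case (transl \<phi> g)
    show ?case by (rule C_rtrans[OF assms[OF transl(1)] transl(2)])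
  next
    case (cmult f c)
    from cmult(2) show ?case by (rule continuous_map_real_mult_left)
  qed (simp_all add: continuous_map_add)
  then show ?thesis
    unfolding subsp_def by (intro conjI ballI allI tspan.add tspan.cmult tspan.zero) auto
qed

lemma tspan_rtrans:
  assumes \<Phi>: "\<And>\<phi>. \<phi> \<in> \<Phi> \<Longrightarrow> C \<phi>" and f: "f \<in> tspan \<Phi>" and g: "g \<in> carrier G"
  shows "(\<lambda>x. f (x \<otimes> g)) \<in> tspan \<Phi>"
  using f
proof induction
  case (transl \<phi> h)
  have "(\<lambda>x. \<phi> (x \<otimes> (g \<otimes> h))) \<in> tspan \<Phi>" using transl g by (intro tspan.transl) auto
  then show ?case
  proof (rule tspan.agree)
    show "C (\<lambda>x. \<phi> (x \<otimes> g \<otimes> h))"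
      using C_rtrans[OF C_rtrans[OF \<Phi>[OF transl(1)] transl(2)] g] by simp
  qed (use transl g in \<open>simp add: m_assoc\<close>)
next
  case (agree f h)
  from agree.IH show ?case
    by (rule tspan.agree) (use agree C_rtrans[OF agree(2) g] g in auto)
qed (rule tspan.zero, rule tspan.add, assumption+, rule tspan.cmult, assumption)

text \<open>The representative functions of Peter--Weyl theory. The spanning set need not consist of
  translates, so a basis of an eigenspace or the left factors of a comultiplication will do.\<close>

definition rep_fun :: "('a \<Rightarrow> real) \<Rightarrow> bool" where
  "rep_fun f \<longleftrightarrow> C f \<and> (\<exists>B. finite B \<and> (\<forall>b\<in>B. C b) \<and> (\<forall>g\<in>carrier G. spanned B (\<lambda>x. f (x \<otimes> g))))"

definition orthogonal_rep :: "nat \<Rightarrow> ('a \<Rightarrow> nat \<Rightarrow> nat \<Rightarrow> real) \<Rightarrow> bool" where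
  "orthogonal_rep m \<pi> \<longleftrightarrow>
     (\<forall>g\<in>carrier G. \<forall>h\<in>carrier G. \<forall>i<m. \<forall>j<m. \<pi> (g \<otimes> h) i j = (\<Sum>k<m. \<pi> g i k * \<pi> h k j)) \<and>
     (\<forall>i<m. \<forall>j<m. \<pi> \<one> i j = (if i = j then 1 else 0)) \<and>
     (\<forall>g\<in>carrier G. \<forall>i<m. \<forall>j<m. \<pi> (inv g) i j = \<pi> g j i) \<and>
     (\<forall>i<m. \<forall>j<m. C (\<lambda>g. \<pi> g i j))"

lemma orthogonal_repD:
  assumes "orthogonal_rep m \<pi>" "i < m" "j < m"
  shows "g \<in> carrier G \<Longrightarrow> h \<in> carrier G \<Longrightarrow> \<pi> (g \<otimes> h) i j = (\<Sum>k<m. \<pi> g i k * \<pi> h k j)"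
    and "\<pi> \<one> i j = (if i = j then 1 else 0)"
    and "g \<in> carrier G \<Longrightarrow> \<pi> (inv g) i j = \<pi> g j i"
    and "C (\<lambda>g. \<pi> g i j)"
  using assms unfolding orthogonal_rep_def by simp_all

text \<open>The group acts by right translation on the span of all translates of \<Phi>, and
  invariance of the integral makes the matrices orthogonal in an orthonormal basis.
  \<open>v \<phi>\<close> is the coordinate vector of \<phi>, so g fixes the one exactly when it
  fixes the other.\<close>

lemma matrix_representation:
  assumes \<Phi>: "finite \<Phi>" "\<And>\<phi>. \<phi> \<in> \<Phi> \<Longrightarrow> rep_fun \<phi>"
  obtains m \<pi> and v :: "('a \<Rightarrow> real) \<Rightarrow> nat \<Rightarrow> real"
  where "orthogonal_rep m \<pi>"
    and "\<forall>\<phi>\<in>\<Phi>. \<forall>g\<in>carrier G.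
      (\<forall>i<m. (\<Sum>j<m. \<pi> g i j * v \<phi> j) = v \<phi> i) \<longleftrightarrow> (\<forall>x\<in>carrier G. \<phi> (x \<otimes> g) = \<phi> x)"
proof -
  have C\<Phi>: "C \<phi>" if "\<phi> \<in> \<Phi>" for \<phi> using \<Phi>(2)[OF that] by (simp add: rep_fun_def)
  have "\<forall>\<phi>\<in>\<Phi>. \<exists>B. finite B \<and> (\<forall>b\<in>B. C b) \<and> (\<forall>g\<in>carrier G. spanned B (\<lambda>x. \<phi> (x \<otimes> g)))"
    using \<Phi>(2) unfolding rep_fun_def by blast
  then obtain B where B: "\<forall>\<phi>\<in>\<Phi>. finite (B \<phi>) \<and> (\<forall>b\<in>B \<phi>. C b) \<and> (\<forall>g\<in>carrier G. spanned (B \<phi>) (\<lambda>x. \<phi> (x \<otimes> g)))"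
    by (rule bchoice[THEN exE])
  let ?B = "\<Union>\<phi>\<in>\<Phi>. B \<phi>"
  have finB: "finite ?B" using B \<Phi>(1) by auto
  have CB: "C b" if "b \<in> ?B" for b using that B by auto
  obtain E0 where E0: "orthonormal_set E0" "\<And>b. b \<in> ?B \<Longrightarrow> spanned E0 b" using Gram_Schmidt[OF finB CB] by blast
  let ?V = "tspan \<Phi>"
  have V: "subsp ?V" by (rule subsp_tspan[OF C\<Phi>])
  have CV: "C f" if "f \<in> ?V" for f using V that by (simp add: subsp_def)
  have "spanned ?B f" if "f \<in> ?V" for f
    using that
  proof induction
    case (transl \<phi> g)
    then have "spanned (B \<phi>) (\<lambda>x. \<phi> (x \<otimes> g))" using B by blast
    then show ?case by (rule spanned_mono) (use transl finB in auto)
  next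
    case (agree f h)
    show ?case by (rule spanned_cong[OF agree.IH agree.hyps(3)])
  qed (rule spanned_zero, rule spanned_add, assumption+, rule spanned_cmult, assumption)
  then have sp: "spanned E0 f" if "f \<in> ?V" for f
    using spanned_trans[of ?B f E0] finB E0(2) that by blast
  \<comment> \<open>\<open>E0\<close> spans every translate but need not lie in their span; it
    serves to bound the size of orthonormal sets inside that span.\<close>
  have "card E \<le> card E0" if "orthonormal_set E" "E \<subseteq> ?V" for E
    using card_orthonormal_le[OF E0(1) that(1)] sp that(2) by blast
  from orthonormal_basis[OF V this] obtain E where E: "orthonormal_set E" "E \<subseteq> ?V" "\<And>f. f \<in> ?V \<Longrightarrow> spanned E f" by blast
  have Ef: "f x = proj E f x" if "f \<in> ?V" "x \<in> carrier G" for f x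
    by (rule spanned_orthonormal[OF E(1) CV[OF that(1)] E(3)[OF that(1)] that(2)])
  define m where "m = card E"
  have "finite E" using E(1) by (simp add: orthonormal_set_def)
  from ex_bij_betw_nat_finite[OF this] obtain e where e: "bij_betw e {..<m} E"
    by (auto simp: m_def atLeast0LessThan)
  have eE: "e i \<in> E" "e i \<in> ?V" "C (e i)" if "i < m" for i
    using bij_betwE[OF e] that E(2) CV by auto
  have ipe: "ip (e i) (e j) = (if i = j then 1 else 0)" if "i < m" "j < m" for i j
    using E(1) eE(1)[OF that(1)] eE(1)[OF that(2)] bij_betw_imp_inj_on[OF e] that
    by (auto simp: orthonormal_set_def inj_on_def)
  have expand: "f x = (\<Sum>j<m. ip f (e j) * e j x)" if "f \<in> ?V" "x \<in> carrier G" for f x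
    unfolding Ef[OF that] proj_def by (rule sum.reindex_bij_betw[OF e, symmetric])
  have R: "(\<lambda>x. f (x \<otimes> g)) \<in> ?V" if "f \<in> ?V" "g \<in> carrier G" for f g
    by (rule tspan_rtrans[OF C\<Phi> that])
  \<comment> \<open>Column j holds the coordinates of the translate of \<open>e j\<close> by g.
    Right translations compose in the order of the product, so a homomorphism results without an
    inverse.\<close>
  define \<pi> where "\<pi> g i j = ip (\<lambda>x. e j (x \<otimes> g)) (e i)" for g i j
  have ipR: "ip (\<lambda>x. f (x \<otimes> g)) (e i) = (\<Sum>j<m. \<pi> g i j * ip f (e j))"
    if f: "f \<in> ?V" and g: "g \<in> carrier G" and i: "i < m" for f g i
  proof -
    have "ip (\<lambda>x. f (x \<otimes> g)) (e i) = ip (\<lambda>x. \<Sum>j<m. ip f (e j) * e j (x \<otimes> g)) (e i)"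
      using expand[OF f] g by (intro ip_cong) auto
    also have "\<dots> = (\<Sum>j<m. ip f (e j) * ip (\<lambda>x. e j (x \<otimes> g)) (e i))"
      using C_rtrans[OF eE(3) g] i eE(3) by (intro ip_sum_left) auto
    finally show ?thesis by (simp add: \<pi>_def mult.commute)
  qed
  have 1: "\<pi> (g \<otimes> h) i j = (\<Sum>k<m. \<pi> g i k * \<pi> h k j)"
    if gh: "g \<in> carrier G" "h \<in> carrier G" "i < m" "j < m" for g h i j
  proof -
    have "\<pi> (g \<otimes> h) i j = ip (\<lambda>x. (\<lambda>y. e j (y \<otimes> h)) (x \<otimes> g)) (e i)"
      unfolding \<pi>_def using gh by (intro ip_cong) (auto simp: m_assoc)
    also have "\<dots> = (\<Sum>k<m. \<pi> g i k * ip (\<lambda>y. e j (y \<otimes> h)) (e k))"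
      using gh by (intro ipR R eE)
    finally show ?thesis by (simp add: \<pi>_def)
  qed
  have 2: "\<pi> \<one> i j = (if i = j then 1 else 0)" if "i < m" "j < m" for i j
  proof -
    have "\<pi> \<one> i j = ip (e j) (e i)" unfolding \<pi>_def by (intro ip_cong) auto
    then show ?thesis using ipe that by auto
  qed
  have 3: "\<pi> (inv g) i j = \<pi> g j i" if gij: "g \<in> carrier G" "i < m" "j < m" for g i j
  proof -
    have "\<pi> (inv g) i j = ip (\<lambda>x. e j (x \<otimes> inv g)) (e i)" by (simp add: \<pi>_def)
    also have "\<dots> = ip (\<lambda>x. (\<lambda>y. e j (y \<otimes> inv g)) (x \<otimes> g)) (\<lambda>x. e i (x \<otimes> g))"
      by (rule ip_rtrans[symmetric, OF C_rtrans[OF eE(3)[OF gij(3)] inv_closed[OF gij(1)]] eE(3)[OF gij(2)] gij(1)])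
    also have "\<dots> = ip (e j) (\<lambda>x. e i (x \<otimes> g))"
      using gij by (intro ip_cong) (auto simp: m_assoc)
    finally show ?thesis by (simp add: \<pi>_def ip_commute)
  qed
  have 4: "C (\<lambda>g. \<pi> g i j)" if "i < m" "j < m" for i j
    unfolding \<pi>_def ip_def
  proof (rule C_haar)
    have "continuous_map (prod_topology T T) T (\<lambda>p. snd p \<otimes> fst p)" by (intro continuous_intros)
    from continuous_map_real_mult[OF C_comp[OF eE(3)[OF that(2)] this] C_comp[OF eE(3)[OF that(1)] continuous_map_snd]]
    show "continuous_map (prod_topology T T) euclideanreal (\<lambda>(g, x). e j (x \<otimes> g) * e i x)"
      by (simp add: case_prod_unfold)
  qed
  define v where "v \<phi> j = ip \<phi> (e j)" for \<phi> j
  have 5: "(\<forall>i<m. (\<Sum>j<m. \<pi> g i j * v \<phi> j) = v \<phi> i) \<longleftrightarrow> (\<forall>x\<in>carrier G. \<phi> (x \<otimes> g) = \<phi> x)"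
    if \<phi>: "\<phi> \<in> \<Phi>" and g: "g \<in> carrier G" for \<phi> g
  proof -
    have "(\<lambda>x. \<phi> (x \<otimes> \<one>)) \<in> ?V" using \<phi> by (intro tspan.transl) auto
    then have \<phi>V: "\<phi> \<in> ?V" by (rule tspan.agree) (use C\<Phi>[OF \<phi>] in auto)
    have coef: "(\<Sum>j<m. \<pi> g i j * v \<phi> j) = ip (\<lambda>x. \<phi> (x \<otimes> g)) (e i)" if "i < m" for i
      using ipR[OF \<phi>V g that] by (simp add: v_def)
    show ?thesis
    proof
      assume inv: "\<forall>i<m. (\<Sum>j<m. \<pi> g i j * v \<phi> j) = v \<phi> i"
      show "\<forall>x\<in>carrier G. \<phi> (x \<otimes> g) = \<phi> x"
      proof
        fix x assume x: "x \<in> carrier G"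
        show "\<phi> (x \<otimes> g) = \<phi> x"
          using expand[OF R[OF \<phi>V g] x] expand[OF \<phi>V x] inv coef by (simp add: v_def)
      qed
    next
      assume "\<forall>x\<in>carrier G. \<phi> (x \<otimes> g) = \<phi> x"
      then have "ip (\<lambda>x. \<phi> (x \<otimes> g)) (e i) = ip \<phi> (e i)" for i by (intro ip_cong) auto
      then show "\<forall>i<m. (\<Sum>j<m. \<pi> g i j * v \<phi> j) = v \<phi> i" using coef by (simp add: v_def)
    qed
  qed
  have "orthogonal_rep m \<pi>" unfolding orthogonal_rep_def using 1 2 3 4 by simp
  with 5 show ?thesis by (intro that[of m \<pi> v]) auto
qed

section \<open>Convolution operators and their eigenspaces\<close>

definition conv_op :: "('a \<Rightarrow> real) \<Rightarrow> ('a \<Rightarrow> real) \<Rightarrow> 'a \<Rightarrow> real" where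
  "conv_op k f x = haar (\<lambda>y. k (x \<otimes> inv y) * f y)"

lemma C_kernel: "C k \<Longrightarrow> x \<in> carrier G \<Longrightarrow> C (\<lambda>y. k (x \<otimes> inv y))"
  by (rule C_comp[of k]) (auto intro!: continuous_intros)

lemma C_kernel2: "C k \<Longrightarrow> continuous_map (prod_topology T T) euclideanreal (\<lambda>(x, y). k (x \<otimes> inv y))"
  unfolding case_prod_unfold by (rule C_comp[of k]) (auto intro!: continuous_intros)

lemma conv_op_ip: "conv_op k f x = ip (\<lambda>y. k (x \<otimes> inv y)) f"
  by (simp add: conv_op_def ip_def)

lemma C_conv_op:
  assumes "C k" "C f"
  shows "C (conv_op k f)"
proof -
  have "continuous_map (prod_topology T T) euclideanreal (\<lambda>(x, y). k (x \<otimes> inv y) * f y)"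
    using continuous_map_real_mult[OF C_kernel2[OF assms(1)] C_comp[OF assms(2) continuous_map_snd]]
    by (simp add: case_prod_unfold)
  from C_haar[OF this] show ?thesis by (simp add: conv_op_def[abs_def])
qed

lemma conv_op_diff: "C k \<Longrightarrow> C f \<Longrightarrow> C h \<Longrightarrow> x \<in> carrier G \<Longrightarrow> conv_op k (\<lambda>y. f y - h y) x = conv_op k f x - conv_op k h x"
  by (simp add: conv_op_ip ip_diff_right C_kernel)

lemma conv_op_add: "C k \<Longrightarrow> C f \<Longrightarrow> C h \<Longrightarrow> x \<in> carrier G \<Longrightarrow> conv_op k (\<lambda>y. f y + h y) x = conv_op k f x + conv_op k h x"
  by (simp add: conv_op_ip ip_add_right C_kernel)

lemma conv_op_cmult: "C k \<Longrightarrow> C f \<Longrightarrow> x \<in> carrier G \<Longrightarrow> conv_op k (\<lambda>y. c * f y) x = c * conv_op k f x"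
  by (simp add: conv_op_ip ip_cmult_right C_kernel)

lemma conv_op_cong: "(\<And>y. y \<in> carrier G \<Longrightarrow> f y = h y) \<Longrightarrow> conv_op k f x = conv_op k h x"
  by (simp add: conv_op_ip cong: ip_cong)

text \<open>The kernel depends on \<open>x \<otimes> inv y\<close> only, which does not change when
  both points are multiplied by g on the right. Eigenspaces are therefore stable under right
  translation.\<close>

lemma conv_op_rtrans:
  assumes k: "C k" and f: "C f" and x: "x \<in> carrier G" and g: "g \<in> carrier G"
  shows "conv_op k (\<lambda>y. f (y \<otimes> g)) x = conv_op k f (x \<otimes> g)"
proof -
  have "conv_op k f (x \<otimes> g) = haar (\<lambda>y. k (x \<otimes> g \<otimes> inv (y \<otimes> g)) * f (y \<otimes> g))"
    unfolding conv_op_def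
    by (rule haar_rtrans[symmetric, where f = "\<lambda>y. k (x \<otimes> g \<otimes> inv y) * f y"])
      (use k f x g in \<open>auto intro!: continuous_map_real_mult C_kernel\<close>)
  also have "\<dots> = conv_op k (\<lambda>y. f (y \<otimes> g)) x"
    unfolding conv_op_def
  proof (rule haar_cong)
    fix y assume y: "y \<in> carrier G"
    have "g \<otimes> (inv g \<otimes> inv y) = inv y" using y g by (simp add: m_assoc[symmetric])
    then have "x \<otimes> g \<otimes> inv (y \<otimes> g) = x \<otimes> inv y" using x y g by (simp add: inv_mult_group m_assoc)
    then show "k (x \<otimes> g \<otimes> inv (y \<otimes> g)) * f (y \<otimes> g) = k (x \<otimes> inv y) * f (y \<otimes> g)"
      using x y g by simp
  qed
  finally show ?thesis by simp
qed

text \<open>An even k makes \<open>k (x \<otimes> inv y)\<close> symmetric in x and y; what remains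
  is an exchange of the two integrations.\<close>

lemma conv_op_symmetric:
  assumes k: "C k" and even: "\<And>x. x \<in> carrier G \<Longrightarrow> k (inv x) = k x" and f: "C f" and h: "C h"
  shows "ip (conv_op k f) h = ip f (conv_op k h)"
proof -
  have CF: "continuous_map (prod_topology T T) euclideanreal (\<lambda>(x, y). k (x \<otimes> inv y) * f y * h x)"
    using continuous_map_real_mult[OF continuous_map_real_mult[OF C_kernel2[OF k] C_comp[OF f continuous_map_snd]]
        C_comp[OF h continuous_map_fst]]
    by (simp add: case_prod_unfold)
  have "ip (conv_op k f) h = haar (\<lambda>x. haar (\<lambda>y. k (x \<otimes> inv y) * f y * h x))"
    unfolding ip_def
  proof (rule haar_cong)
    fix x assume x: "x \<in> carrier G"
    show "conv_op k f x * h x = haar (\<lambda>y. k (x \<otimes> inv y) * f y * h x)"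
      using haar_cmult[of "\<lambda>y. k (x \<otimes> inv y) * f y" "h x"] C_kernel[OF k x] f
      by (simp add: conv_op_def mult.commute continuous_map_real_mult)
  qed
  also have "\<dots> = haar (\<lambda>y. haar (\<lambda>x. k (x \<otimes> inv y) * f y * h x))" by (rule haar_swap[OF CF])
  also have "\<dots> = ip f (conv_op k h)"
    unfolding ip_def
  proof (rule haar_cong)
    fix y assume y: "y \<in> carrier G"
    have "haar (\<lambda>x. k (x \<otimes> inv y) * f y * h x) = haar (\<lambda>x. f y * (k (y \<otimes> inv x) * h x))"
    proof (rule haar_cong)
      fix x assume x: "x \<in> carrier G"
      have "k (x \<otimes> inv y) = k (y \<otimes> inv x)"
        using even[of "x \<otimes> inv y"] x y by (simp add: inv_mult_group)
      then show "k (x \<otimes> inv y) * f y * h x = f y * (k (y \<otimes> inv x) * h x)" by simp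
    qed
    also have "\<dots> = f y * conv_op k h y"
      unfolding conv_op_def by (rule haar_cmult) (use C_kernel[OF k y] h in \<open>auto intro: continuous_map_real_mult\<close>)
    finally show "haar (\<lambda>x. k (x \<otimes> inv y) * f y * h x) = f y * conv_op k h y" .
  qed
  finally show ?thesis .
qed

lemma ip_kernel_le:
  assumes k: "C k" and K: "\<And>x. x \<in> carrier G \<Longrightarrow> \<bar>k x\<bar> \<le> K" and x: "x \<in> carrier G"
  shows "ip (\<lambda>y. k (x \<otimes> inv y)) (\<lambda>y. k (x \<otimes> inv y)) \<le> K\<^sup>2"
  using C_kernel[OF k x] by (rule ip_le_square) (use K x in auto)

lemma conv_op_square_le:
  assumes k: "C k" and K: "\<And>x. x \<in> carrier G \<Longrightarrow> \<bar>k x\<bar> \<le> K" and f: "C f" and x: "x \<in> carrier G"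
  shows "(conv_op k f x)\<^sup>2 \<le> K\<^sup>2 * ip f f"
proof -
  have "(conv_op k f x)\<^sup>2 \<le> ip (\<lambda>y. k (x \<otimes> inv y)) (\<lambda>y. k (x \<otimes> inv y)) * ip f f"
    unfolding conv_op_ip by (rule ip_Cauchy_Schwarz[OF C_kernel[OF k x] f])
  also have "\<dots> \<le> K\<^sup>2 * ip f f"
    by (intro mult_right_mono ip_kernel_le[OF k K x] ip_nonneg f)
  finally show ?thesis .
qed

text \<open>The neighbourhood depends on k, x and e but not on f. Equicontinuity of the image of the
  unit ball is the compactness of the operator, needed for the maximising sequence.\<close>

lemma conv_op_equicontinuous:
  assumes k: "C k" and x: "x \<in> carrier G" and e: "e > 0"
  obtains U where "openin T U" "x \<in> U"
    "\<And>f y. C f \<Longrightarrow> ip f f \<le> 1 \<Longrightarrow> y \<in> U \<Longrightarrow> \<bar>conv_op k f y - conv_op k f x\<bar> \<le> e"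
proof -
  have "x \<in> topspace T" using x by simp
  from uniform_on_compact[OF C_kernel2[OF k] compact this e] obtain U where
    U: "openin T U" "x \<in> U" "\<And>y z. y \<in> U \<Longrightarrow> z \<in> topspace T \<Longrightarrow> \<bar>k (y \<otimes> inv z) - k (x \<otimes> inv z)\<bar> < e"
    by blast
  have "\<bar>conv_op k f y - conv_op k f x\<bar> \<le> e" if f: "C f" "ip f f \<le> 1" and y: "y \<in> U" for f y
  proof -
    have yG: "y \<in> carrier G" using openin_subset[OF U(1)] y by auto
    let ?d = "\<lambda>z. k (y \<otimes> inv z) - k (x \<otimes> inv z)"
    have Cd: "C ?d" using C_kernel[OF k] x yG by (intro continuous_map_diff)
    have "conv_op k f y - conv_op k f x = ip ?d f"
      unfolding conv_op_ip using C_kernel[OF k] x yG f by (simp add: ip_diff_left)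
    then have "(conv_op k f y - conv_op k f x)\<^sup>2 \<le> ip ?d ?d * ip f f"
      using ip_Cauchy_Schwarz[OF Cd f(1)] by simp
    also have "\<dots> \<le> e\<^sup>2 * 1"
      using U(3)[OF y] by (intro mult_mono ip_le_square Cd f(2) ip_nonneg f(1)) (auto intro: less_imp_le)
    finally show ?thesis using e by (simp add: abs_le_square_iff[symmetric])
  qed
  with U(1,2) that show ?thesis by blast
qed

text \<open>A Hilbert--Schmidt bound: for an orthonormal E in the eigenspace of \<nu>, symmetry
  gives every \<open>conv_op k e\<close> the squared norm \<nu>, while Bessel's inequality for y
  \<mapsto> \<open>k (x \<otimes> inv y)\<close> bounds the sum of their squares at each x by K^2.
  So E has at most K^2 / \<nu> elements.\<close>

lemma rep_fun_eigenfunction: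
  assumes k: "C k" and even: "\<And>x. x \<in> carrier G \<Longrightarrow> k (inv x) = k x" and \<nu>: "\<nu> > 0"
    and \<psi>: "C \<psi>" "\<And>x. x \<in> carrier G \<Longrightarrow> conv_op k (conv_op k \<psi>) x = \<nu> * \<psi> x"
  shows "rep_fun \<psi>"
proof -
  obtain K where K: "K > 0" "\<And>x. x \<in> carrier G \<Longrightarrow> \<bar>k x\<bar> \<le> K" using C_bounded[OF k] by metis
  define V where "V = {f. C f \<and> (\<forall>x\<in>carrier G. conv_op k (conv_op k f) x = \<nu> * f x)}"
  have V: "subsp V"
    unfolding subsp_def
  proof (intro conjI ballI allI)
    fix f assume f: "f \<in> V"
    then have Cf: "C f" and ef: "\<And>x. x \<in> carrier G \<Longrightarrow> conv_op k (conv_op k f) x = \<nu> * f x" by (auto simp: V_def)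
    show "C f" by (rule Cf)
    fix c
    have "conv_op k (conv_op k (\<lambda>x. c * f x)) x = \<nu> * (c * f x)" if "x \<in> carrier G" for x
    proof -
      have "conv_op k (conv_op k (\<lambda>x. c * f x)) x = conv_op k (\<lambda>x. c * conv_op k f x) x"
        using k Cf by (intro conv_op_cong conv_op_cmult)
      also have "\<dots> = c * conv_op k (conv_op k f) x" using k Cf that by (intro conv_op_cmult C_conv_op)
      finally show ?thesis using ef that by simp
    qed
    then show "(\<lambda>x. c * f x) \<in> V" using Cf by (simp add: V_def continuous_map_real_mult_left)
    fix g assume "g \<in> V"
    then have Cg: "C g" and eg: "\<And>x. x \<in> carrier G \<Longrightarrow> conv_op k (conv_op k g) x = \<nu> * g x" by (auto simp: V_def)
    have "conv_op k (conv_op k (\<lambda>x. f x + g x)) x = \<nu> * (f x + g x)" if "x \<in> carrier G" for x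
    proof -
      have "conv_op k (conv_op k (\<lambda>x. f x + g x)) x = conv_op k (\<lambda>x. conv_op k f x + conv_op k g x) x"
        using k Cf Cg by (intro conv_op_cong conv_op_add)
      also have "\<dots> = conv_op k (conv_op k f) x + conv_op k (conv_op k g) x" using k Cf Cg that by (intro conv_op_add C_conv_op)
      finally show ?thesis using ef eg that by (simp add: algebra_simps)
    qed
    then show "(\<lambda>x. f x + g x) \<in> V" using Cf Cg by (simp add: V_def continuous_map_add)
  next
    have z: "conv_op k (\<lambda>x. 0) = (\<lambda>x. 0)" by (simp add: conv_op_def fun_eq_iff)
    show "(\<lambda>x. 0) \<in> V" by (simp add: V_def z)
  qed
  have bound: "card E \<le> nat \<lceil>K\<^sup>2 / \<nu>\<rceil>" if E: "orthonormal_set E" "E \<subseteq> V" for E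
  proof -
    have CE: "C e" if "e \<in> E" for e using E that by (auto simp: orthonormal_set_def)
    have \<nu>e: "ip (conv_op k e) (conv_op k e) = \<nu>" if e: "e \<in> E" for e
    proof -
      have "ip (conv_op k e) (conv_op k e) = ip e (conv_op k (conv_op k e))"
        by (rule conv_op_symmetric[OF k even CE[OF e] C_conv_op[OF k CE[OF e]]])
      also have "\<dots> = ip e (\<lambda>x. \<nu> * e x)" using e E(2) by (intro ip_cong) (auto simp: V_def)
      also have "\<dots> = \<nu> * ip e e" by (rule ip_cmult_right[OF CE[OF e] CE[OF e]])
      finally show ?thesis using e E(1) by (simp add: orthonormal_set_def)
    qed
    have "real (card E) * \<nu> = (\<Sum>e\<in>E. \<nu>)" by simp
    also have "\<dots> = (\<Sum>e\<in>E. haar (\<lambda>x. conv_op k e x * conv_op k e x))"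
      by (intro sum.cong refl) (simp add: \<nu>e[symmetric] ip_def)
    also have "\<dots> = haar (\<lambda>x. \<Sum>e\<in>E. conv_op k e x * conv_op k e x)"
      using E(1) by (intro haar_sum[symmetric]) (auto simp: orthonormal_set_def intro!: continuous_map_real_mult C_conv_op k)
    also have "\<dots> \<le> haar (\<lambda>x. K\<^sup>2)"
    proof (rule haar_mono)
      show "C (\<lambda>x. \<Sum>e\<in>E. conv_op k e x * conv_op k e x)"
        using E(1) by (intro continuous_map_sum) (auto simp: orthonormal_set_def intro!: continuous_map_real_mult C_conv_op k)
      fix x assume x: "x \<in> carrier G"
      have "(\<Sum>e\<in>E. conv_op k e x * conv_op k e x) = (\<Sum>e\<in>E. (ip (\<lambda>y. k (x \<otimes> inv y)) e)\<^sup>2)"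
        by (simp add: conv_op_ip power2_eq_square)
      also have "\<dots> \<le> K\<^sup>2"
        using Bessel[OF E(1) C_kernel[OF k x]] ip_kernel_le[OF k K(2) x] by linarith
      finally show "(\<Sum>e\<in>E. conv_op k e x * conv_op k e x) \<le> K\<^sup>2" .
    qed auto
    finally have "real (card E) \<le> K\<^sup>2 / \<nu>" using \<nu> by (simp add: field_simps)
    then show ?thesis by linarith
  qed
  from orthonormal_basis[OF V bound] obtain E where E: "orthonormal_set E" "E \<subseteq> V" "\<And>f. f \<in> V \<Longrightarrow> spanned E f" by blast
  have "(\<lambda>x. \<psi> (x \<otimes> g)) \<in> V" if g: "g \<in> carrier G" for g
  proof -
    have "conv_op k (conv_op k (\<lambda>y. \<psi> (y \<otimes> g))) x = \<nu> * \<psi> (x \<otimes> g)" if x: "x \<in> carrier G" for x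
    proof -
      have "conv_op k (conv_op k (\<lambda>y. \<psi> (y \<otimes> g))) x = conv_op k (\<lambda>y. conv_op k \<psi> (y \<otimes> g)) x"
        using k \<psi>(1) g by (intro conv_op_cong conv_op_rtrans)
      also have "\<dots> = conv_op k (conv_op k \<psi>) (x \<otimes> g)" using k \<psi>(1) g x by (intro conv_op_rtrans C_conv_op)
      finally show ?thesis using \<psi>(2) x g by simp
    qed
    then show ?thesis using \<psi>(1) g by (simp add: V_def C_rtrans)
  qed
  then show ?thesis unfolding rep_fun_def using \<psi>(1) E by (auto simp: orthonormal_set_def intro!: exI[of _ E])
qed

lemma conv_op_abs_le:
  assumes k: "C k" and K: "0 \<le> K" "\<And>x. x \<in> carrier G \<Longrightarrow> \<bar>k x\<bar> \<le> K" and f: "C f" "ip f f \<le> d\<^sup>2" "0 \<le> d"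
    and x: "x \<in> carrier G"
  shows "\<bar>conv_op k f x\<bar> \<le> K * d"
proof -
  have "(conv_op k f x)\<^sup>2 \<le> K\<^sup>2 * ip f f" by (rule conv_op_square_le[OF k K(2) f(1) x])
  also have "\<dots> \<le> K\<^sup>2 * d\<^sup>2" using f(2) by (intro mult_left_mono) auto
  finally have "(conv_op k f x)\<^sup>2 \<le> (K * d)\<^sup>2" by (simp add: power_mult_distrib)
  then show ?thesis using K(1) f(3) by (simp add: abs_le_square_iff[symmetric])
qed

text \<open>The Rayleigh quotient of the squared convolution operator is maximised on the functions
  \<open>x \<mapsto> u (xg) - u x\<close>; by compactness a maximising sequence yields an eigenfunction, which is
  orthogonal to all \<open>g\<close>-invariant functions and hence is not \<open>g\<close>-invariant itself.\<close>
lemma eigenfunction_exists: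
  assumes k: "C k" and even: "\<And>x. x \<in> carrier G \<Longrightarrow> k (inv x) = k x"
    and u: "C u" and g: "g \<in> carrier G" and x0: "x0 \<in> carrier G" "conv_op k (\<lambda>x. u (x \<otimes> g) - u x) x0 \<noteq> 0"
  obtains \<nu> \<psi> where "\<nu> > 0" "C \<psi>" "\<And>x. x \<in> carrier G \<Longrightarrow> conv_op k (conv_op k \<psi>) x = \<nu> * \<psi> x"
    "\<exists>x\<in>carrier G. \<psi> (x \<otimes> g) \<noteq> \<psi> x"
proof -
  obtain K where K: "K > 0" "\<And>x. x \<in> carrier G \<Longrightarrow> \<bar>k x\<bar> \<le> K" using C_bounded[OF k] by metis
  then have K0: "K \<ge> 0" by simp
  \<comment> \<open>Convolution commutes with right translation, hence with \<open>D\<close>. The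
    functions \<open>D w\<close> thus form a space stable under the operator, and
    \<open>N_nu\<close> will apply to their images as well.\<close>
  define D where "D w = (\<lambda>x. w (x \<otimes> g) - w x)" for w :: "'a \<Rightarrow> real"
  have CD: "C (D w)" if "C w" for w
    unfolding D_def by (rule continuous_map_diff[OF C_rtrans[OF that g] that])
  have Dc: "(\<lambda>x. c * D w x) = D (\<lambda>x. c * w x)" for c w by (simp add: D_def algebra_simps)
  have SD: "conv_op k (D w) x = D (conv_op k w) x" if "C w" "x \<in> carrier G" for w x
    unfolding D_def using conv_op_diff[OF k C_rtrans[OF that(1) g] that(1) that(2)] conv_op_rtrans[OF k that g] by simp
  define N where "N f = ip (conv_op k f) (conv_op k f)" for f
  have N_le: "N f \<le> K\<^sup>2 * ip f f" if f: "C f" for f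
  proof -
    have "N f \<le> haar (\<lambda>x. K\<^sup>2 * ip f f)"
      unfolding N_def ip_def[of "conv_op k f"]
      by (rule haar_mono) (use conv_op_square_le[OF k K(2) f] C_conv_op[OF k f] in
          \<open>auto simp: power2_eq_square intro: continuous_map_real_mult\<close>)
    then show ?thesis by simp
  qed
  have N_scale: "N (\<lambda>x. c * f x) = c * (c * N f)" if f: "C f" for c f
  proof -
    have "N (\<lambda>x. c * f x) = ip (\<lambda>x. c * conv_op k f x) (\<lambda>x. c * conv_op k f x)"
      unfolding N_def using conv_op_cmult[OF k f] by (intro ip_cong)
    also have "\<dots> = c * (c * N f)"
      unfolding N_def using C_conv_op[OF k f] by (simp add: ip_cmult_left ip_cmult_right continuous_map_real_mult_left)
    finally show ?thesis .
  qed
  have ip_scale: "ip (\<lambda>x. c * f x) (\<lambda>x. c * f x) = c * (c * ip f f)" if "C f" for c f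
    using that by (simp add: ip_cmult_left ip_cmult_right continuous_map_real_mult_left)
  define X where "X = {N (D w) | w. C w \<and> ip (D w) (D w) = 1}"
  have normalize: "\<exists>c. c > 0 \<and> c * (c * ip f f) = 1" if "C f" "ip f f \<noteq> 0" for f
  proof -
    have p: "ip f f > 0" using that ip_nonneg[OF that(1)] by simp
    show ?thesis by (rule exI[of _ "inverse (sqrt (ip f f))"]) (use p in \<open>simp add: field_simps\<close>)
  qed
  have nz: "ip (D u) (D u) \<noteq> 0"
  proof
    assume "ip (D u) (D u) = 0"
    then have "conv_op k (D u) x0 = conv_op k (\<lambda>x. 0) x0" using ip_eq_0[OF CD[OF u]] by (intro conv_op_cong) auto
    then show False using x0(2) by (simp add: conv_op_def D_def)
  qed
  obtain c where c: "c > 0" "c * (c * ip (D u) (D u)) = 1" using normalize[OF CD[OF u] nz] by blast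
  have "N (D u) \<noteq> 0"
    using ip_eq_0[OF C_conv_op[OF k CD[OF u]] _ x0(1)] x0(2) by (auto simp: N_def D_def)
  then have Npos: "N (D u) > 0" using ip_nonneg[OF C_conv_op[OF k CD[OF u]]] by (simp add: N_def)
  have cu: "C (\<lambda>x. c * u x)" using u by (rule continuous_map_real_mult_left)
  have X1: "N (D (\<lambda>x. c * u x)) \<in> X"
    unfolding X_def using cu c(2) ip_scale[OF CD[OF u], of c] by (auto simp: Dc)
  have X1pos: "N (D (\<lambda>x. c * u x)) > 0"
    using N_scale[OF CD[OF u], of c] c(1) Npos by (simp add: Dc)
  have bdd: "bdd_above X"
    unfolding X_def using N_le[OF CD] by (intro bdd_aboveI[of _ "K\<^sup>2"]) force
  define \<nu> where "\<nu> = Sup X"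
  have \<nu>: "\<nu> > 0" using cSup_upper[OF X1 bdd] X1pos by (simp add: \<nu>_def)
  have N_nu: "N (D w) \<le> \<nu> * ip (D w) (D w)" if w: "C w" for w
  proof (cases "ip (D w) (D w) = 0")
    case True
    then show ?thesis using N_le[OF CD[OF w]] by simp
  next
    case False
    obtain c where c: "c > 0" "c * (c * ip (D w) (D w)) = 1" using normalize[OF CD[OF w] False] by blast
    have "C (\<lambda>x. c * w x)" using w by (rule continuous_map_real_mult_left)
    then have "N (D (\<lambda>x. c * w x)) \<in> X"
      unfolding X_def using c(2) ip_scale[OF CD[OF w], of c] by (auto simp: Dc)
    then have "N (D (\<lambda>x. c * w x)) \<le> \<nu>" unfolding \<nu>_def using bdd by (rule cSup_upper)
    then have "c * (c * N (D w)) \<le> \<nu> * (c * (c * ip (D w) (D w)))"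
      using N_scale[OF CD[OF w], of c] c(2) by (simp add: Dc)
    then have "(c * c) * N (D w) \<le> (c * c) * (\<nu> * ip (D w) (D w))" by (simp add: algebra_simps)
    then show ?thesis using c(1) by (simp add: mult_le_cancel_left)
  qed
  have "\<exists>w. C w \<and> ip (D w) (D w) = 1 \<and> N (D w) > \<nu> - inverse (real (Suc n))" for n
  proof -
    have "\<nu> - inverse (real (Suc n)) < Sup X" unfolding \<nu>_def by simp
    from less_cSupD[OF _ this] X1 obtain y where "y \<in> X" "\<nu> - inverse (real (Suc n)) < y" by blast
    then show ?thesis unfolding X_def by blast
  qed
  then obtain w where w: "\<And>n. C (w n)" "\<And>n. ip (D (w n)) (D (w n)) = 1"
      "\<And>n. N (D (w n)) > \<nu> - inverse (real (Suc n))"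
    by metis
  define f where "f n = D (w n)" for n
  define F where "F n = conv_op k (f n)" for n
  have f: "C (f n)" "ip (f n) (f n) = 1" for n using w CD by (auto simp: f_def)
  have CF: "C (F n)" for n unfolding F_def by (rule C_conv_op[OF k f(1)])
  have NF: "N (f n) = ip (F n) (F n)" for n by (simp add: N_def F_def)
  have FD: "F n x = D (conv_op k (w n)) x" if "x \<in> carrier G" for n x
    unfolding F_def f_def by (rule SD[OF w(1) that])
  have bnd: "\<bar>F n x\<bar> \<le> K" if "x \<in> carrier G" for n x
    unfolding F_def using conv_op_abs_le[OF k K0 K(2) f(1), of n 1 x] f(2) that by simp
  have "\<exists>U. openin T U \<and> x \<in> U \<and> (\<forall>n. \<forall>y\<in>U. \<bar>F n y - F n x\<bar> \<le> e)" if "x \<in> carrier G" "e > 0" for x e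
  proof -
    from conv_op_equicontinuous[OF k that] obtain U where "openin T U" "x \<in> U"
      "\<And>f y. C f \<Longrightarrow> ip f f \<le> 1 \<Longrightarrow> y \<in> U \<Longrightarrow> \<bar>conv_op k f y - conv_op k f x\<bar> \<le> e" by blast
    then show ?thesis unfolding F_def using f by (intro exI[of _ U]) auto
  qed
  from Arzela_Ascoli_cluster[of F K, OF bnd this] obtain \<psi> where \<psi>: "C \<psi>"
      and cl: "\<And>e M. e > 0 \<Longrightarrow> \<exists>n\<ge>(M::nat). \<forall>x\<in>carrier G. \<bar>F n x - \<psi> x\<bar> \<le> e"
    by blast
  have near: "\<exists>n. (\<forall>x\<in>carrier G. \<bar>F n x - \<psi> x\<bar> \<le> e) \<and> N (f n) > \<nu> - d" if ed: "e > 0" "d > 0" for e d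
  proof -
    obtain M where M: "inverse (real (Suc M)) < d" using reals_Archimedean[OF ed(2)] by blast
    obtain n where n: "n \<ge> M" "\<forall>x\<in>carrier G. \<bar>F n x - \<psi> x\<bar> \<le> e" using cl[OF ed(1)] by blast
    have "inverse (real (Suc n)) \<le> inverse (real (Suc M))" using n(1) by (intro le_imp_inverse_le) auto
    then have "N (f n) > \<nu> - d" using w(3)[of n] M unfolding f_def by linarith
    with n(2) show ?thesis by blast
  qed
  have "conv_op k (conv_op k \<psi>) x = \<nu> * \<psi> x" if x: "x \<in> carrier G" for x
  proof (rule abs_le_all_imp_eq)
    fix e0 :: real assume e0: "e0 > 0"
    \<comment> \<open>The denominator collects three errors: K * K * e from replacing \<psi> by F n
      under the squared operator, K * e from the defect \<open>?q\<close>, and \<nu> * e from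
      returning from F n to \<psi>.\<close>
    define e where "e = e0 / (K * K + K + \<nu>)"
    have "K * K + K + \<nu> > 0" using K(1) \<nu> by (intro add_pos_pos mult_pos_pos)
    then have e: "e > 0" "(K * K + K + \<nu>) * e = e0" using e0 unfolding e_def by auto
    obtain n where n: "\<And>x. x \<in> carrier G \<Longrightarrow> \<bar>F n x - \<psi> x\<bar> \<le> e" "N (f n) > \<nu> - e\<^sup>2 / \<nu>"
      using near[OF e(1), of "e\<^sup>2 / \<nu>"] e(1) \<nu> by auto
    \<comment> \<open>\<open>?q\<close> measures how far f n is from being an eigenfunction.
      Expanding its squared norm and using \<open>N_nu\<close> for F n bounds it by \<nu> * (\<nu> -
      N (f n)), which the choice of n makes at most e^2.\<close>
    let ?h = "\<lambda>x. \<psi> x - F n x" and ?q = "\<lambda>x. conv_op k (F n) x - \<nu> * f n x"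
    have Ch: "C ?h" by (rule continuous_map_diff[OF \<psi> CF])
    have CSF: "C (conv_op k (F n))" by (rule C_conv_op[OF k CF])
    have C\<nu>f: "C (\<lambda>x. \<nu> * f n x)" by (rule continuous_map_real_mult_left[OF f(1)])
    have Cq: "C ?q" by (rule continuous_map_diff[OF CSF C\<nu>f])
    have h1: "ip ?h ?h \<le> e\<^sup>2" using n(1) by (intro ip_le_square Ch) (simp add: abs_minus_commute)
    have "ip (conv_op k ?h) (conv_op k ?h) \<le> (K * e)\<^sup>2"
      using conv_op_abs_le[OF k K0 K(2) Ch h1] e(1) by (intro ip_le_square C_conv_op k Ch) auto
    then have t1: "\<bar>conv_op k (conv_op k ?h) x\<bar> \<le> K * (K * e)"
      using conv_op_abs_le[OF k K0 K(2) C_conv_op[OF k Ch] _ _ x] K0 e(1) by auto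
    have "ip (conv_op k (F n)) (conv_op k (F n)) = N (D (conv_op k (w n)))"
      unfolding N_def using conv_op_cong[of "F n" "D (conv_op k (w n))" k] FD by (intro ip_cong) auto
    also have "\<dots> \<le> \<nu> * ip (D (conv_op k (w n))) (D (conv_op k (w n)))" by (rule N_nu[OF C_conv_op[OF k w(1)]])
    also have "ip (D (conv_op k (w n))) (D (conv_op k (w n))) = N (f n)"
      unfolding NF using FD by (intro ip_cong) auto
    finally have q1: "ip (conv_op k (F n)) (conv_op k (F n)) \<le> \<nu> * N (f n)" .
    have q2: "ip (conv_op k (F n)) (f n) = N (f n)"
      using conv_op_symmetric[OF k even CF f(1)] by (simp add: NF F_def[of n, symmetric])
    have "ip ?q ?q = ip (conv_op k (F n)) (conv_op k (F n)) - \<nu> * N (f n) - (\<nu> * N (f n) - \<nu> * (\<nu> * 1))"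
      using CSF C\<nu>f Cq f[of n] q2
      by (simp add: ip_diff_left ip_diff_right ip_cmult_left ip_cmult_right ip_commute[of "f n" "conv_op k (F n)"])
    also have "\<dots> \<le> \<nu> * (\<nu> - N (f n))" using q1 by (simp add: algebra_simps)
    also have "\<dots> \<le> \<nu> * (e\<^sup>2 / \<nu>)" using n(2) \<nu> by (intro mult_left_mono) auto
    finally have "ip ?q ?q \<le> e\<^sup>2" using \<nu> by simp
    then have t2: "\<bar>conv_op k ?q x\<bar> \<le> K * e" using conv_op_abs_le[OF k K0 K(2) Cq _ _ x] e(1) by auto
    have "conv_op k (conv_op k ?h) x = conv_op k (\<lambda>x. conv_op k \<psi> x - conv_op k (F n) x) x"
      using conv_op_diff[OF k \<psi> CF] by (intro conv_op_cong)
    also have "\<dots> = conv_op k (conv_op k \<psi>) x - conv_op k (conv_op k (F n)) x" by (rule conv_op_diff[OF k C_conv_op[OF k \<psi>] CSF x])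
    finally have e1: "conv_op k (conv_op k ?h) x = conv_op k (conv_op k \<psi>) x - conv_op k (conv_op k (F n)) x" .
    have e2: "conv_op k ?q x = conv_op k (conv_op k (F n)) x - \<nu> * F n x"
      using conv_op_diff[OF k CSF C\<nu>f x] conv_op_cmult[OF k f(1) x, of \<nu> n] by (simp add: F_def)
    have t3: "\<bar>\<nu> * (F n x - \<psi> x)\<bar> \<le> \<nu> * e"
      using n(1)[OF x] \<nu> by (simp add: abs_mult)
    have "conv_op k (conv_op k \<psi>) x - \<nu> * \<psi> x = conv_op k (conv_op k ?h) x + conv_op k ?q x + \<nu> * (F n x - \<psi> x)"
      unfolding e1 e2 by (simp add: algebra_simps)
    then have "\<bar>conv_op k (conv_op k \<psi>) x - \<nu> * \<psi> x\<bar> \<le> K * (K * e) + K * e + \<nu> * e" using t1 t2 t3 by linarith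
    also have "\<dots> = e0" using e(2) by (simp add: algebra_simps)
    finally show "\<bar>conv_op k (conv_op k \<psi>) x - \<nu> * \<psi> x\<bar> \<le> e0" .
  qed
  moreover have "\<exists>x\<in>carrier G. \<psi> (x \<otimes> g) \<noteq> \<psi> x"
  proof (rule ccontr)
    assume "\<not> (\<exists>x\<in>carrier G. \<psi> (x \<otimes> g) \<noteq> \<psi> x)"
    then have inv: "\<And>x. x \<in> carrier G \<Longrightarrow> \<psi> (x \<otimes> g) = \<psi> x" by metis
    \<comment> \<open>An invariant \<psi> would be orthogonal to F n, so the squared norm of F n
      could not exceed that of F n - \<psi>, which is at most e^2 = \<nu> / 2; but n is chosen with
      N (f n) > \<nu> / 2.\<close>
    define e where "e = sqrt (\<nu> / 2)"
    have e: "e > 0" "e\<^sup>2 = \<nu> / 2" using \<nu> by (auto simp: e_def)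
    obtain n where n: "\<And>x. x \<in> carrier G \<Longrightarrow> \<bar>F n x - \<psi> x\<bar> \<le> e" "N (f n) > \<nu> - \<nu> / 2"
      using near[OF e(1), of "\<nu> / 2"] \<nu> by auto
    have CSw: "C (conv_op k (w n))" by (rule C_conv_op[OF k w(1)])
    have "ip \<psi> (F n) = ip \<psi> (D (conv_op k (w n)))" using FD by (intro ip_cong) auto
    also have "\<dots> = ip \<psi> (\<lambda>x. conv_op k (w n) (x \<otimes> g)) - ip \<psi> (conv_op k (w n))"
      unfolding D_def by (rule ip_diff_right[OF C_rtrans[OF CSw g] CSw \<psi>])
    also have "ip \<psi> (\<lambda>x. conv_op k (w n) (x \<otimes> g)) = ip (\<lambda>x. \<psi> (x \<otimes> g)) (\<lambda>x. conv_op k (w n) (x \<otimes> g))"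
      using inv by (intro ip_cong) auto
    also have "\<dots> = ip \<psi> (conv_op k (w n))" by (rule ip_rtrans[OF \<psi> CSw g])
    finally have orth: "ip \<psi> (F n) = 0" by simp
    let ?h = "\<lambda>x. F n x - \<psi> x"
    have Ch: "C ?h" by (rule continuous_map_diff[OF CF \<psi>])
    have "(ip (F n) (F n))\<^sup>2 = (ip ?h (F n))\<^sup>2" using orth by (simp add: ip_diff_left[OF CF \<psi> CF])
    also have "\<dots> \<le> ip ?h ?h * ip (F n) (F n)" by (rule ip_Cauchy_Schwarz[OF Ch CF])
    also have "\<dots> \<le> (\<nu> / 2) * ip (F n) (F n)"
      using ip_le_square[OF Ch n(1)] e(2) by (intro mult_right_mono ip_nonneg CF) auto
    finally have "ip (F n) (F n) * ip (F n) (F n) \<le> (\<nu> / 2) * ip (F n) (F n)" by (simp add: power2_eq_square)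
    then show False using n(2) \<nu> unfolding NF by (simp add: mult_le_cancel_right)
  qed
  ultimately show ?thesis using \<nu> \<psi> by (intro that[of \<nu> \<psi>])
qed

theorem rep_funs_separate:
  assumes g: "g \<in> carrier G" "g \<noteq> \<one>"
  obtains \<phi> where "rep_fun \<phi>" "\<exists>x\<in>carrier G. \<phi> (x \<otimes> g) \<noteq> \<phi> x"
proof -
  have "normal_space T" using compact hausdorff by (simp add: compact_Hausdorff_or_regular_imp_normal_space)
  moreover have "closedin T {\<one>}" "closedin T {g}"
    using g hausdorff by (auto intro!: closedin_Hausdorff_singleton)
  ultimately obtain u where u0: "continuous_map T (top_of_set {0..1::real}) u" "u ` {\<one>} \<subseteq> {0}" "u ` {g} \<subseteq> {1}"
    using Urysohn_lemma[of T "{\<one>}" "{g}" 0 1] g by (auto simp: disjnt_def)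
  then have u: "C u" "u \<one> = 0" "u g = 1" by (auto intro: continuous_map_into_fulltopology)
  define f where "f x = u (x \<otimes> g) - u x" for x
  have f: "C f" unfolding f_def by (rule continuous_map_diff[OF C_rtrans[OF u(1) g(1)] u(1)])
  have f1: "f \<one> = 1" using u g by (simp add: f_def)
  \<comment> \<open>The product of the two factors is even. At the identity, the integrand of the
    convolution with f is nonnegative, because the kernel there contains the positive part of f y as
    a factor; at y = \<one> it equals 1.\<close>
  define k where "k z = max 0 (f z) * max 0 (f (inv z))" for z
  have k: "C k"
    unfolding k_def using f C_inv[OF f] by (intro continuous_map_real_mult continuous_map_real_max) auto
  have even: "k (inv x) = k x" if "x \<in> carrier G" for x using that by (simp add: k_def)
  have "conv_op k f \<one> = haar (\<lambda>y. k (\<one> \<otimes> inv y) * f y)" by (simp add: conv_op_def)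
  also have "\<dots> > 0"
  proof (rule haar_pos)
    show "C (\<lambda>y. k (\<one> \<otimes> inv y) * f y)" by (rule continuous_map_real_mult[OF C_kernel[OF k one_closed] f])
    show "0 \<le> k (\<one> \<otimes> inv y) * f y" if "y \<in> carrier G" for y
      using that by (cases "f y \<ge> 0") (auto simp: k_def)
    show "0 < k (\<one> \<otimes> inv \<one>) * f \<one>" by (simp add: k_def f1)
  qed auto
  finally have "conv_op k (\<lambda>x. u (x \<otimes> g) - u x) \<one> \<noteq> 0" by (simp add: f_def[abs_def])
  from eigenfunction_exists[OF k even u(1) g(1) one_closed this] obtain \<nu> \<psi> where
    "\<nu> > 0" "C \<psi>" "\<And>x. x \<in> carrier G \<Longrightarrow> conv_op k (conv_op k \<psi>) x = \<nu> * \<psi> x" "\<exists>x\<in>carrier G. \<psi> (x \<otimes> g) \<noteq> \<psi> x"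
    by blast
  then show ?thesis using rep_fun_eigenfunction[OF k even] that by blast
qed

end

section \<open>Lie groups have no small subgroups\<close>

lemma finite_uniform_pos:
  fixes P :: "'i \<Rightarrow> real \<Rightarrow> bool"
  assumes "finite I" "\<And>i. i \<in> I \<Longrightarrow> \<exists>\<delta>>0. \<forall>\<epsilon>. 0 < \<epsilon> \<and> \<epsilon> \<le> \<delta> \<longrightarrow> P i \<epsilon>"
  obtains \<delta> where "\<delta> > 0" "\<And>i \<epsilon>. i \<in> I \<Longrightarrow> 0 < \<epsilon> \<Longrightarrow> \<epsilon> \<le> \<delta> \<Longrightarrow> P i \<epsilon>"
proof -
  have "\<exists>\<delta>>0. \<forall>i\<in>I. \<forall>\<epsilon>. 0 < \<epsilon> \<and> \<epsilon> \<le> \<delta> \<longrightarrow> P i \<epsilon>"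
    using assms
  proof (induction I rule: finite_induct)
    case empty
    show ?case by (intro exI[of _ 1]) auto
  next
    case (insert i I)
    have "\<exists>\<delta>>0. \<forall>i\<in>I. \<forall>\<epsilon>. 0 < \<epsilon> \<and> \<epsilon> \<le> \<delta> \<longrightarrow> P i \<epsilon>" using insert by simp
    then obtain \<delta>1 where 1: "\<delta>1 > 0" "\<forall>i\<in>I. \<forall>\<epsilon>. 0 < \<epsilon> \<and> \<epsilon> \<le> \<delta>1 \<longrightarrow> P i \<epsilon>" by blast
    have "\<exists>\<delta>>0. \<forall>\<epsilon>. 0 < \<epsilon> \<and> \<epsilon> \<le> \<delta> \<longrightarrow> P i \<epsilon>" using insert.prems by simp
    then obtain \<delta>2 where 2: "\<delta>2 > 0" "\<forall>\<epsilon>. 0 < \<epsilon> \<and> \<epsilon> \<le> \<delta>2 \<longrightarrow> P i \<epsilon>" by blast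
    show ?case using 1 2 by (intro exI[of _ "min \<delta>1 \<delta>2"]) auto
  qed
  then show ?thesis using that by blast
qed

section \<open>Coordinate boxes and first-order estimates\<close>

definition coord_box :: "nat \<Rightarrow> (nat \<Rightarrow> real) \<Rightarrow> real \<Rightarrow> (nat \<Rightarrow> real) set" where
  "coord_box n p \<delta> = {x \<in> Rd n. \<forall>i<n. \<bar>x i - p i\<bar> < \<delta>}"

lemma coord_box_mono: "\<delta> \<le> \<delta>' \<Longrightarrow> coord_box n p \<delta> \<subseteq> coord_box n p \<delta>'"
  by (auto simp: coord_box_def)

lemma openin_coord_box: "openin (top_of_set (Rd n)) (coord_box n p \<delta>)"
proof -
  have "open {x. \<bar>x i - p i\<bar> < \<delta>}" for i
    by (intro open_Collect_less continuous_intros continuous_on_product_coordinates)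
  then have "open (\<Inter>i\<in>{..<n}. {x. \<bar>x i - p i\<bar> < \<delta>})" by (intro open_INT) auto
  moreover have "coord_box n p \<delta> = Rd n \<inter> (\<Inter>i\<in>{..<n}. {x. \<bar>x i - p i\<bar> < \<delta>})" by (auto simp: coord_box_def)
  ultimately show ?thesis by (simp add: openin_open_Int)
qed

text \<open>A basic open set of the product topology may restrict any coordinate, but those from n
  on are 0 throughout \<open>Rd n\<close>. Only the first n need a common radius.\<close>

lemma coord_box_nbhd:
  assumes V: "openin (top_of_set (Rd n)) V" and p: "p \<in> V"
  obtains \<delta> where "\<delta> > 0" "coord_box n p \<delta> \<subseteq> V"
proof -
  obtain W where W: "open W" "V = Rd n \<inter> W" using V unfolding openin_open by blast
  have "openin (product_topology (\<lambda>i. euclidean) UNIV) W" using W(1) by (simp add: open_fun_def)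
  from product_topology_open_contains_basis[OF this, of p] obtain X where
    X: "p \<in> Pi\<^sub>E UNIV X" "\<And>i. open (X i)" "Pi\<^sub>E UNIV X \<subseteq> W"
    using p W(2) by auto
  have "\<exists>\<delta>>0. \<forall>\<epsilon>. 0 < \<epsilon> \<and> \<epsilon> \<le> \<delta> \<longrightarrow> ball (p i) \<epsilon> \<subseteq> X i" for i
  proof -
    have "p i \<in> X i" using X(1) by auto
    then obtain \<delta> where "\<delta> > 0" "ball (p i) \<delta> \<subseteq> X i" using X(2)[of i] open_contains_ball by blast
    then show ?thesis by (intro exI[of _ \<delta>]) (auto intro: subset_trans[OF subset_ball])
  qed
  from finite_uniform_pos[of "{..<n}" "\<lambda>i \<epsilon>. ball (p i) \<epsilon> \<subseteq> X i", OF finite_lessThan this]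
  obtain \<delta> where "\<delta> > 0" "\<And>i \<epsilon>. i \<in> {..<n} \<Longrightarrow> 0 < \<epsilon> \<Longrightarrow> \<epsilon> \<le> \<delta> \<Longrightarrow> ball (p i) \<epsilon> \<subseteq> X i" by blast
  then have \<delta>: "\<delta> > 0" "\<And>i. i < n \<Longrightarrow> ball (p i) \<delta> \<subseteq> X i" by auto
  have "x \<in> V" if x: "x \<in> coord_box n p \<delta>" for x
  proof -
    have "x i \<in> X i" for i
    proof (cases "i < n")
      case True
      then have "x i \<in> ball (p i) \<delta>" using x by (auto simp: coord_box_def dist_real_def abs_minus_commute)
      then show ?thesis using \<delta>(2)[OF True] by blast
    next
      case False
      then have "x i = p i" using x p W(2) by (auto simp: coord_box_def Rd_def)
      then show ?thesis using X(1) by auto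
    qed
    then show ?thesis using X(3) W(2) x by (auto simp: coord_box_def)
  qed
  with \<delta>(1) that show ?thesis by blast
qed

lemma mean_value_bound:
  fixes h :: "real \<Rightarrow> real"
  assumes d: "\<And>t. t \<in> closed_segment a b \<Longrightarrow> h differentiable (at t)"
    and b: "\<And>t. t \<in> closed_segment a b \<Longrightarrow> \<bar>deriv h t - c\<bar> \<le> \<epsilon>"
  shows "\<bar>h b - h a - c * (b - a)\<bar> \<le> \<epsilon> * \<bar>b - a\<bar>"
proof -
  let ?k = "\<lambda>t. h t - c * t"
  have "(?k has_field_derivative (deriv h t - c)) (at t within closed_segment a b)"
    if "t \<in> closed_segment a b" for t
  proof -
    have "(h has_field_derivative deriv h t) (at t)"
      using d[OF that] by (simp add: DERIV_deriv_iff_real_differentiable)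
    from DERIV_diff[OF this DERIV_cmult_Id[of c t UNIV]]
    have "(?k has_field_derivative (deriv h t - c)) (at t)" .
    then show ?thesis by (auto intro: has_field_derivative_at_within)
  qed
  from field_differentiable_bound[OF convex_closed_segment this, of \<epsilon> b a]
  have "norm (?k b - ?k a) \<le> \<epsilon> * norm (b - a)" using b by auto
  then show ?thesis by (simp add: algebra_simps)
qed

text \<open>Smoothness is given through partial derivatives, so the point moves from z0 to z one
  coordinate at a time, with the mean value bound on each segment; all the segments stay in the
  box.\<close>

lemma partials_bound:
  fixes f :: "(nat \<Rightarrow> real) \<Rightarrow> real"
  assumes z0: "z0 \<in> Rd n" and \<delta>: "\<delta> > 0"
    and diff: "\<And>i z. i < n \<Longrightarrow> z \<in> coord_box n z0 \<delta> \<Longrightarrow> (\<lambda>t. f (z(i := t))) differentiable (at (z i))"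
    and bd: "\<And>i z. i < n \<Longrightarrow> z \<in> coord_box n z0 \<delta> \<Longrightarrow> \<bar>deriv (\<lambda>t. f (z(i := t))) (z i) - c i\<bar> \<le> \<epsilon>"
    and z: "z \<in> coord_box n z0 \<delta>"
  shows "\<bar>f z - f z0 - (\<Sum>i<n. c i * (z i - z0 i))\<bar> \<le> \<epsilon> * (\<Sum>i<n. \<bar>z i - z0 i\<bar>)"
proof -
  define w where "w k = (\<lambda>i. if i < k then z i else z0 i)" for k :: nat
  have "\<bar>f (w k) - f z0 - (\<Sum>i<k. c i * (z i - z0 i))\<bar> \<le> \<epsilon> * (\<Sum>i<k. \<bar>z i - z0 i\<bar>)" if "k \<le> n" for k
    using that
  proof (induction k)
    case 0
    have "w 0 = z0" by (simp add: w_def)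
    then show ?case by simp
  next
    case (Suc k)
    let ?h = "\<lambda>t. f ((w k)(k := t))"
    have inbox: "(w k)(k := t) \<in> coord_box n z0 \<delta>" if "t \<in> closed_segment (z0 k) (z k)" for t
    proof -
      have "\<bar>t - z0 k\<bar> \<le> \<bar>z k - z0 k\<bar>" using that by (auto simp: closed_segment_eq_real_ivl split: if_splits)
      also have "\<dots> < \<delta>" using z Suc.prems by (auto simp: coord_box_def)
      finally show ?thesis using z z0 \<delta> Suc.prems by (auto simp: coord_box_def w_def Rd_def)
    qed
    have eq: "(\<lambda>s. f (((w k)(k := t))(k := s))) = ?h" for t by simp
    have kn: "k < n" using Suc.prems by simp
    have "?h differentiable (at t)" if "t \<in> closed_segment (z0 k) (z k)" for t
      using diff[OF kn inbox[OF that]] by (simp only: eq fun_upd_same)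
    moreover have "\<bar>deriv ?h t - c k\<bar> \<le> \<epsilon>" if "t \<in> closed_segment (z0 k) (z k)" for t
      using bd[OF kn inbox[OF that]] by (simp only: eq fun_upd_same)
    ultimately have "\<bar>?h (z k) - ?h (z0 k) - c k * (z k - z0 k)\<bar> \<le> \<epsilon> * \<bar>z k - z0 k\<bar>"
      by (rule mean_value_bound)
    moreover have "(w k)(k := z k) = w (Suc k)" "(w k)(k := z0 k) = w k" by (auto simp: w_def)
    ultimately have "\<bar>f (w (Suc k)) - f (w k) - c k * (z k - z0 k)\<bar> \<le> \<epsilon> * \<bar>z k - z0 k\<bar>" by simp
    with Suc.IH Suc.prems show ?case by (simp add: distrib_left)
  qed
  moreover have "w n = z" using z z0 by (auto simp: w_def coord_box_def Rd_def)
  ultimately show ?thesis by auto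
qed

lemma pair_coords_fst: "x \<in> Rd d \<Longrightarrow> fst_coords d (pair_coords d x y) = x"
  by (auto simp: fst_coords_def pair_coords_def Rd_def)

lemma pair_coords_snd: "y \<in> Rd d \<Longrightarrow> snd_coords d (pair_coords d x y) = y"
  by (auto simp: snd_coords_def pair_coords_def Rd_def)

lemma pair_coords_fst_snd: "z \<in> Rd (2 * d) \<Longrightarrow> pair_coords d (fst_coords d z) (snd_coords d z) = z"
  by (auto simp: fst_coords_def snd_coords_def pair_coords_def Rd_def)

lemma pair_coords_coord_box:
  assumes "z \<in> coord_box (2 * d) (pair_coords d p q) \<delta>"
  shows "fst_coords d z \<in> coord_box d p \<delta>" "snd_coords d z \<in> coord_box d q \<delta>"
proof -
  have *: "\<bar>z i - pair_coords d p q i\<bar> < \<delta>" if "i < 2 * d" for i using assms that by (simp add: coord_box_def)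
  show "fst_coords d z \<in> coord_box d p \<delta>"
  proof -
    have "\<bar>z i - p i\<bar> < \<delta>" if "i < d" for i using *[of i] that by (simp add: pair_coords_def)
    then show ?thesis by (auto simp: coord_box_def fst_coords_def Rd_def)
  qed
  have "\<bar>z (i + d) - q i\<bar> < \<delta>" if "i < d" for i
    using *[of "i + d"] that by (simp add: pair_coords_def)
  then show "snd_coords d z \<in> coord_box d q \<delta>" by (auto simp: coord_box_def snd_coords_def Rd_def)
qed

lemma sum_double_split: "(\<Sum>i<2 * d. f i) = (\<Sum>i<d. f i) + (\<Sum>i<d. f (i + d))" for f :: "nat \<Rightarrow> real"
proof -
  have "(\<Sum>i<d + d. f i) = (\<Sum>i<d. f i) + (\<Sum>i\<in>{d..<d + d}. f i)"
    by (simp add: lessThan_atLeast0 sum.atLeastLessThan_concat)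
  also have "(\<Sum>i\<in>{d..<d + d}. f i) = (\<Sum>i<d. f (i + d))"
    using sum.shift_bounds_nat_ivl[of f 0 d d] by (simp add: lessThan_atLeast0)
  finally show ?thesis by (simp add: mult_2)
qed

text \<open>In a chart with \<open>p = \<phi> \<one>\<close>, multiplication has derivative \<open>(x, y) \<mapsto> x + y\<close> at \<open>(p, p)\<close>, so squaring
  expands the distance to \<open>p\<close> by a factor close to 2, and a subgroup cannot stay near \<open>p\<close>.\<close>
theorem no_small_subgroups:
  fixes G (structure)
  assumes "lie_group G T"
  obtains U where "openin T U" "\<one> \<in> U" "\<And>K. subgroup K G \<Longrightarrow> K \<subseteq> U \<Longrightarrow> K = {\<one>}"
proof -
  note L = assms[unfolded lie_group_def]
  interpret group G by (rule L[THEN conjunct1])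
  note top = L[THEN conjunct2, THEN conjunct1]
  note mult_cont = L[THEN conjunct2, THEN conjunct2, THEN conjunct2, THEN conjunct2, THEN conjunct1]
  obtain d A where atlas: "smooth_atlas T d A"
    and smooth: "\<forall>(U1, \<phi>1)\<in>A. \<forall>(U2, \<phi>2)\<in>A. \<forall>(W, \<psi>)\<in>A.
           smooth_map_on (2 * d) d
             {pair_coords d x y | x y. x \<in> \<phi>1 ` U1 \<and> y \<in> \<phi>2 ` U2 \<and>
                 inv_into U1 \<phi>1 x \<otimes> inv_into U2 \<phi>2 y \<in> W}
             (\<lambda>z. \<psi> (inv_into U1 \<phi>1 (fst_coords d z) \<otimes> inv_into U2 \<phi>2 (snd_coords d z)))"
    using L[THEN conjunct2, THEN conjunct2, THEN conjunct2, THEN conjunct2, THEN conjunct2, THEN conjunct2]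
    by (elim exE conjE) (rule that)
  have "\<one> \<in> (\<Union>(U, \<phi>)\<in>A. U)" using atlas top by (simp add: smooth_atlas_def)
  then obtain U \<phi> where U\<phi>: "(U, \<phi>) \<in> A" "\<one> \<in> U" by blast
  have "\<forall>(U, \<phi>)\<in>A. is_chart T d U \<phi>" using atlas unfolding smooth_atlas_def by (elim conjE)
  from bspec[OF this U\<phi>(1)] have "is_chart T d U \<phi>" by simp
  then have U: "openin T U" and P: "\<phi> ` U \<subseteq> Rd d" "openin (top_of_set (Rd d)) (\<phi> ` U)"
    and hom: "homeomorphic_map (subtopology T U) (top_of_set (\<phi> ` U)) \<phi>"
    by (auto simp: is_chart_def open_Rd_def)
  have unitary_set: "U \<subseteq> carrier G" using openin_subset[OF U] top by simp
  have inj: "inj_on \<phi> U"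
    using homeomorphic_imp_injective_map[OF hom] unitary_set top by (simp add: topspace_subtopology Int_absorb1)
  define \<psi> where "\<psi> = inv_into U \<phi>"
  have \<psi>: "\<psi> (\<phi> g) = g" if "g \<in> U" for g using inj that by (simp add: \<psi>_def)
  have open_img: "openin (top_of_set (Rd d)) (\<phi> ` W)" if "openin T W" "W \<subseteq> U" for W
  proof -
    have "openin (subtopology T U) W" using that by (auto simp: openin_subtopology intro!: exI[of _ W])
    then have "openin (top_of_set (\<phi> ` U)) (\<phi> ` W)"
      using hom that by (metis homeomorphic_imp_open_map open_map_def)
    then show ?thesis using P(2) openin_trans by blast
  qed
  define p where "p = \<phi> \<one>"
  have p: "p \<in> \<phi> ` U" "p \<in> Rd d" "\<psi> p = \<one>" using U\<phi>(2) P(1) \<psi> by (auto simp: p_def)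
  define \<Omega> where "\<Omega> = {pair_coords d x y | x y. x \<in> \<phi> ` U \<and> y \<in> \<phi> ` U \<and> \<psi> x \<otimes> \<psi> y \<in> U}"
  define f where "f j z = \<phi> (\<psi> (fst_coords d z) \<otimes> \<psi> (snd_coords d z)) j" for j z
  note smooth1 = bspec[OF smooth U\<phi>(1), unfolded split_conv]
  note smooth2 = bspec[OF smooth1 U\<phi>(1), unfolded split_conv]
  note smooth3 = bspec[OF smooth2 U\<phi>(1), unfolded split_conv, folded \<psi>_def, folded \<Omega>_def]
  have sm: "smooth_fun_on (2 * d) \<Omega> (f j)" if "j < d" for j
    using smooth3 that unfolding smooth_map_on_def f_def[abs_def] by blast
  have sm1: "(\<lambda>t. f j (z(i := t))) differentiable (at (z i))" if "j < d" "i < 2 * d" "z \<in> \<Omega>" for i j z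
    using sm[OF that(1)] that unfolding smooth_fun_on_def by (metis empty_iff empty_set pds.simps(1) subsetI)
  have sm2: "continuous_on \<Omega> (\<lambda>z. deriv (\<lambda>t. f j (z(i := t))) (z i))" if "j < d" "i < 2 * d" for i j
  proof -
    have "set [i] \<subseteq> {..<2 * d}" using that by simp
    then have "continuous_on \<Omega> (pds [i] (f j))" using sm[OF that(1)] unfolding smooth_fun_on_def by blast
    then show ?thesis by simp
  qed
  have fp: "f j (pair_coords d x y) = \<phi> (\<psi> x \<otimes> \<psi> y) j" if "x \<in> Rd d" "y \<in> Rd d" for j x y
    using that by (simp add: f_def pair_coords_fst pair_coords_snd)
  \<comment> \<open>Products of elements of W stay in the chart domain U, so pairs of coordinate
    vectors of points of W lie in \<Omega>.\<close>
  obtain W where W: "openin T W" "\<one> \<in> W" "W \<subseteq> U" "\<And>a b. a \<in> W \<Longrightarrow> b \<in> W \<Longrightarrow> a \<otimes> b \<in> U"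
  proof -
    let ?Q = "{z \<in> topspace (prod_topology T T). (\<lambda>(x, y). x \<otimes> y) z \<in> U}"
    have Q: "openin (prod_topology T T) ?Q"
      by (rule openin_continuous_map_preimage[OF mult_cont U])
    have "(\<one>, \<one>) \<in> ?Q" using U\<phi>(2) top by simp
    from iffD1[OF openin_prod_topology_alt Q, rule_format, OF this]
    obtain W1 W2 where W12: "openin T W1" "openin T W2" "\<one> \<in> W1" "\<one> \<in> W2" "W1 \<times> W2 \<subseteq> ?Q"
      by (elim exE conjE) (rule that)
    show ?thesis
    proof (rule that[of "W1 \<inter> W2 \<inter> U"])
      fix a b assume "a \<in> W1 \<inter> W2 \<inter> U" "b \<in> W1 \<inter> W2 \<inter> U"
      then have "(a, b) \<in> W1 \<times> W2" by simp
      from subsetD[OF W12(5) this] show "a \<otimes> b \<in> U" by simp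
    next
      show "openin T (W1 \<inter> W2 \<inter> U)" using W12 U by (intro openin_Int)
    qed (use W12 U\<phi>(2) in auto)
  qed
  have "p \<in> \<phi> ` W" using W(2) by (simp add: p_def)
  from coord_box_nbhd[OF open_img[OF W(1,3)] this] obtain \<delta>0 where \<delta>0: "\<delta>0 > 0" "coord_box d p \<delta>0 \<subseteq> \<phi> ` W" by blast
  define z0 where "z0 = pair_coords d p p"
  have z0R: "z0 \<in> Rd (2 * d)" using p(2) by (auto simp: z0_def pair_coords_def Rd_def)
  have boxW: "\<psi> x \<in> W" "\<phi> (\<psi> x) = x" "x \<in> \<phi> ` U" if "x \<in> coord_box d p \<delta>0" for x
    using \<delta>0(2) W(3) \<psi> that by (auto simp: subset_iff)
  have coord_box\<Omega>: "coord_box (2 * d) z0 \<delta>0 \<subseteq> \<Omega>"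
  proof
    fix z assume z: "z \<in> coord_box (2 * d) z0 \<delta>0"
    have zp: "z = pair_coords d (fst_coords d z) (snd_coords d z)"
      using z by (simp add: coord_box_def pair_coords_fst_snd)
    show "z \<in> \<Omega>"
      unfolding \<Omega>_def using zp boxW[OF pair_coords_coord_box(1)[OF z[unfolded z0_def]]]
        boxW[OF pair_coords_coord_box(2)[OF z[unfolded z0_def]]] W(4) by blast
  qed
  have pbox: "p \<in> coord_box d p \<delta>" if "\<delta> > 0" for \<delta> using p(2) that by (simp add: coord_box_def)
  have z0coord_box: "z0 \<in> coord_box (2 * d) z0 \<delta>" if "\<delta> > 0" for \<delta> using z0R that by (simp add: coord_box_def)
  \<comment> \<open>The Jacobian of multiplication at (p, p), two identity blocks side by side:
    along a coordinate line through z0 one factor remains the identity, so f j is just the j-th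
    coordinate of the other.\<close>
  define c where "c j i = (if i = j \<or> i = j + d then 1 else 0 :: real)" for i j
  have deriv0: "deriv (\<lambda>t. f j (z0(i := t))) (z0 i) = c j i" if j: "j < d" and i: "i < 2 * d" for i j
  proof -
    define i' where "i' = (if i < d then i else i - d)"
    have i': "i' < d" "z0 i = p i'" using i by (auto simp: i'_def z0_def pair_coords_def)
    have upd: "p(i' := t) \<in> Rd d" for t using p(2) i'(1) by (auto simp: Rd_def)
    have fe: "f j (z0(i := t)) = (p(i' := t)) j" if t: "\<bar>t - p i'\<bar> < \<delta>0" for t
    proof -
      have b: "p(i' := t) \<in> coord_box d p \<delta>0" using upd[of t] t \<delta>0(1) by (auto simp: coord_box_def)
      have pU: "\<psi> (p(i' := t)) \<in> carrier G" using boxW(1)[OF b] W(3) unitary_set by blast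
      show ?thesis
      proof (cases "i < d")
        case True
        then have "z0(i := t) = pair_coords d (p(i' := t)) p" by (auto simp: fun_eq_iff z0_def pair_coords_def i'_def)
        then show ?thesis using fp[OF upd p(2)] boxW[OF b] p(3) pU by simp
      next
        case False
        then have "z0(i := t) = pair_coords d p (p(i' := t))" by (auto simp: fun_eq_iff z0_def pair_coords_def i'_def)
        then show ?thesis using fp[OF p(2) upd] boxW[OF b] p(3) pU by simp
      qed
    qed
    have "((\<lambda>t. (p(i' := t)) j) has_field_derivative c j i) (at (p i'))"
    proof (cases "i' = j")
      case True
      then have "c j i = 1" using j by (auto simp: c_def i'_def split: if_splits)
      then show ?thesis using True by simp
    next
      case False
      then have "c j i = 0" using i j by (auto simp: c_def i'_def split: if_splits)
      then show ?thesis using False by simp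
    qed
    then have "((\<lambda>t. f j (z0(i := t))) has_field_derivative c j i) (at (p i'))"
      using fe by (rule_tac has_field_derivative_transform_within_open[of _ _ _ "{p i' - \<delta>0 <..< p i' + \<delta>0}"])
        (use \<delta>0(1) in \<open>auto simp: abs_less_iff\<close>)
    then show ?thesis unfolding i'(2) by (rule DERIV_imp_deriv)
  qed
  \<comment> \<open>Each of the d coordinates contributes an error 2 * \<epsilon> * N, together at
    most N / 2, which leaves the factor 3/2 in \<open>expand\<close>. The summand 1 keeps \<epsilon>
    positive in dimension 0.\<close>
  define \<epsilon> where "\<epsilon> = 1 / (4 * (real d + 1))"
  have \<epsilon>: "\<epsilon> > 0" "2 * \<epsilon> * real d \<le> 1 / 2" by (auto simp: \<epsilon>_def field_simps)
  let ?P = "\<lambda>(i, j) \<delta>. \<forall>z\<in>coord_box (2 * d) z0 \<delta>. \<bar>deriv (\<lambda>t. f j (z(i := t))) (z i) - c j i\<bar> \<le> \<epsilon>"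
  have "\<exists>\<delta>>0. \<forall>\<delta>'. 0 < \<delta>' \<and> \<delta>' \<le> \<delta> \<longrightarrow> ?P ij \<delta>'" if mem: "ij \<in> {..<2 * d} \<times> {..<d}" for ij
  proof -
    obtain i j where ij: "ij = (i, j)" "i < 2 * d" "j < d" using mem by auto
    let ?h = "\<lambda>z. \<bar>deriv (\<lambda>t. f j (z(i := t))) (z i) - c j i\<bar>"
    let ?B = "coord_box (2 * d) z0 \<delta>0"
    have "continuous_on ?B ?h"
      using continuous_on_subset[OF sm2[OF ij(3,2)] coord_box\<Omega>] by (intro continuous_intros)
    then have "openin (top_of_set ?B) (?B \<inter> ?h -` {..<\<epsilon>})" by (rule continuous_openin_preimage_gen) auto
    then have o: "openin (top_of_set (Rd (2 * d))) (?B \<inter> ?h -` {..<\<epsilon>})"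
      using openin_coord_box openin_trans by blast
    have "z0 \<in> ?B \<inter> ?h -` {..<\<epsilon>}" using z0coord_box[OF \<delta>0(1)] deriv0[OF ij(3,2)] \<epsilon>(1) by simp
    from coord_box_nbhd[OF o this] obtain \<delta> where \<delta>: "\<delta> > 0" "coord_box (2 * d) z0 \<delta> \<subseteq> ?B \<inter> ?h -` {..<\<epsilon>}" by blast
    have "?h z \<le> \<epsilon>" if "\<delta>' \<le> \<delta>" "z \<in> coord_box (2 * d) z0 \<delta>'" for \<delta>' z
      using subsetD[OF \<delta>(2) subsetD[OF coord_box_mono[OF that(1)] that(2)]] by simp
    with \<delta>(1) show ?thesis unfolding ij by (intro exI[of _ \<delta>]) auto
  qed
  from finite_uniform_pos[of "{..<2 * d} \<times> {..<d}" ?P, OF finite_cartesian_product[OF finite_lessThan finite_lessThan] this] obtain \<delta>1 where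
    \<delta>1: "\<delta>1 > 0" "\<And>ij \<delta>. ij \<in> {..<2 * d} \<times> {..<d} \<Longrightarrow> 0 < \<delta> \<Longrightarrow> \<delta> \<le> \<delta>1 \<Longrightarrow> ?P ij \<delta>" by blast
  define \<delta> where "\<delta> = min \<delta>0 \<delta>1"
  have \<delta>: "\<delta> > 0" "\<delta> \<le> \<delta>0" "\<delta> \<le> \<delta>1" using \<delta>0(1) \<delta>1(1) by (auto simp: \<delta>_def)
  have bd: "\<bar>deriv (\<lambda>t. f j (z(i := t))) (z i) - c j i\<bar> \<le> \<epsilon>" if "i < 2 * d" "j < d" "z \<in> coord_box (2 * d) z0 \<delta>" for i j z
    using \<delta>1(2)[of "(i, j)" \<delta>] \<delta> that by auto
  define N where "N x = (\<Sum>i<d. \<bar>x i - p i\<bar>)" for x :: "nat \<Rightarrow> real"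
  have N0: "N x \<ge> 0" for x unfolding N_def by (intro sum_nonneg) auto
  have expand: "3 / 2 * N (\<phi> g) \<le> N (\<phi> (g \<otimes> g))" if g: "g \<in> U" "\<phi> g \<in> coord_box d p \<delta>" for g
  proof -
    let ?x = "\<phi> g"
    have xR: "?x \<in> Rd d" using g(1) P(1) by blast
    let ?z = "pair_coords d ?x ?x"
    have zbox: "?z \<in> coord_box (2 * d) z0 \<delta>"
      using g(2) by (auto simp: coord_box_def z0_def pair_coords_def Rd_def)
    have fz: "f j ?z = \<phi> (g \<otimes> g) j" for j using fp[OF xR xR] \<psi>[OF g(1)] by simp
    have fz0: "f j z0 = p j" for j using fp[OF p(2) p(2)] p(3) by (simp add: z0_def p_def)
    have sq: "\<bar>\<phi> (g \<otimes> g) j - p j - 2 * (?x j - p j)\<bar> \<le> \<epsilon> * (2 * N ?x)" if j: "j < d" for j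
    proof -
      have "\<bar>f j ?z - f j z0 - (\<Sum>i<2 * d. c j i * (?z i - z0 i))\<bar> \<le> \<epsilon> * (\<Sum>i<2 * d. \<bar>?z i - z0 i\<bar>)"
        using sm1[OF j] bd[OF _ j] coord_box\<Omega> coord_box_mono[OF \<delta>(2), of "2 * d" z0]
        by (intro partials_bound[OF z0R \<delta>(1) _ _ zbox]) blast+
      also have "(\<Sum>i<2 * d. \<bar>?z i - z0 i\<bar>) = 2 * N ?x"
        unfolding sum_double_split by (simp add: z0_def pair_coords_def N_def)
      also have "(\<Sum>i<2 * d. c j i * (?z i - z0 i)) = 2 * (?x j - p j)"
      proof -
        have "(\<Sum>i<d. c j i * (?z i - z0 i)) = (\<Sum>i<d. if i = j then ?x i - p i else 0)"
          by (intro sum.cong) (auto simp: c_def z0_def pair_coords_def)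
        moreover have "(\<Sum>i<d. c j (i + d) * (?z (i + d) - z0 (i + d))) = (\<Sum>i<d. if i = j then ?x i - p i else 0)"
          using j by (intro sum.cong) (auto simp: c_def z0_def pair_coords_def)
        ultimately show ?thesis unfolding sum_double_split using j by simp
      qed
      finally show ?thesis by (simp add: fz fz0)
    qed
    have "2 * \<bar>?x j - p j\<bar> - \<epsilon> * (2 * N ?x) \<le> \<bar>\<phi> (g \<otimes> g) j - p j\<bar>" if "j < d" for j
      using sq[OF that] by linarith
    then have "(\<Sum>j<d. 2 * \<bar>?x j - p j\<bar> - \<epsilon> * (2 * N ?x)) \<le> N (\<phi> (g \<otimes> g))"
      unfolding N_def[of "\<phi> (g \<otimes> g)"] by (intro sum_mono) auto
    then have "2 * N ?x - real d * (\<epsilon> * (2 * N ?x)) \<le> N (\<phi> (g \<otimes> g))"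
      by (simp add: sum_subtractf sum_distrib_left[symmetric] N_def[symmetric])
    moreover have "(2 * \<epsilon> * real d) * N ?x \<le> 1 / 2 * N ?x" using \<epsilon>(2) N0 by (rule mult_right_mono)
    ultimately show ?thesis by (simp add: algebra_simps)
  qed
  define U' where "U' = {g \<in> U. \<phi> g \<in> coord_box d p \<delta>}"
  have "openin (top_of_set (\<phi> ` U)) (\<phi> ` U \<inter> coord_box d p \<delta>)"
  proof -
    obtain O' where O': "open O'" "coord_box d p \<delta> = Rd d \<inter> O'" using openin_coord_box[of d p \<delta>] unfolding openin_open by blast
    have "\<phi> ` U \<inter> coord_box d p \<delta> = \<phi> ` U \<inter> O'" using P(1) O'(2) by auto
    then show ?thesis using O'(1) by (simp add: openin_open_Int)
  qed
  have "openin (subtopology T U) {g \<in> topspace (subtopology T U). \<phi> g \<in> \<phi> ` U \<inter> coord_box d p \<delta>}"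
    by (rule openin_continuous_map_preimage[OF homeomorphic_imp_continuous_map[OF hom]]) fact
  also have "{g \<in> topspace (subtopology T U). \<phi> g \<in> \<phi> ` U \<inter> coord_box d p \<delta>} = U'"
    using unitary_set top by (auto simp: U'_def)
  finally have U'open: "openin T U'" using U openin_trans_full by blast
  have "K = {\<one>}" if K: "subgroup K G" "K \<subseteq> U'" for K
  proof -
    \<comment> \<open>The induction passes from g to its square, which stays in K. After k squarings
      the distance has grown by (3/2)^k but is still confined to the box, so it must have been
      0.\<close>
    have bound: "(3 / 2) ^ k * N (\<phi> g) \<le> real d * \<delta>" if "g \<in> K" for k g
      using that
    proof (induction k arbitrary: g)
      case 0
      then have "\<phi> g \<in> coord_box d p \<delta>" using K(2) by (auto simp: U'_def)
      then have "N (\<phi> g) \<le> (\<Sum>i<d. \<delta>)" unfolding N_def by (intro sum_mono) (auto simp: coord_box_def less_imp_le)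
      then show ?case by simp
    next
      case (Suc k)
      have "(3 / 2) ^ Suc k * N (\<phi> g) = (3 / 2) ^ k * (3 / 2 * N (\<phi> g))" by simp
      also have "\<dots> \<le> (3 / 2) ^ k * N (\<phi> (g \<otimes> g))"
        using expand[of g] Suc.prems K(2) by (intro mult_left_mono) (auto simp: U'_def)
      also have "\<dots> \<le> real d * \<delta>" using Suc.prems K(1) by (intro Suc.IH) (simp add: subgroup.m_closed)
      finally show ?case .
    qed
    have "g = \<one>" if g: "g \<in> K" for g
    proof -
      have "N (\<phi> g) = 0"
      proof (rule ccontr)
        assume "N (\<phi> g) \<noteq> 0"
        then have pos: "N (\<phi> g) > 0" using N0[of "\<phi> g"] by simp
        obtain k where "real d * \<delta> / N (\<phi> g) < (3 / 2) ^ k" using real_arch_pow[of "3/2"] by auto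
        then show False using bound[OF g, of k] pos by (simp add: field_simps)
      qed
      then have "\<phi> g i = p i" if "i < d" for i
        using that by (simp add: N_def sum_nonneg_eq_0_iff)
      moreover have gU: "g \<in> U" using g K(2) by (auto simp: U'_def)
      moreover have "\<phi> g i = p i" if "\<not> i < d" for i
        using that P(1) p(2) gU by (auto simp: Rd_def subset_iff)
      ultimately have "\<phi> g = \<phi> \<one>" unfolding p_def by blast
      then show ?thesis using inj gU U\<phi>(2) by (simp add: inj_on_def)
    qed
    then show ?thesis using subgroup.one_closed[OF K(1)] by blast
  qed
  moreover have "\<one> \<in> U'" using U\<phi>(2) pbox[OF \<delta>(1)] by (simp add: U'_def p_def)
  ultimately show ?thesis using that U'open by blast
qed

section \<open>Hilbert's basis theorem for rings of functions\<close>

text \<open>Subrings are subsets of one ambient ring, so that generators can be adjoined one after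
  another without a change of type.\<close>

definition subring_set :: "'r::comm_ring_1 set \<Rightarrow> bool" where
  "subring_set R \<longleftrightarrow> 1 \<in> R \<and> (\<forall>x\<in>R. \<forall>y\<in>R. x + y \<in> R \<and> x * y \<in> R) \<and> (\<forall>x\<in>R. - x \<in> R)"

lemma subring_set_zero: "subring_set R \<Longrightarrow> 0 \<in> R"
  unfolding subring_set_def by (metis add.right_inverse)

inductive_set idl :: "'r::comm_ring_1 set \<Rightarrow> 'r set \<Rightarrow> 'r set" for R B where
  zero: "0 \<in> idl R B"
| step: "x \<in> idl R B \<Longrightarrow> r \<in> R \<Longrightarrow> b \<in> B \<Longrightarrow> x + r * b \<in> idl R B"

text \<open>The finite set is taken from Q itself, where Q need not be an ideal. The polynomials
  extracted at the end are therefore invariants again, not just members of an ideal.\<close>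

definition noetherian :: "'r::comm_ring_1 set \<Rightarrow> bool" where
  "noetherian R \<longleftrightarrow> (\<forall>Q\<subseteq>R. \<exists>B. finite B \<and> B \<subseteq> Q \<and> Q \<subseteq> idl R B)"

lemma noetherianD: "noetherian R \<Longrightarrow> Q \<subseteq> R \<Longrightarrow> \<exists>B. finite B \<and> B \<subseteq> Q \<and> Q \<subseteq> idl R B"
  unfolding noetherian_def by simp

lemma idl_add:
  assumes x: "x \<in> idl R B" and y: "y \<in> idl R B"
  shows "x + y \<in> idl R B"
  using y
proof (induction rule: idl.induct)
  case (step y r b)
  from idl.step[OF step.IH step.hyps(2,3)] show ?case by (simp add: add.assoc)
qed (simp add: x)

lemma idl_mult:
  assumes R: "subring_set R" and s: "s \<in> R" and x: "x \<in> idl R B"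
  shows "s * x \<in> idl R B"
  using x
proof (induction rule: idl.induct)
  case zero
  then show ?case by (simp add: idl.zero)
next
  case (step x r b)
  have "s * x + (s * r) * b \<in> idl R B"
    using step R s by (intro idl.step) (auto simp: subring_set_def)
  then show ?case by (simp add: algebra_simps)
qed

lemma idl_base: "subring_set R \<Longrightarrow> b \<in> B \<Longrightarrow> b \<in> idl R B"
  using idl.step[OF idl.zero, of 1 R b B] by (simp add: subring_set_def)

lemma idl_subset:
  assumes R: "subring_set R" and A: "A \<subseteq> idl R B"
  shows "idl R A \<subseteq> idl R B"
proof
  fix x assume "x \<in> idl R A"
  then show "x \<in> idl R B"
  proof (induction rule: idl.induct)
    case (step x r b)
    then show ?case using idl_add idl_mult[OF R] A by blast
  qed (rule idl.zero)
qed

lemma idl_mono: "subring_set R \<Longrightarrow> A \<subseteq> B \<Longrightarrow> idl R A \<subseteq> idl R B"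
  by (intro idl_subset) (auto intro: idl_base)

lemma idl_in_ring:
  assumes R: "subring_set R" and B: "B \<subseteq> R" and x: "x \<in> idl R B"
  shows "x \<in> R"
  using x by (induction rule: idl.induct) (use R B in \<open>auto simp: subring_set_def subring_set_zero[OF R]\<close>)

lemma idl_finite_witness:
  assumes R: "subring_set R" and x: "x \<in> idl R Q"
  shows "\<exists>B. finite B \<and> B \<subseteq> Q \<and> x \<in> idl R B"
  using x
proof (induction rule: idl.induct)
  case zero
  show ?case by (intro exI[of _ "{}"]) (simp add: idl.zero)
next
  case (step x r b)
  then obtain B where B: "finite B" "B \<subseteq> Q" "x \<in> idl R B" by blast
  have "x + r * b \<in> idl R (insert b B)"
    using idl_mono[OF R, of B "insert b B"] B(3) step.hyps by (intro idl.step) auto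
  then show ?case using B step.hyps by (intro exI[of _ "insert b B"]) auto
qed

text \<open>The values at f of polynomials over R of degree below n. The strict bound gives the zero
  polynomial the index 0 and makes a the leading coefficient of \<open>y + a * f ^ n\<close> for y
  in \<open>poly_below R f n\<close>.\<close>

primrec poly_below :: "'r::comm_ring_1 set \<Rightarrow> 'r \<Rightarrow> nat \<Rightarrow> 'r set" where
  "poly_below R f 0 = {0}"
| "poly_below R f (Suc n) = {y + a * f ^ n | y a. y \<in> poly_below R f n \<and> a \<in> R}"

definition adjoin :: "'r::comm_ring_1 set \<Rightarrow> 'r \<Rightarrow> 'r set" where
  "adjoin R f = (\<Union>n. poly_below R f n)"

context
  fixes R :: "'r::comm_ring_1 set" and f :: 'r
  assumes R: "subring_set R"
begin

lemma poly_below_SucI: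
  "y \<in> poly_below R f n \<Longrightarrow> a \<in> R \<Longrightarrow> x = y + a * f ^ n \<Longrightarrow> x \<in> poly_below R f (Suc n)"
  by auto

lemma poly_below_SucE:
  assumes "x \<in> poly_below R f (Suc n)"
  obtains y a where "x = y + a * f ^ n" "y \<in> poly_below R f n" "a \<in> R"
  using assms by auto

declare poly_below.simps(2) [simp del]

lemma poly_below_mono: "n \<le> m \<Longrightarrow> poly_below R f n \<subseteq> poly_below R f m"
proof (induction m rule: dec_induct)
  case (step m)
  have "x \<in> poly_below R f (Suc m)" if "x \<in> poly_below R f m" for x
    by (rule poly_below_SucI[OF that subring_set_zero[OF R]]) simp
  with step show ?case by blast
qed simp

lemma poly_below_add: "x \<in> poly_below R f n \<Longrightarrow> y \<in> poly_below R f n \<Longrightarrow> x + y \<in> poly_below R f n"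
proof (induction n arbitrary: x y)
  case (Suc n)
  obtain x' a where x: "x = x' + a * f ^ n" "x' \<in> poly_below R f n" "a \<in> R"
    using Suc.prems(1) by (rule poly_below_SucE)
  obtain y' b where y: "y = y' + b * f ^ n" "y' \<in> poly_below R f n" "b \<in> R"
    using Suc.prems(2) by (rule poly_below_SucE)
  have "a + b \<in> R" using x y R by (auto simp: subring_set_def)
  with Suc.IH[OF x(2) y(2)] show ?case by (rule poly_below_SucI) (simp add: x y algebra_simps)
qed simp

lemma poly_below_cmult: "c \<in> R \<Longrightarrow> x \<in> poly_below R f n \<Longrightarrow> c * x \<in> poly_below R f n"
proof (induction n arbitrary: x)
  case (Suc n)
  obtain x' a where x: "x = x' + a * f ^ n" "x' \<in> poly_below R f n" "a \<in> R"
    using Suc.prems(2) by (rule poly_below_SucE)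
  have "c * a \<in> R" using x Suc.prems R by (auto simp: subring_set_def)
  with Suc.IH[OF Suc.prems(1) x(2)] show ?case by (rule poly_below_SucI) (simp add: x algebra_simps)
qed simp

lemma poly_below_shift: "x \<in> poly_below R f n \<Longrightarrow> f * x \<in> poly_below R f (Suc n)"
proof (induction n arbitrary: x)
  case 0
  then show ?case using poly_below_mono[of 0 "Suc 0"] by auto
next
  case (Suc n)
  obtain x' a where x: "x = x' + a * f ^ n" "x' \<in> poly_below R f n" "a \<in> R"
    using Suc.prems by (rule poly_below_SucE)
  from Suc.IH[OF x(2)] x(3) show ?case by (rule poly_below_SucI) (simp add: x algebra_simps)
qed

lemma poly_below_shift_power: "x \<in> poly_below R f n \<Longrightarrow> f ^ k * x \<in> poly_below R f (n + k)"
  by (induction k) (use poly_below_shift in \<open>auto simp: mult.assoc\<close>)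

lemma poly_below_monom: "a \<in> R \<Longrightarrow> a * f ^ n \<in> poly_below R f (Suc n)"
  using poly_below_mono[of 0 n] by (intro poly_below_SucI[of 0]) auto

lemma subset_adjoin: "R \<subseteq> adjoin R f"
  unfolding adjoin_def using poly_below_monom[of _ 0] by (auto)

lemma adjoin_gen: "f \<in> adjoin R f"
  unfolding adjoin_def using poly_below_monom[of 1 1] R by (auto simp: subring_set_def)

lemma poly_below_subset_adjoin: "poly_below R f n \<subseteq> adjoin R f"
  by (auto simp: adjoin_def)

lemma subring_set_adjoin: "subring_set (adjoin R f)"
proof -
  have add: "x + y \<in> adjoin R f" if xy: "x \<in> adjoin R f" "y \<in> adjoin R f" for x y
  proof -
    obtain n m where "x \<in> poly_below R f n" "y \<in> poly_below R f m" using xy by (auto simp: adjoin_def)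
    then have "x \<in> poly_below R f (max n m)" "y \<in> poly_below R f (max n m)"
      using poly_below_mono[of n "max n m"] poly_below_mono[of m "max n m"] by auto
    from poly_below_add[OF this] show ?thesis by (auto simp: adjoin_def)
  qed
  have cm: "c * x \<in> adjoin R f" if "c \<in> R" "x \<in> adjoin R f" for c x
    using that poly_below_cmult by (auto simp: adjoin_def)
  have sh: "f ^ k * x \<in> adjoin R f" if "x \<in> adjoin R f" for k x
    using that poly_below_shift_power by (auto simp: adjoin_def)
  have mm: "x * y \<in> adjoin R f" if x: "x \<in> poly_below R f n" and y: "y \<in> adjoin R f" for x y n
    using x
  proof (induction n arbitrary: x)
    case 0
    then show ?case using subset_adjoin subring_set_zero[OF R] by auto
  next
    case (Suc n)
    from Suc.prems obtain x' a where "x = x' + a * f ^ n" "x' \<in> poly_below R f n" "a \<in> R"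
      by (rule poly_below_SucE)
    then show ?case using add[OF Suc.IH cm[OF _ sh[OF y]], of x' a n] by (simp add: algebra_simps)
  qed
  have mult: "x * y \<in> adjoin R f" if xy: "x \<in> adjoin R f" "y \<in> adjoin R f" for x y
  proof -
    obtain n where "x \<in> poly_below R f n" using xy(1) by (auto simp: adjoin_def)
    from mm[OF this xy(2)] show ?thesis .
  qed
  have m1: "- 1 \<in> R" "1 \<in> R" using R by (auto simp: subring_set_def)
  have "- x \<in> adjoin R f" if "x \<in> adjoin R f" for x using cm[OF m1(1) that] by simp
  then show ?thesis unfolding subring_set_def using add mult subset_adjoin m1 by blast
qed

text \<open>The ideal \<open>L n\<close> of leading coefficients in degree \<open>n\<close> is defined
  without reference to a unique representation, so \<open>f\<close> need not be transcendental over \<open>R\<close>.\<close>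
theorem noetherian_adjoin:
  assumes noeth: "noetherian R"
  shows "noetherian (adjoin R f)"
  unfolding noetherian_def
proof (intro allI impI)
  fix Q assume Q: "Q \<subseteq> adjoin R f"
  let ?S = "adjoin R f"
  note S = subring_set_adjoin
  let ?I = "idl ?S Q"
  define L where "L n = {a \<in> R. \<exists>y\<in>poly_below R f n. y + a * f ^ n \<in> ?I}" for n
  have LR: "L n \<subseteq> R" for n by (auto simp: L_def)
  have f_I: "f ^ k * x \<in> ?I" if "x \<in> ?I" for x k
  proof -
    have "f ^ k \<in> ?S"
      using poly_below_monom[of 1 k] poly_below_subset_adjoin R by (auto simp: subring_set_def)
    from idl_mult[OF S this that] show ?thesis .
  qed
  have L_mono: "L n \<subseteq> L m" if "n \<le> m" for n m
  proof
    fix a assume "a \<in> L n"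
    then obtain y where y: "a \<in> R" "y \<in> poly_below R f n" "y + a * f ^ n \<in> ?I" by (auto simp: L_def)
    have "f ^ (m - n) * y \<in> poly_below R f m" using poly_below_shift_power[OF y(2), of "m - n"] that by simp
    moreover have "f ^ (m - n) * y + a * f ^ m \<in> ?I"
      using f_I[OF y(3), of "m - n"] that by (simp add: algebra_simps flip: power_add)
    ultimately show "a \<in> L m" using y(1) by (auto simp: L_def)
  qed
  have L_idl: "idl R A \<subseteq> L n" if A: "A \<subseteq> L n" for A n
  proof
    fix a assume "a \<in> idl R A"
    then show "a \<in> L n"
    proof (induction rule: idl.induct)
      case zero
      then show ?case
        using subring_set_zero[OF R] poly_below_mono[of 0 n] idl.zero by (auto simp: L_def intro!: bexI[of _ 0])
    next
      case (step x r b)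
      obtain y where y: "x \<in> R" "y \<in> poly_below R f n" "y + x * f ^ n \<in> ?I" using step.IH by (auto simp: L_def)
      have "b \<in> L n" using step.hyps A by blast
      then obtain z where z: "b \<in> R" "z \<in> poly_below R f n" "z + b * f ^ n \<in> ?I" by (auto simp: L_def)
      have "(y + x * f ^ n) + r * (z + b * f ^ n) \<in> ?I"
        using step.hyps(2) subset_adjoin by (intro idl_add[OF y(3) idl_mult[OF S _ z(3)]]) auto
      then have "(y + r * z) + (x + r * b) * f ^ n \<in> ?I" by (simp add: algebra_simps)
      moreover have "y + r * z \<in> poly_below R f n" using y z step.hyps by (intro poly_below_add poly_below_cmult)
      moreover have "x + r * b \<in> R" using R y z step.hyps by (auto simp: subring_set_def)
      ultimately show ?case by (auto simp: L_def)
    qed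
  qed
  have "(\<Union>n. L n) \<subseteq> R" using LR by blast
  from noetherianD[OF noeth this] obtain A where
    A: "finite A" "A \<subseteq> (\<Union>n. L n)" "(\<Union>n. L n) \<subseteq> idl R A"
    by (elim exE conjE) (rule that)
  \<comment> \<open>The sets L n increase and finitely many elements generate their union, so the
    chain is constant from some N on.\<close>
  have "\<exists>N. A \<subseteq> L N"
    using A(1,2)
  proof (induction A rule: finite_induct)
    case (insert a A)
    then obtain N n where Nn: "A \<subseteq> L N" "a \<in> L n" by auto
    have "A \<subseteq> L (max N n)" "a \<in> L (max N n)"
      using subset_trans[OF Nn(1) L_mono[OF max.cobounded1]] subsetD[OF L_mono[OF max.cobounded2] Nn(2)] by blast+
    then have "insert a A \<subseteq> L (max N n)" by simp
    then show ?case by blast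
  qed simp
  then obtain N where "A \<subseteq> L N" by blast
  then have LN: "L n \<subseteq> L N" for n using L_idl[of A N] A(3) by blast
  have "\<exists>A. finite A \<and> A \<subseteq> L n \<and> L n \<subseteq> idl R A" for n
    by (rule noetherianD[OF noeth LR])
  then obtain A' where A': "\<And>n. finite (A' n)" "\<And>n. A' n \<subseteq> L n" "\<And>n. L n \<subseteq> idl R (A' n)" by metis
  define y where "y n a = (SOME y. y \<in> poly_below R f n \<and> y + a * f ^ n \<in> ?I)" for n a
  have "y n a \<in> poly_below R f n \<and> y n a + a * f ^ n \<in> ?I" if "a \<in> L n" for n a
    unfolding y_def by (rule someI_ex) (use that in \<open>auto simp: L_def\<close>)
  then have y: "\<And>n a. a \<in> L n \<Longrightarrow> y n a \<in> poly_below R f n"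
      "\<And>n a. a \<in> L n \<Longrightarrow> y n a + a * f ^ n \<in> ?I" by auto
  \<comment> \<open>For every degree up to N and every generator of the leading coefficients in that
    degree, one member of the ideal that realises it.\<close>
  define B where "B = (\<Union>n\<in>{..N}. (\<lambda>a. y n a + a * f ^ n) ` A' n)"
  have finB: "finite B" using A'(1) by (auto simp: B_def)
  have BI: "B \<subseteq> ?I" using y(2) A'(2) by (auto simp: B_def)
  have lead: "\<exists>w\<in>idl ?S B. \<exists>z\<in>poly_below R f n. w = z + a * f ^ n" if "n \<le> N" "a \<in> idl R (A' n)" for n a
    using that(2)
  proof (induction rule: idl.induct)
    case zero
    then show ?case using poly_below_mono[of 0 n] idl.zero by (auto intro!: bexI[of _ 0])
  next
    case (step x r b)
    then obtain w z where wz: "w \<in> idl ?S B" "z \<in> poly_below R f n" "w = z + x * f ^ n" by blast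
    have bL: "b \<in> L n" using step.hyps A'(2) by blast
    have "y n b + b * f ^ n \<in> B" using that(1) step.hyps by (auto simp: B_def)
    then have "w + r * (y n b + b * f ^ n) \<in> idl ?S B"
      using wz(1) step.hyps subset_adjoin by (intro idl.step) auto
    moreover have "z + r * y n b \<in> poly_below R f n"
      using wz(2) y(1)[OF bL] step.hyps by (intro poly_below_add poly_below_cmult)
    moreover have "w + r * (y n b + b * f ^ n) = (z + r * y n b) + (x + r * b) * f ^ n"
      using wz(3) by (simp add: algebra_simps)
    ultimately show ?case by blast
  qed
  have neg: "- x \<in> ?I" if "x \<in> ?I" for x
  proof -
    have "- 1 \<in> ?S" using S unfolding subring_set_def by blast
    from idl_mult[OF S this that] show ?thesis by simp
  qed
  have below: "x \<in> idl ?S B" if "x \<in> ?I" "x \<in> poly_below R f n" for x n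
    using that
  proof (induction n arbitrary: x)
    case 0
    then show ?case by (simp add: idl.zero)
  next
    case (Suc n)
    from Suc.prems(2) obtain x' a where x': "x = x' + a * f ^ n" "x' \<in> poly_below R f n" "a \<in> R"
      by (rule poly_below_SucE)
    have aL: "a \<in> L n" using Suc.prems(1) x' by (auto simp: L_def)
    \<comment> \<open>Leading coefficients in degree above N already occur in degree N, so there a
      member of degree N is shifted by \<open>f ^ (n - N)\<close>; in low degrees nothing is
      shifted. Subtracting it cancels the leading term of x.\<close>
    define k where "k = min n N"
    have "a \<in> L k" using aL LN[of n] by (auto simp: k_def min_def)
    then have "a \<in> idl R (A' k)" using A'(3) by blast
    then obtain w z where wz: "w \<in> idl ?S B" "z \<in> poly_below R f k" "w = z + a * f ^ k"
      using lead[of k a] by (auto simp: k_def)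
    let ?w = "f ^ (n - k) * w"
    have kn: "k \<le> n" by (simp add: k_def)
    have "f ^ (n - k) \<in> ?S"
      using poly_below_monom[of 1 "n - k"] poly_below_subset_adjoin R by (auto simp: subring_set_def)
    from idl_mult[OF S this wz(1)] have w1: "?w \<in> idl ?S B" .
    have "f ^ (n - k) * z \<in> poly_below R f n" (is "?z \<in> _") using poly_below_shift_power[OF wz(2), of "n - k"] kn by simp
    moreover have "- 1 \<in> R" using R by (auto simp: subring_set_def)
    ultimately have "x' + - 1 * ?z \<in> poly_below R f n"
      by (intro poly_below_add[OF x'(2)] poly_below_cmult[of "- 1" ?z])
    moreover have weq: "?w = f ^ (n - k) * z + a * f ^ n"
      using wz(3) kn by (simp add: algebra_simps flip: power_add)
    ultimately have 1: "x + - ?w \<in> poly_below R f n" using x'(1) by simp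
    have "?w \<in> ?I" using w1 idl_subset[OF S BI] by blast
    then have "x + - ?w \<in> ?I" using Suc.prems(1) by (intro idl_add neg)
    from Suc.IH[OF this 1] have "(x + - ?w) + ?w \<in> idl ?S B" using w1 by (rule idl_add)
    then show ?case by simp
  qed
  have I: "?I \<subseteq> idl ?S B"
  proof
    fix x assume x: "x \<in> ?I"
    then obtain n where "x \<in> poly_below R f n" using idl_in_ring[OF S Q] by (auto simp: adjoin_def)
    from below[OF x this] show "x \<in> idl ?S B" .
  qed
  \<comment> \<open>B lies in the ideal of Q but need not lie in Q. Each b is a combination of
    finitely many members of Q, and these become the generators.\<close>
  have "\<forall>b\<in>B. \<exists>C. finite C \<and> C \<subseteq> Q \<and> b \<in> idl ?S C" using idl_finite_witness[OF S] BI by blast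
  then obtain C where C: "\<And>b. b \<in> B \<Longrightarrow> finite (C b) \<and> C b \<subseteq> Q \<and> b \<in> idl ?S (C b)" by metis
  let ?C = "\<Union>b\<in>B. C b"
  have "B \<subseteq> idl ?S ?C"
  proof
    fix b assume b: "b \<in> B"
    then have "idl ?S (C b) \<subseteq> idl ?S ?C" by (intro idl_mono[OF S]) auto
    moreover have "b \<in> idl ?S (C b)" using C[OF b] by simp
    ultimately show "b \<in> idl ?S ?C" by (rule subsetD)
  qed
  then have "?I \<subseteq> idl ?S ?C" by (rule subset_trans[OF I idl_subset[OF S]])
  moreover have "Q \<subseteq> ?I" using idl_base[OF S] by blast
  ultimately have "Q \<subseteq> idl ?S ?C" by (rule subset_trans[rotated])
  moreover have "finite ?C" using finB C by simp
  moreover have "?C \<subseteq> Q" using C by (intro UN_least) simp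
  ultimately show "\<exists>B. finite B \<and> B \<subseteq> Q \<and> Q \<subseteq> idl ?S B" by (intro exI[of _ ?C] conjI)
qed

end

text \<open>The constants form a field, where any nonzero member of Q generates; the functions of
  the list are then adjoined one at a time.\<close>

lemma noetherian_function_ring:
  fixes fs :: "('x \<Rightarrow> real) list"
  shows "\<exists>R. noetherian R \<and> subring_set R \<and> range (\<lambda>c _. c) \<subseteq> R \<and> set fs \<subseteq> R"
proof (induction fs)
  case Nil
  let ?R = "range (\<lambda>c (_::'x). c::real)"
  have sub: "subring_set ?R"
    unfolding subring_set_def by (auto simp: fun_eq_iff image_iff)
  have "noetherian ?R"
    unfolding noetherian_def
  proof (intro allI impI)
    fix Q assume Q: "Q \<subseteq> ?R"
    show "\<exists>B. finite B \<and> B \<subseteq> Q \<and> Q \<subseteq> idl ?R B"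
    proof (cases "Q \<subseteq> {0}")
      case True
      then show ?thesis by (intro exI[of _ "{}"]) (auto intro: idl.zero)
    next
      case False
      then obtain q where q: "q \<in> Q" "q \<noteq> 0" by blast
      then obtain c where c: "q = (\<lambda>_. c)" using Q by auto
      then have "c \<noteq> 0" using q by (auto simp: fun_eq_iff)
      have "x \<in> idl ?R {q}" if x: "x \<in> Q" for x
      proof -
        obtain d where d: "x = (\<lambda>_. d)" using x Q by auto
        have "0 + (\<lambda>_. d / c) * q \<in> idl ?R {q}" by (intro idl.step idl.zero) auto
        moreover have "0 + (\<lambda>_. d / c) * q = x" using c d \<open>c \<noteq> 0\<close> by (auto simp: fun_eq_iff)
        ultimately show ?thesis by simp
      qed
      then show ?thesis using q by (intro exI[of _ "{q}"]) auto
    qed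
  qed
  with sub show ?case by (intro exI[of _ ?R]) auto
next
  case (Cons f fs)
  then obtain R where R: "noetherian R" "subring_set R" "range (\<lambda>c _. c) \<subseteq> R" "set fs \<subseteq> R" by blast
  show ?case
    using noetherian_adjoin[OF R(2,1), of f] subring_set_adjoin[OF R(2), of f] subset_adjoin[OF R(2), of f]
      adjoin_gen[OF R(2), of f] R(3,4)
    by (intro exI[of _ "adjoin R f"]) auto
qed

lemma noetherian_zero_set:
  fixes R :: "('x \<Rightarrow> real) set"
  assumes "noetherian R" "Q \<subseteq> R"
  obtains B where "finite B" "B \<subseteq> Q" "\<And>x q. \<forall>b\<in>B. b x = 0 \<Longrightarrow> q \<in> Q \<Longrightarrow> q x = 0"
proof -
  obtain B where B: "finite B" "B \<subseteq> Q" "Q \<subseteq> idl R B" using noetherianD[OF assms] by blast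
  have *: "q x = 0" if z: "\<forall>b\<in>B. b x = 0" and q: "q \<in> idl R B" for x q
    using q by (induction rule: idl.induct) (use z in auto)
  show ?thesis
  proof (rule that[OF B(1,2)])
    fix x q assume "\<forall>b\<in>B. b x = 0" "q \<in> Q"
    with *[OF this(1) subsetD[OF B(3)]] show "q x = 0" by simp
  qed
qed

section \<open>Unitary matrices\<close>

text \<open>The bridge to matrices with dimensions, from which associativity, one-sided inverses and
  the determinants of products and blocks are imported; \<open>to_mat_inject\<close> leads
  back.\<close>

definition to_mat :: "nat \<Rightarrow> cmat \<Rightarrow> complex Matrix.mat" where
  "to_mat n A = Matrix.mat n n (\<lambda>(i, j). A i j)"

lemma to_mat_carrier [simp]: "to_mat n A \<in> carrier_mat n n"
  by (simp add: to_mat_def)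

lemma to_mat_mult: "to_mat n (mat_mult n A B) = to_mat n A * to_mat n B"
  by (rule eq_matI) (auto simp: to_mat_def mat_mult_def scalar_prod_def lessThan_atLeast0)

lemma to_mat_one: "to_mat n (mat_one n) = 1\<^sub>m n"
  by (rule eq_matI) (auto simp: to_mat_def mat_one_def)

lemma is_matD: "is_mat n A \<Longrightarrow> n \<le> i \<or> n \<le> j \<Longrightarrow> A i j = 0"
  unfolding is_mat_def by blast

lemma to_mat_inject:
  assumes "is_mat n A" "is_mat n B" "to_mat n A = to_mat n B"
  shows "A = B"
proof (intro ext)
  fix i j
  show "A i j = B i j"
  proof (cases "i < n \<and> j < n")
    case True
    then show ?thesis using arg_cong[OF assms(3), of "\<lambda>M. M $$ (i, j)"] by (simp add: to_mat_def)
  next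
    case False
    then have "n \<le> i \<or> n \<le> j" by auto
    then show ?thesis using is_matD[OF assms(1)] is_matD[OF assms(2)] by simp
  qed
qed

lemma mat_det_eq: "mat_det n A = Determinant.det (to_mat n A)"
proof -
  have "(\<Prod>i = 0..<n. to_mat n A $$ (i, p i)) = (\<Prod>i = 0..<n. A i (p i))" if p: "p permutes {0..<n}" for p
  proof (rule prod.cong)
    fix i assume "i \<in> {0..<n}"
    moreover from this have "p i \<in> {0..<n}" using permutes_in_image[OF p] by blast
    ultimately show "to_mat n A $$ (i, p i) = A i (p i)" by (simp add: to_mat_def)
  qed simp
  then show ?thesis
    unfolding det_def'[OF to_mat_carrier] mat_det_def lessThan_atLeast0 by (intro sum.cong) simp_all
qed

lemma is_mat_mult [simp]: "is_mat n (mat_mult n A B)"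
  by (auto simp: is_mat_def mat_mult_def)

lemma is_mat_one [simp]: "is_mat n (mat_one n)"
  by (auto simp: is_mat_def mat_one_def)

lemma is_mat_adj [simp]: "is_mat n A \<Longrightarrow> is_mat n (mat_adj A)"
  by (auto simp: is_mat_def mat_adj_def)

lemma mat_mult_assoc: "mat_mult n (mat_mult n A B) D = mat_mult n A (mat_mult n B D)"
  by (rule to_mat_inject[of n])
    (simp_all add: to_mat_mult assoc_mult_mat[OF to_mat_carrier to_mat_carrier to_mat_carrier])

lemma mat_mult_one_left: "is_mat n A \<Longrightarrow> mat_mult n (mat_one n) A = A"
  by (rule to_mat_inject[of n]) (simp_all add: to_mat_mult to_mat_one left_mult_one_mat[OF to_mat_carrier])

lemma mat_mult_one_right: "is_mat n A \<Longrightarrow> mat_mult n A (mat_one n) = A"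
  by (rule to_mat_inject[of n]) (simp_all add: to_mat_mult to_mat_one right_mult_one_mat[OF to_mat_carrier])

lemma mat_adj_mult: "mat_adj (mat_mult n A B) = mat_mult n (mat_adj B) (mat_adj A)"
  by (auto simp: fun_eq_iff mat_adj_def mat_mult_def mult.commute)

lemma mat_adj_adj [simp]: "mat_adj (mat_adj A) = A"
  by (simp add: mat_adj_def)

lemma mat_adj_one [simp]: "mat_adj (mat_one n) = mat_one n"
  by (auto simp: fun_eq_iff mat_adj_def mat_one_def)

definition unitary_set :: "nat \<Rightarrow> cmat set" where
  "unitary_set n = {A. is_mat n A \<and> mat_mult n A (mat_adj A) = mat_one n \<and> mat_mult n (mat_adj A) A = mat_one n}"

text \<open>A right inverse of a square matrix is a left inverse, so the one equation in
  \<open>SU\<close> yields both of \<open>unitary_set\<close>.\<close>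

lemma SU_subset_unitary_set: "SU n \<subseteq> unitary_set n"
proof
  fix A assume A: "A \<in> SU n"
  then have "to_mat n A * to_mat n (mat_adj A) = 1\<^sub>m n"
    by (simp add: SU_def to_mat_mult[symmetric] to_mat_one)
  from mat_mult_left_right_inverse[OF to_mat_carrier to_mat_carrier this]
  have "to_mat n (mat_mult n (mat_adj A) A) = to_mat n (mat_one n)" by (simp add: to_mat_mult to_mat_one)
  then have "mat_mult n (mat_adj A) A = mat_one n" by (intro to_mat_inject[of n]) auto
  with A show "A \<in> unitary_set n" by (simp add: unitary_set_def SU_def)
qed

lemma unitary_set_mult:
  assumes "A \<in> unitary_set n" "B \<in> unitary_set n"
  shows "mat_mult n A B \<in> unitary_set n"
proof -
  have "mat_mult n (mat_mult n A B) (mat_adj (mat_mult n A B))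
      = mat_mult n A (mat_mult n (mat_mult n B (mat_adj B)) (mat_adj A))"
    by (simp add: mat_adj_mult mat_mult_assoc)
  moreover have "mat_mult n (mat_adj (mat_mult n A B)) (mat_mult n A B)
      = mat_mult n (mat_adj B) (mat_mult n (mat_mult n (mat_adj A) A) B)"
    by (simp add: mat_adj_mult mat_mult_assoc)
  ultimately show ?thesis using assms by (simp add: unitary_set_def mat_mult_one_left)
qed

lemma unitary_set_one: "mat_one n \<in> unitary_set n"
  by (simp add: unitary_set_def mat_mult_one_left)

lemma unitary_set_adj: "A \<in> unitary_set n \<Longrightarrow> mat_adj A \<in> unitary_set n"
  by (simp add: unitary_set_def)

lemma group_unitary_set: "group (mat_group n (unitary_set n))"
proof (rule groupI)
  fix x assume x: "x \<in> carrier (mat_group n (unitary_set n))"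
  show "\<exists>y\<in>carrier (mat_group n (unitary_set n)). y \<otimes>\<^bsub>mat_group n (unitary_set n)\<^esub> x = \<one>\<^bsub>mat_group n (unitary_set n)\<^esub>"
    using x unitary_set_adj[of x n] by (intro bexI[of _ "mat_adj x"]) (auto simp: mat_group_def unitary_set_def)
qed (auto simp: mat_group_def unitary_set_mult unitary_set_one mat_mult_assoc, auto simp: unitary_set_def mat_mult_one_left)

lemma inv_unitary_set:
  assumes "A \<in> unitary_set n"
  shows "inv\<^bsub>mat_group n (unitary_set n)\<^esub> A = mat_adj A"
  by (rule group.inv_equality[OF group_unitary_set]) (use assms unitary_set_adj in \<open>auto simp: mat_group_def unitary_set_def\<close>)

section \<open>Topology of the unitary group\<close>

lemma continuous_on_entry: "continuous_on S (\<lambda>A::cmat. A i j)"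
proof -
  have "continuous_on UNIV (\<lambda>A::cmat. A i)" by (rule continuous_on_product_coordinates)
  from continuous_on_product_then_coordinatewise[OF this, of j] show ?thesis
    by (rule continuous_on_subset) simp
qed

lemma continuous_on_cmat:
  assumes "\<And>i j. continuous_on S (\<lambda>x. f x i j)"
  shows "continuous_on S (f :: 'x::topological_space \<Rightarrow> cmat)"
  using assms by (intro continuous_on_coordinatewise_then_product)

lemma continuous_on_entry_comp: "continuous_on S f \<Longrightarrow> continuous_on S (\<lambda>x. (f x :: cmat) i j)"
  by (rule continuous_on_product_then_coordinatewise[OF continuous_on_product_then_coordinatewise])

lemma continuous_on_mat_mult:
  assumes "continuous_on S f" "continuous_on S g"
  shows "continuous_on S (\<lambda>x. mat_mult n (f x) (g x))"
proof (rule continuous_on_cmat)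
  fix i j
  show "continuous_on S (\<lambda>x. mat_mult n (f x) (g x) i j)"
  proof (cases "i < n \<and> j < n")
    case True
    have "continuous_on S (\<lambda>x. \<Sum>k<n. f x i k * g x k j)"
      by (intro continuous_on_sum continuous_on_mult) (rule continuous_on_entry_comp, rule assms)+
    with True show ?thesis by (simp add: mat_mult_def)
  next
    case False
    then have "mat_mult n A B i j = 0" for A B by (auto simp: mat_mult_def)
    then show ?thesis by simp
  qed
qed

lemma continuous_on_mat_adj:
  assumes "continuous_on S f"
  shows "continuous_on S (\<lambda>x. mat_adj (f x))"
  unfolding mat_adj_def
  by (rule continuous_on_cmat, rule continuous_on_cnj, rule continuous_on_entry_comp, rule assms)

lemma unitary_set_entry_bound:
  assumes "A \<in> unitary_set n"
  shows "norm (A i j) \<le> 1"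
proof (cases "i < n \<and> j < n")
  case True
  have "mat_mult n A (mat_adj A) i i = 1" using assms True by (simp add: unitary_set_def mat_one_def)
  then have "(\<Sum>k<n. A i k * cnj (A i k)) = 1" using True by (simp add: mat_mult_def mat_adj_def)
  then have "of_real (\<Sum>k<n. (norm (A i k))\<^sup>2) = (1::complex)" by (simp only: of_real_sum complex_norm_square)
  then have s: "(\<Sum>k<n. (norm (A i k))\<^sup>2) = 1" by (simp only: of_real_eq_1_iff)
  have "(norm (A i j))\<^sup>2 \<le> (\<Sum>k<n. (norm (A i k))\<^sup>2)"
    using True by (intro member_le_sum) auto
  then show ?thesis using s by (simp add: power_le_one_iff abs_square_le_1)
next
  case False
  then have "n \<le> i \<or> n \<le> j" by auto
  moreover have "is_mat n A" using assms by (simp add: unitary_set_def)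
  ultimately show ?thesis by (simp add: is_matD)
qed

text \<open>Rows of length 1 bound all entries by 1, so the set is a closed part of a product of
  closed unit discs over all index pairs, compact by Tychonoff's theorem.\<close>

lemma compact_unitary_set: "compact (unitary_set n)"
proof -
  have c1: "closed {A::cmat. is_mat n A}"
    unfolding is_mat_def
    by (intro closed_Collect_all closed_Collect_imp closed_Collect_eq continuous_on_entry continuous_intros) auto
  have c2: "closed {A::cmat. mat_mult n A (mat_adj A) = mat_one n}"
    by (intro closed_Collect_eq continuous_on_mat_mult continuous_on_mat_adj continuous_on_id continuous_on_const)
  have c3: "closed {A::cmat. mat_mult n (mat_adj A) A = mat_one n}"
    by (intro closed_Collect_eq continuous_on_mat_mult continuous_on_mat_adj continuous_on_id continuous_on_const)
  have "unitary_set n = {A. is_mat n A} \<inter> {A. mat_mult n A (mat_adj A) = mat_one n} \<inter> {A. mat_mult n (mat_adj A) A = mat_one n}"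
    by (auto simp: unitary_set_def)
  then have cl: "closed (unitary_set n)" using c1 c2 c3 by (simp add: closed_Int)
  have "compact (PiE UNIV (\<lambda>_::nat. PiE UNIV (\<lambda>_::nat. cball (0::complex) 1)))"
    by (intro compact_PiE_UNIV) auto
  from compact_Int_closed[OF this cl]
  have "compact (PiE UNIV (\<lambda>_::nat. PiE UNIV (\<lambda>_::nat. cball (0::complex) 1)) \<inter> unitary_set n)" .
  moreover have "unitary_set n \<subseteq> PiE UNIV (\<lambda>_. PiE UNIV (\<lambda>_. cball 0 1))"
    using unitary_set_entry_bound by (auto simp: PiE_UNIV_domain)
  ultimately show ?thesis by (simp add: Int_absorb1)
qed

lemma compact_group_unitary_set: "compact_group (mat_group n (unitary_set n)) (top_of_set (unitary_set n))"
proof -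
  interpret group "mat_group n (unitary_set n)" by (rule group_unitary_set)
  show ?thesis
  proof
    show "topspace (top_of_set (unitary_set n)) = carrier (mat_group n (unitary_set n))" by (simp add: mat_group_def)
    show "compact_space (top_of_set (unitary_set n))" using compact_unitary_set by (simp add: compact_space_subtopology)
    show "Hausdorff_space (top_of_set (unitary_set n))" by (simp add: Hausdorff_space_subtopology)
    have "continuous_on (unitary_set n \<times> unitary_set n) (\<lambda>z. mat_mult n (fst z) (snd z))"
      by (intro continuous_on_mat_mult continuous_intros)
    then have "continuous_map (top_of_set (unitary_set n \<times> unitary_set n)) (top_of_set (unitary_set n)) (\<lambda>z. mat_mult n (fst z) (snd z))"
      by (auto simp: continuous_map_in_subtopology unitary_set_mult)
    moreover have "top_of_set (unitary_set n \<times> unitary_set n) = prod_topology (top_of_set (unitary_set n)) (top_of_set (unitary_set n))"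
      using subtopology_Times[of euclidean euclidean "unitary_set n" "unitary_set n"] by simp
    ultimately have "continuous_map (prod_topology (top_of_set (unitary_set n)) (top_of_set (unitary_set n))) (top_of_set (unitary_set n))
       (\<lambda>z. mat_mult n (fst z) (snd z))" by (simp only:)
    then show "continuous_map (prod_topology (top_of_set (unitary_set n)) (top_of_set (unitary_set n))) (top_of_set (unitary_set n))
       (\<lambda>(x, y). x \<otimes>\<^bsub>mat_group n (unitary_set n)\<^esub> y)"
      unfolding mat_group_def case_prod_unfold monoid.simps .
    have "continuous_on (unitary_set n) mat_adj"
      using continuous_on_mat_adj[OF continuous_on_id] by simp
    then have "continuous_map (top_of_set (unitary_set n)) (top_of_set (unitary_set n)) mat_adj"
      by (auto simp: continuous_map_in_subtopology unitary_set_adj)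
    then show "continuous_map (top_of_set (unitary_set n)) (top_of_set (unitary_set n)) (\<lambda>x. inv\<^bsub>mat_group n (unitary_set n)\<^esub> x)"
      by (rule continuous_map_eq) (simp add: inv_unitary_set)
  qed
qed

section \<open>Block embeddings into SU(n)\<close>

definition real_to_mat :: "nat \<Rightarrow> (nat \<Rightarrow> nat \<Rightarrow> real) \<Rightarrow> complex Matrix.mat" where
  "real_to_mat m P = Matrix.mat m m (\<lambda>(i, j). of_real (P i j))"

text \<open>The block matrix \<open>P \<oplus> P \<oplus> 1\<close>; taking \<open>P\<close> twice makes the determinant of an orthogonal \<open>P\<close>
  come out as \<open>(det P)\<^sup>2 = 1\<close>.\<close>
definition double_embed :: "nat \<Rightarrow> nat \<Rightarrow> (nat \<Rightarrow> nat \<Rightarrow> real) \<Rightarrow> cmat" where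
  "double_embed n m P = (\<lambda>i j. if i < n \<and> j < n then
     (if i < m \<and> j < m then of_real (P i j)
      else if m \<le> i \<and> i < 2 * m \<and> m \<le> j \<and> j < 2 * m then of_real (P (i - m) (j - m))
      else if i = j \<and> 2 * m \<le> i then 1 else 0) else 0)"

lemma real_to_mat_carrier [simp]: "real_to_mat m P \<in> carrier_mat m m"
  by (simp add: real_to_mat_def)

lemma real_to_mat_dim [simp]: "dim_row (real_to_mat m P) = m" "dim_col (real_to_mat m P) = m"
  by (simp_all add: real_to_mat_def)

abbreviation double_block :: "nat \<Rightarrow> (nat \<Rightarrow> nat \<Rightarrow> real) \<Rightarrow> complex Matrix.mat" where
  "double_block m P \<equiv> four_block_mat (real_to_mat m P) (0\<^sub>m m m) (0\<^sub>m m m) (real_to_mat m P)"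

lemma double_block_carrier [simp]: "double_block m P \<in> carrier_mat (m + m) (m + m)"
  by (intro four_block_carrier_mat) auto

text \<open>Nesting the blocks, P \<oplus> P inside and the identity of size l outside, reduces
  products and determinants to the formulas for two-by-two blocks.\<close>

lemma to_mat_double_embed:
  assumes "n = m + m + l"
  shows "to_mat n (double_embed n m P)
    = four_block_mat (double_block m P) (0\<^sub>m (m + m) l) (0\<^sub>m l (m + m)) (1\<^sub>m l)"
  by (rule eq_matI) (use assms in \<open>auto simp: to_mat_def double_embed_def real_to_mat_def\<close>)

lemma is_mat_double_embed [simp]: "is_mat n (double_embed n m P)"
  by (auto simp: is_mat_def double_embed_def)

lemma double_embed_mult:
  assumes "2 * m \<le> n" and R: "\<And>i j. i < m \<Longrightarrow> j < m \<Longrightarrow> R i j = (\<Sum>k<m. P i k * Q k j)"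
  shows "mat_mult n (double_embed n m P) (double_embed n m Q) = double_embed n m R"
proof (rule to_mat_inject[of n])
  obtain l where n: "n = m + m + l" using assms(1) by (metis le_Suc_ex mult_2)
  have PQ: "real_to_mat m P * real_to_mat m Q = real_to_mat m R"
    by (rule eq_matI) (auto simp: real_to_mat_def scalar_prod_def R lessThan_atLeast0)
  have db: "double_block m P * double_block m Q = double_block m R"
    by (subst mult_four_block_mat[where ?nr1.0 = m and ?n1.0 = m and ?n2.0 = m and ?nr2.0 = m and ?nc1.0 = m and ?nc2.0 = m])
      (auto simp: PQ)
  show "to_mat n (mat_mult n (double_embed n m P) (double_embed n m Q)) = to_mat n (double_embed n m R)"
    unfolding to_mat_mult to_mat_double_embed[OF n]
    by (subst mult_four_block_mat[where ?nr1.0 = "m + m" and ?n1.0 = "m + m" and ?n2.0 = l and ?nr2.0 = l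
          and ?nc1.0 = "m + m" and ?nc2.0 = l]) (auto simp: db)
qed auto

lemma double_embed_one:
  assumes "2 * m \<le> n" "\<And>i j. i < m \<Longrightarrow> j < m \<Longrightarrow> P i j = (if i = j then 1 else 0)"
  shows "double_embed n m P = mat_one n"
  using assms by (auto simp: fun_eq_iff double_embed_def mat_one_def)

lemma mat_adj_double_embed:
  assumes "\<And>i j. i < m \<Longrightarrow> j < m \<Longrightarrow> P' i j = P j i"
  shows "mat_adj (double_embed n m P) = double_embed n m P'"
  using assms by (auto simp: fun_eq_iff mat_adj_def double_embed_def)

lemma double_embed_in_SU:
  assumes "2 * m \<le> n" and inv: "\<And>i j. i < m \<Longrightarrow> j < m \<Longrightarrow> (\<Sum>k<m. P i k * P j k) = (if i = j then 1 else 0)"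
  shows "double_embed n m P \<in> SU n"
proof -
  obtain l where n: "n = m + m + l" using assms(1) by (metis le_Suc_ex mult_2)
  define P' where "P' i j = P j i" for i j
  define R where "R i j = (\<Sum>k<m. P i k * P' k j)" for i j
  have "mat_mult n (double_embed n m P) (mat_adj (double_embed n m P)) = double_embed n m R"
    unfolding mat_adj_double_embed[of m P' P, unfolded P'_def, OF refl]
    using assms(1) by (intro double_embed_mult) (auto simp: R_def P'_def)
  also have "\<dots> = mat_one n" using assms by (intro double_embed_one) (auto simp: R_def P'_def)
  finally have u: "mat_mult n (double_embed n m P) (mat_adj (double_embed n m P)) = mat_one n" .
  let ?M = "real_to_mat m P"
  have "?M * transpose_mat ?M = 1\<^sub>m m"
    by (rule eq_matI) (auto simp: real_to_mat_def scalar_prod_def inv[unfolded lessThan_atLeast0] simp flip: of_real_mult of_real_sum)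
  then have "Determinant.det (?M * transpose_mat ?M) = 1" by simp
  then have d: "Determinant.det ?M * Determinant.det ?M = 1"
    by (simp add: det_mult[OF real_to_mat_carrier transpose_carrier_mat[THEN iffD2, OF real_to_mat_carrier]]
        det_transpose[OF real_to_mat_carrier])
  have "mat_det n (double_embed n m P) = Determinant.det (double_block m P) * Determinant.det (1\<^sub>m l)"
    unfolding mat_det_eq to_mat_double_embed[OF n]
    by (rule det_four_block_mat_upper_right_zero) auto
  also have "Determinant.det (double_block m P) = Determinant.det ?M * Determinant.det ?M"
    by (rule det_four_block_mat_upper_right_zero) auto
  finally have "mat_det n (double_embed n m P) = 1" by (simp add: d)
  with u show ?thesis by (simp add: SU_def)
qed

lemma double_embed_inj:
  assumes "2 * m \<le> n" "double_embed n m P = double_embed n m Q" "i < m" "j < m"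
  shows "P i j = Q i j"
  using fun_cong[OF fun_cong[OF assms(2)], of i j] assms by (simp add: double_embed_def)

section \<open>Closed subgroups as stabilizers\<close>

text \<open>Polynomial functions rather than formal polynomials: only evaluation matters, and the
  basis theorem applies to rings of functions with pointwise operations.\<close>

inductive_set polyR :: "nat \<Rightarrow> (cmat \<Rightarrow> real) set" for n where
  const: "(\<lambda>_. c) \<in> polyR n"
| re: "i < n \<Longrightarrow> j < n \<Longrightarrow> (\<lambda>A. Re (A i j)) \<in> polyR n"
| im: "i < n \<Longrightarrow> j < n \<Longrightarrow> (\<lambda>A. Im (A i j)) \<in> polyR n"
| add: "p \<in> polyR n \<Longrightarrow> q \<in> polyR n \<Longrightarrow> (\<lambda>A. p A + q A) \<in> polyR n"
| mult: "p \<in> polyR n \<Longrightarrow> q \<in> polyR n \<Longrightarrow> (\<lambda>A. p A * q A) \<in> polyR n"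

lemma polyR_continuous: "p \<in> polyR n \<Longrightarrow> continuous_on S p"
proof (induction rule: polyR.induct)
  case (re i j)
  show ?case by (rule continuous_on_Re[OF continuous_on_entry])
next
  case (im i j)
  show ?case by (rule continuous_on_Im[OF continuous_on_entry])
qed (auto intro: continuous_on_add continuous_on_mult continuous_on_const)

lemma polyR_diff: "p \<in> polyR n \<Longrightarrow> q \<in> polyR n \<Longrightarrow> (\<lambda>A. p A - q A) \<in> polyR n"
  using polyR.add[OF _ polyR.mult[OF polyR.const[of "-1"]], of p n q] by simp

lemma polyR_sum:
  "finite I \<Longrightarrow> (\<And>i. i \<in> I \<Longrightarrow> p i \<in> polyR n) \<Longrightarrow> (\<lambda>A. \<Sum>i\<in>I. p i A) \<in> polyR n"
  by (induction I rule: finite_induct) (auto intro: polyR.const polyR.add)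

lemma polyR_sum_list:
  "(\<And>i. i \<in> set xs \<Longrightarrow> p i \<in> polyR n) \<Longrightarrow> (\<lambda>A. \<Sum>i\<leftarrow>xs. p i A) \<in> polyR n"
  by (induction xs) (auto intro: polyR.const polyR.add)

lemma polyR_separates:
  assumes "is_mat n A" "is_mat n B" "A \<noteq> B"
  shows "\<exists>p\<in>polyR n. p A \<noteq> p B"
proof -
  obtain i j where ij: "A i j \<noteq> B i j" using assms(3) by (auto simp: fun_eq_iff)
  have "\<not> (n \<le> i \<or> n \<le> j)"
  proof
    assume "n \<le> i \<or> n \<le> j"
    from is_matD[OF assms(1) this] is_matD[OF assms(2) this] ij show False by simp
  qed
  then have n: "i < n" "j < n" by auto
  show ?thesis
  proof (cases "Re (A i j) = Re (B i j)")
    case True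
    then have "Im (A i j) \<noteq> Im (B i j)" using ij by (auto simp: complex_eq_iff)
    then show ?thesis by (intro bexI[OF _ polyR.im[OF n]])
  next
    case False
    then show ?thesis by (intro bexI[OF _ polyR.re[OF n]])
  qed
qed

text \<open>Inclusion in a noetherian ring is enough, because finite generating sets are chosen
  inside the given set of polynomials.\<close>

lemma polyR_noetherian: "\<exists>R. noetherian R \<and> polyR n \<subseteq> R"
proof -
  let ?fs = "map (\<lambda>(i, j) A. Re (A i j)) (List.product [0..<n] [0..<n]) @
      map (\<lambda>(i, j) A. Im (A i j)) (List.product [0..<n] [0..<n]) :: (cmat \<Rightarrow> real) list"
  obtain R where R: "noetherian R" "subring_set R" "range (\<lambda>c _. c) \<subseteq> R" "set ?fs \<subseteq> R"
    using noetherian_function_ring[of ?fs] by blast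
  have "p \<in> R" if "p \<in> polyR n" for p
    using that
  proof induction
    case (const c)
    show ?case using R(3) by blast
  next
    case (re i j)
    then have "(\<lambda>A. Re (A i j)) \<in> set ?fs" by force
    then show ?case using R(4) by blast
  next
    case (im i j)
    then have "(\<lambda>A. Im (A i j)) \<in> set ?fs" by force
    then show ?case using R(4) by blast
  next
    case (add p q)
    then have "p + q \<in> R" using R(2) by (auto simp: subring_set_def)
    then show ?case by (simp add: plus_fun_def)
  next
    case (mult p q)
    then have "p * q \<in> R" using R(2) by (auto simp: subring_set_def)
    then show ?case by (simp add: times_fun_def)
  qed
  with R(1) show ?thesis by blast
qed

text \<open>Finite-dimensional comultiplication; it makes polynomials representative functions of the
  unitary group and shows that averaging over a subgroup yields polynomials again.\<close>
lemma polyR_split: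
  assumes "p \<in> polyR n"
  shows "\<exists>ps. set ps \<subseteq> polyR n \<times> polyR n \<and> (\<forall>A B. p (mat_mult n A B) = (\<Sum>(e, c)\<leftarrow>ps. e A * c B))"
  using assms
proof induction
  case (const a)
  show ?case by (intro exI[of _ "[(\<lambda>_. a, \<lambda>_. 1)]"]) (auto intro: polyR.const)
next
  case (re i j)
  let ?ps = "map (\<lambda>k. (\<lambda>A. Re (A i k), \<lambda>B. Re (B k j))) [0..<n] @
      map (\<lambda>k. (\<lambda>A. - 1 * Im (A i k), \<lambda>B. Im (B k j))) [0..<n] :: ((cmat \<Rightarrow> real) \<times> (cmat \<Rightarrow> real)) list"
  have "Re (mat_mult n A B i j) = (\<Sum>(e, c)\<leftarrow>?ps. e A * c B)" for A B
    using re by (simp add: mat_mult_def sum_subtractf sum_negf o_def interv_sum_list_conv_sum_set_nat lessThan_atLeast0)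
  moreover have "set ?ps \<subseteq> polyR n \<times> polyR n"
    using re by (auto intro!: polyR.re polyR.im polyR.mult[OF polyR.const, of _ _ "-1", simplified])
  ultimately show ?case by blast
next
  case (im i j)
  let ?ps = "map (\<lambda>k. (\<lambda>A. Re (A i k), \<lambda>B. Im (B k j))) [0..<n] @
      map (\<lambda>k. (\<lambda>A. Im (A i k), \<lambda>B. Re (B k j))) [0..<n] :: ((cmat \<Rightarrow> real) \<times> (cmat \<Rightarrow> real)) list"
  have "Im (mat_mult n A B i j) = (\<Sum>(e, c)\<leftarrow>?ps. e A * c B)" for A B
    using im by (simp add: mat_mult_def sum.distrib o_def interv_sum_list_conv_sum_set_nat lessThan_atLeast0)
  moreover have "set ?ps \<subseteq> polyR n \<times> polyR n"
    using im by (auto intro!: polyR.re polyR.im)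
  ultimately show ?case by blast
next
  case (add p q)
  then obtain ps qs where "set ps \<subseteq> polyR n \<times> polyR n" "\<forall>A B. p (mat_mult n A B) = (\<Sum>(e, c)\<leftarrow>ps. e A * c B)"
    "set qs \<subseteq> polyR n \<times> polyR n" "\<forall>A B. q (mat_mult n A B) = (\<Sum>(e, c)\<leftarrow>qs. e A * c B)" by blast
  then show ?case by (intro exI[of _ "ps @ qs"]) auto
next
  case (mult p q)
  then obtain ps qs where ps: "set ps \<subseteq> polyR n \<times> polyR n" "\<forall>A B. p (mat_mult n A B) = (\<Sum>(e, c)\<leftarrow>ps. e A * c B)"
    and qs: "set qs \<subseteq> polyR n \<times> polyR n" "\<forall>A B. q (mat_mult n A B) = (\<Sum>(e, c)\<leftarrow>qs. e A * c B)" by blast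
  let ?rs = "map (\<lambda>((e, c), (e', c')). (\<lambda>A. e A * e' A, \<lambda>B. c B * c' B)) (List.product ps qs)"
  have 1: "(\<Sum>y\<leftarrow>ys. a * b * (case y of (e', c') \<Rightarrow> e' A * c' B)) = a * b * (\<Sum>(e', c')\<leftarrow>ys. e' A * c' B)"
    for a b :: real and ys and A B :: cmat
    by (induction ys) (auto simp: algebra_simps)
  have 2: "(\<Sum>(e, c)\<leftarrow>map (\<lambda>((e, c), (e', c')). (\<lambda>A. e A * e' A, \<lambda>B. c B * c' B)) (List.product xs ys). e A * c B)
      = (\<Sum>(e, c)\<leftarrow>xs. e A * c B) * (\<Sum>(e, c)\<leftarrow>ys. e A * c B)"
    for xs ys :: "((cmat \<Rightarrow> real) \<times> (cmat \<Rightarrow> real)) list" and A B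
  proof (induction xs)
    case (Cons x xs)
    have "(\<Sum>(e, c)\<leftarrow>map (\<lambda>(e', c'). (\<lambda>A. fst x A * e' A, \<lambda>B. snd x B * c' B)) ys. e A * c B)
        = (fst x A * snd x B) * (\<Sum>(e', c')\<leftarrow>ys. e' A * c' B)"
      by (induction ys) (auto simp: algebra_simps)
    with Cons show ?case by (simp add: o_def case_prod_unfold algebra_simps)
  qed simp
  have "set ?rs \<subseteq> polyR n \<times> polyR n" using ps(1) qs(1) by (fastforce intro: polyR.mult)
  moreover have "\<forall>A B. p (mat_mult n A B) * q (mat_mult n A B) = (\<Sum>(e, c)\<leftarrow>?rs. e A * c B)"
    unfolding 2 using ps(2) qs(2) by simp
  ultimately show ?case by blast
qed

text \<open>For fixed g the splitting writes A \<mapsto> p (A g) as a linear combination of the left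
  factors e with coefficients c g. The left factors do not depend on g, so they span all right
  translates.\<close>

lemma rep_fun_polyR:
  assumes p: "p \<in> polyR n"
  shows "compact_group.rep_fun (mat_group n (unitary_set n)) (top_of_set (unitary_set n)) p"
proof -
  interpret U: compact_group "mat_group n (unitary_set n)" "top_of_set (unitary_set n)" by (rule compact_group_unitary_set)
  have Cp: "U.C q" if "q \<in> polyR n" for q using polyR_continuous[OF that] by simp
  obtain ps where ps: "set ps \<subseteq> polyR n \<times> polyR n" "\<And>A B. p (mat_mult n A B) = (\<Sum>(e, c)\<leftarrow>ps. e A * c B)"
    using polyR_split[OF p] by blast
  let ?B = "fst ` set ps"
  have "U.spanned ?B (\<lambda>A. \<Sum>(e, c)\<leftarrow>xs. e A * c g)" if "set xs \<subseteq> set ps" for xs g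
    using that
  proof (induction xs)
    case Nil
    show ?case by (simp add: U.spanned_zero)
  next
    case (Cons x xs)
    have "U.spanned ?B (fst x)" using Cons.prems by (intro U.spanned_self) auto
    from U.spanned_add[OF U.spanned_cmult[OF this, of "snd x g"] Cons.IH] Cons.prems
    show ?case by (simp add: case_prod_unfold mult.commute)
  qed
  then have "U.spanned ?B (\<lambda>A. \<Sum>(e, c)\<leftarrow>ps. e A * c g)" for g by simp
  then have "U.spanned ?B (\<lambda>A. p (A \<otimes>\<^bsub>mat_group n (unitary_set n)\<^esub> g))" for g by (simp add: mat_group_def ps(2))
  moreover have "\<forall>b\<in>?B. U.C b" using ps(1) Cp by force
  ultimately show ?thesis unfolding U.rep_fun_def using Cp[OF p] by (intro conjI exI[of _ ?B]) auto
qed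

section \<open>Polynomial invariants of a compact matrix group\<close>

context compact_group
begin

context
  fixes n :: nat and f :: "'a \<Rightarrow> cmat"
  assumes f_unitary_set: "\<And>g. g \<in> carrier G \<Longrightarrow> f g \<in> unitary_set n"
    and f_mult: "\<And>g h. g \<in> carrier G \<Longrightarrow> h \<in> carrier G \<Longrightarrow> f (g \<otimes> h) = mat_mult n (f g) (f h)"
    and f_one: "f \<one> = mat_one n"
    and f_cont: "continuous_map T euclidean f"
begin

definition average :: "(cmat \<Rightarrow> real) \<Rightarrow> cmat \<Rightarrow> real" where
  "average p A = haar (\<lambda>h. p (mat_mult n A (f h)))"

lemma C_polyR: "p \<in> polyR n \<Longrightarrow> C (\<lambda>h. p (f h))"
  using continuous_map_compose[OF f_cont, of euclideanreal p] polyR_continuous[of p n UNIV] by (simp add: o_def)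

lemma C_polyR_mult: "p \<in> polyR n \<Longrightarrow> C (\<lambda>h. p (mat_mult n A (f h)))"
proof -
  assume p: "p \<in> polyR n"
  have "continuous_on UNIV (\<lambda>B. p (mat_mult n A B))"
    using continuous_on_compose[OF continuous_on_mat_mult[OF continuous_on_const continuous_on_id] polyR_continuous[OF p]]
    by (simp add: o_def)
  then show ?thesis using continuous_map_compose[OF f_cont, of euclideanreal "\<lambda>B. p (mat_mult n A B)"] by (simp add: o_def)
qed

lemma average_polyR:
  assumes p: "p \<in> polyR n"
  shows "average p \<in> polyR n"
proof -
  obtain ps where ps: "set ps \<subseteq> polyR n \<times> polyR n" "\<And>A B. p (mat_mult n A B) = (\<Sum>(e, c)\<leftarrow>ps. e A * c B)"
    using polyR_split[OF p] by blast
  have "C (\<lambda>h. \<Sum>(e, c)\<leftarrow>xs. e A * c (f h)) \<and>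
      haar (\<lambda>h. \<Sum>(e, c)\<leftarrow>xs. e A * c (f h)) = (\<Sum>(e, c)\<leftarrow>xs. e A * haar (\<lambda>h. c (f h)))"
    if "set xs \<subseteq> set ps" for xs A
    using that
  proof (induction xs)
    case (Cons x xs)
    have "snd x \<in> polyR n" using Cons.prems ps(1) by auto
    then have c: "C (\<lambda>h. snd x (f h))" by (rule C_polyR)
    have xs: "C (\<lambda>h. \<Sum>(e, c)\<leftarrow>xs. e A * c (f h))"
      "haar (\<lambda>h. \<Sum>(e, c)\<leftarrow>xs. e A * c (f h)) = (\<Sum>(e, c)\<leftarrow>xs. e A * haar (\<lambda>h. c (f h)))"
      using Cons by auto
    note cA = continuous_map_real_mult_left[OF c, of "fst x A"]
    show ?case
      using continuous_map_add[OF cA xs(1)] haar_add[OF cA xs(1)] haar_cmult[OF c, of "fst x A"] xs(2)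
      by (simp add: case_prod_unfold)
  qed simp
  from this[OF subset_refl] have "average p = (\<lambda>A. \<Sum>(e, c)\<leftarrow>ps. e A * haar (\<lambda>h. c (f h)))"
    by (simp add: average_def[abs_def] ps(2))
  also have "\<dots> \<in> polyR n"
    unfolding case_prod_unfold using ps(1) by (intro polyR_sum_list polyR.mult polyR.const) auto
  finally show ?thesis .
qed

text \<open>Multiplying A by f h on the right replaces the integration variable h' by
  \<open>h \<otimes> h'\<close>, so right invariance of the average rests on left invariance of the
  integral.\<close>

lemma average_invariant:
  assumes p: "p \<in> polyR n" and h: "h \<in> carrier G"
  shows "average p (mat_mult n A (f h)) = average p A"
proof -
  have "average p (mat_mult n A (f h)) = haar (\<lambda>h'. p (mat_mult n A (f (h \<otimes> h'))))"
    unfolding average_def using h by (intro haar_cong) (simp add: f_mult mat_mult_assoc)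
  also have "\<dots> = average p A"
    unfolding average_def by (rule haar_ltrans[OF C_polyR_mult[OF p] h])
  finally show ?thesis .
qed

definition vanishing_invariants :: "(cmat \<Rightarrow> real) set" where
  "vanishing_invariants = {q \<in> polyR n. (\<forall>h\<in>carrier G. q (f h) = 0) \<and>
     (\<forall>A. \<forall>h\<in>carrier G. q (mat_mult n A (f h)) = q A)}"

lemma vanishing_invariants_separate:
  assumes g: "g \<in> unitary_set n" "g \<notin> f ` carrier G"
  shows "\<exists>q\<in>vanishing_invariants. q g \<noteq> 0"
proof -
  let ?K = "f ` carrier G"
  \<comment> \<open>From this formalisation of Stone--Weierstrass only \<open>two\<close> is taken,
    the separation of disjoint closed sets by a member of the ring.\<close>
  interpret function_ring_on "polyR n" "unitary_set n"
  proof
    fix x y assume "x \<in> unitary_set n" "y \<in> unitary_set n" "x \<noteq> y"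
    then show "\<exists>p\<in>polyR n. p x \<noteq> p y" by (intro polyR_separates) (auto simp: unitary_set_def)
  qed (auto intro: compact_unitary_set polyR_continuous polyR.intros)
  have K: "compact ?K"
    using image_compactin[OF _ f_cont, of "carrier G"] compact_group.compact[OF compact_group_axioms]
    by (simp add: compact_space_def)
  let ?gK = "mat_mult n g ` ?K"
  have gK: "compact ?gK"
    by (intro compact_continuous_image K continuous_on_mat_mult continuous_on_const continuous_on_id)
  have disj: "?K \<inter> ?gK = {}"
  proof (rule ccontr)
    assume "?K \<inter> ?gK \<noteq> {}"
    then obtain h k where hk: "h \<in> carrier G" "k \<in> carrier G" "f h = mat_mult n g (f k)" by auto
    have "f (h \<otimes> inv k) = mat_mult n (mat_mult n g (f k)) (f (inv k))" using hk f_mult by simp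
    also have "\<dots> = mat_mult n g (f (k \<otimes> inv k))"
      by (simp only: mat_mult_assoc f_mult[OF hk(2) inv_closed[OF hk(2)]])
    also have "\<dots> = g" using hk g(1) by (simp add: f_one unitary_set_def mat_mult_one_right)
    finally have "g = f (h \<otimes> inv k)" by simp
    then show False using g(2) hk by blast
  qed
  obtain p where p: "p \<in> polyR n" "\<forall>x\<in>?K. p x < 1/3" "\<forall>x\<in>?gK. p x > 1 - 1/3"
    using two[of ?K ?gK "1/3"] K gK disj f_unitary_set unitary_set_mult[OF g(1)] by (auto simp: compact_imp_closed image_subset_iff)
  \<comment> \<open>The average is constant on K, with its value at the identity. That value
    averages p over K and is at most 1/3, while the value at g averages p over gK and is at least
    2/3.\<close>
  let ?q = "\<lambda>A. average p A - average p (mat_one n)"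
  have avp: "average p \<in> polyR n" by (rule average_polyR[OF p(1)])
  have "?q \<in> polyR n" by (intro polyR_diff avp polyR.const)
  moreover have "?q (f h) = 0" if "h \<in> carrier G" for h
    using average_invariant[OF p(1) that, of "mat_one n"] f_unitary_set[OF that] by (simp add: mat_mult_one_left unitary_set_def)
  ultimately have q: "?q \<in> vanishing_invariants"
    by (simp add: vanishing_invariants_def average_invariant[OF p(1)])
  have "average p (mat_one n) \<le> haar (\<lambda>_. 1/3)"
    unfolding average_def
  proof (rule haar_mono[OF C_polyR_mult[OF p(1)]])
    fix h assume h: "h \<in> carrier G"
    have "is_mat n (f h)" using f_unitary_set[OF h] by (simp add: unitary_set_def)
    then show "p (mat_mult n (mat_one n) (f h)) \<le> 1/3" using p(2) h by (simp add: mat_mult_one_left less_imp_le)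
  qed simp
  moreover have "haar (\<lambda>_. 2/3) \<le> average p g"
    unfolding average_def
  proof (rule haar_mono[OF _ C_polyR_mult[OF p(1)]])
    fix h assume "h \<in> carrier G"
    then have "p (mat_mult n g (f h)) > 1 - 1/3" using p(3) by blast
    then show "2/3 \<le> p (mat_mult n g (f h))" by simp
  qed simp
  ultimately have "?q g \<noteq> 0" by simp
  then show ?thesis by (rule bexI[OF _ q])
qed

lemma polynomial_with_stabilizer:
  obtains F where "F \<in> polyR n" "{g \<in> unitary_set n. \<forall>A\<in>unitary_set n. F (mat_mult n A g) = F A} = f ` carrier G"
proof -
  obtain R where R: "noetherian R" "polyR n \<subseteq> R" using polyR_noetherian by blast
  have "vanishing_invariants \<subseteq> R" using R(2) by (auto simp: vanishing_invariants_def)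
  from noetherian_zero_set[OF R(1) this] obtain B where B: "finite B" "B \<subseteq> vanishing_invariants"
    "\<And>x q. \<forall>b\<in>B. b x = 0 \<Longrightarrow> q \<in> vanishing_invariants \<Longrightarrow> q x = 0" by blast
  define F where "F A = (\<Sum>b\<in>B. b A * b A)" for A
  have BP: "b \<in> polyR n" "\<And>h. h \<in> carrier G \<Longrightarrow> b (f h) = 0"
    "\<And>A h. h \<in> carrier G \<Longrightarrow> b (mat_mult n A (f h)) = b A" if "b \<in> B" for b
    using that B(2) by (auto simp: vanishing_invariants_def)
  have F: "F \<in> polyR n" unfolding F_def using BP B(1) by (intro polyR_sum polyR.mult) auto
  have "{g \<in> unitary_set n. \<forall>A\<in>unitary_set n. F (mat_mult n A g) = F A} = f ` carrier G"
  proof (intro equalityI subsetI)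
    fix g assume g: "g \<in> {g \<in> unitary_set n. \<forall>A\<in>unitary_set n. F (mat_mult n A g) = F A}"
    then have "F (mat_mult n (mat_one n) g) = F (mat_one n)" using unitary_set_one by blast
    also have "F (mat_one n) = 0"
      unfolding F_def
    proof (intro sum.neutral ballI)
      fix b assume "b \<in> B"
      from BP(2)[OF this one_closed] show "b (mat_one n) * b (mat_one n) = 0" by (simp add: f_one)
    qed
    finally have "F g = 0" using g by (simp add: unitary_set_def mat_mult_one_left)
    then have "\<forall>b\<in>B. b g = 0" unfolding F_def using B(1) by (subst (asm) sum_nonneg_eq_0_iff) auto
    from B(3)[OF this] have z: "\<And>q. q \<in> vanishing_invariants \<Longrightarrow> q g = 0" .
    have gU: "g \<in> unitary_set n" using g by simp
    show "g \<in> f ` carrier G"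
    proof (rule ccontr)
      assume "g \<notin> f ` carrier G"
      from vanishing_invariants_separate[OF gU this] z show False by auto
    qed
  next
    fix g assume "g \<in> f ` carrier G"
    then obtain h where h: "h \<in> carrier G" "g = f h" by blast
    have "F (mat_mult n A g) = F A" for A
      unfolding F_def h(2) by (intro sum.cong refl) (simp add: BP(3)[OF _ h(1)])
    then show "g \<in> {g \<in> unitary_set n. \<forall>A\<in>unitary_set n. F (mat_mult n A g) = F A}"
      using f_unitary_set[OF h(1)] h(2) by simp
  qed
  from that[OF F this] show ?thesis .
qed

end

end

text \<open>Right translation is represented for the whole unitary group, and the stabilizer of
  \<open>F\<close> there is the image of f. Intersecting with \<open>SU n\<close> loses nothing, as
  \<open>f_SU\<close> places the image inside.\<close>

theorem closed_subgroup_is_stabilizer: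
  fixes H (structure)
  assumes "compact_group H T"
    and f_SU: "\<And>g. g \<in> carrier H \<Longrightarrow> f g \<in> SU n"
    and f_mult: "\<And>g h. g \<in> carrier H \<Longrightarrow> h \<in> carrier H \<Longrightarrow> f (g \<otimes> h) = mat_mult n (f g) (f h)"
    and f_one: "f \<one> = mat_one n"
    and f_cont: "continuous_map T euclidean f"
  obtains m \<rho> v where "SU_rep n m \<rho>" "stabilizer n m \<rho> v = f ` carrier H"
proof -
  interpret H: compact_group H T by fact
  have f_unitary_set: "f g \<in> unitary_set n" if "g \<in> carrier H" for g using f_SU[OF that] SU_subset_unitary_set by blast
  obtain F where F: "F \<in> polyR n" "{g \<in> unitary_set n. \<forall>A\<in>unitary_set n. F (mat_mult n A g) = F A} = f ` carrier H"
    using H.polynomial_with_stabilizer[OF f_unitary_set f_mult f_one f_cont] by blast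
  interpret U: compact_group "mat_group n (unitary_set n)" "top_of_set (unitary_set n)" by (rule compact_group_unitary_set)
  have car: "carrier (mat_group n (unitary_set n)) = unitary_set n" "mult (mat_group n (unitary_set n)) = mat_mult n"
    "one (mat_group n (unitary_set n)) = mat_one n" by (auto simp: mat_group_def)
  have rF: "finite {F}" "\<And>\<phi>. \<phi> \<in> {F} \<Longrightarrow> U.rep_fun \<phi>" using rep_fun_polyR[OF F(1)] by auto
  obtain m \<pi> and v :: "(cmat \<Rightarrow> real) \<Rightarrow> nat \<Rightarrow> real" where rep: "U.orthogonal_rep m \<pi>"
    and fix_iff: "\<forall>\<phi>\<in>{F}. \<forall>g\<in>carrier (mat_group n (unitary_set n)).
      (\<forall>i<m. (\<Sum>j<m. \<pi> g i j * v \<phi> j) = v \<phi> i) \<longleftrightarrow>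
      (\<forall>x\<in>carrier (mat_group n (unitary_set n)). \<phi> (x \<otimes>\<^bsub>mat_group n (unitary_set n)\<^esub> g) = \<phi> x)"
    by (rule U.matrix_representation[OF rF(1)], erule rF(2), rule that)
  have \<pi>1: "\<pi> (mat_mult n g h) i j = (\<Sum>k<m. \<pi> g i k * \<pi> h k j)"
    if "g \<in> unitary_set n" "h \<in> unitary_set n" "i < m" "j < m" for g h i j
    using U.orthogonal_repD(1)[OF rep that(3,4)] that by (simp add: car)
  have \<pi>2: "\<pi> (mat_one n) i j = (if i = j then 1 else 0)" if "i < m" "j < m" for i j
    using U.orthogonal_repD(2)[OF rep that] by (simp add: car)
  have \<pi>3: "continuous_on (unitary_set n) (\<lambda>g. \<pi> g i j)" if "i < m" "j < m" for i j
    using U.orthogonal_repD(4)[OF rep that] by simp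
  have \<pi>4: "(\<forall>i<m. (\<Sum>j<m. \<pi> g i j * v F j) = v F i) \<longleftrightarrow> (\<forall>x\<in>unitary_set n. F (mat_mult n x g) = F x)"
    if "g \<in> unitary_set n" for g
    using fix_iff that by (simp add: car)
  \<comment> \<open>Entries outside the m x m square are 0, as \<open>is_mat\<close> demands. Matrix
    and vector are real, so the complex equations for a fixed vector are the real ones.\<close>
  define \<rho> :: "cmat \<Rightarrow> cmat" where "\<rho> g = (\<lambda>i j. if i < m \<and> j < m then of_real (\<pi> g i j) else 0)" for g
  define w :: "nat \<Rightarrow> complex" where "w j = of_real (v F j)" for j
  have "SU_rep n m \<rho>"
    unfolding SU_rep_def
  proof (intro conjI ballI)
    fix g assume g: "g \<in> SU n"
    show "is_mat m (\<rho> g)" by (auto simp: is_mat_def \<rho>_def)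
    fix h assume h: "h \<in> SU n"
    show "\<rho> (mat_mult n g h) = mat_mult m (\<rho> g) (\<rho> h)"
      using g h SU_subset_unitary_set by (auto simp: fun_eq_iff \<rho>_def mat_mult_def[of m] \<pi>1 subset_iff)
  next
    show "\<rho> (mat_one n) = mat_one m" by (auto simp: fun_eq_iff \<rho>_def mat_one_def[of m] \<pi>2)
    have "continuous_on (unitary_set n) \<rho>"
    proof (rule continuous_on_cmat)
      fix i j
      show "continuous_on (unitary_set n) (\<lambda>g. \<rho> g i j)"
        using \<pi>3 by (cases "i < m \<and> j < m") (auto simp: \<rho>_def intro!: continuous_on_of_real)
    qed
    then show "continuous_on (SU n) \<rho>" by (rule continuous_on_subset) (rule SU_subset_unitary_set)
  qed
  moreover have "stabilizer n m \<rho> w = f ` carrier H"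
  proof -
    have "(\<Sum>j<m. \<rho> g i j * w j) = w i \<longleftrightarrow> (\<Sum>j<m. \<pi> g i j * v F j) = v F i" if "i < m" for g i
    proof -
      have "(\<Sum>j<m. \<rho> g i j * w j) = of_real (\<Sum>j<m. \<pi> g i j * v F j)"
        using that by (simp add: \<rho>_def w_def)
      then show ?thesis by (simp only: w_def of_real_eq_iff)
    qed
    then have "stabilizer n m \<rho> w = {g \<in> SU n. \<forall>i<m. (\<Sum>j<m. \<pi> g i j * v F j) = v F i}"
      by (auto simp: stabilizer_def)
    also have "\<dots> = SU n \<inter> {g \<in> unitary_set n. \<forall>A\<in>unitary_set n. F (mat_mult n A g) = F A}"
      using \<pi>4 SU_subset_unitary_set by blast
    also have "\<dots> = f ` carrier H" unfolding F(2) using f_SU by blast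
    finally show ?thesis .
  qed
  ultimately show ?thesis using that by blast
qed

text \<open>Compactness lets finitely many separating functions deal with all of H outside the
  neighbourhood U. The elements fixing each of these functions form a subgroup inside U, which must
  be trivial, and the kernel of the representation is contained in it.\<close>

theorem faithful_representation:
  fixes H (structure)
  assumes "compact_lie_group H T"
  obtains m \<pi> where "compact_group.orthogonal_rep H T m \<pi>"
    and "\<forall>g\<in>carrier H. (\<forall>i<m. \<forall>j<m. \<pi> g i j = (if i = j then 1 else 0)) \<longrightarrow> g = \<one>"
proof -
  have lie: "lie_group H T" and "compact_space T" using assms by (auto simp: compact_lie_group_def)
  note L = lie[unfolded lie_group_def]
  interpret group H by (rule L[THEN conjunct1])
  interpret compact_group H T
    by unfold_locales (use L \<open>compact_space T\<close> in blast)+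
  obtain U where U: "openin T U" "\<one> \<in> U" "\<And>K. subgroup K H \<Longrightarrow> K \<subseteq> U \<Longrightarrow> K = {\<one>}"
    using no_small_subgroups[OF lie] by blast
  have "\<exists>\<phi>. rep_fun \<phi> \<and> (\<exists>x\<in>carrier H. \<phi> (x \<otimes> g) \<noteq> \<phi> x)" if "g \<in> carrier H" "g \<noteq> \<one>" for g
    using rep_funs_separate[OF that] by blast
  then obtain \<phi> where \<phi>: "\<And>g. g \<in> carrier H \<Longrightarrow> g \<noteq> \<one> \<Longrightarrow> rep_fun (\<phi> g)"
      "\<And>g. g \<in> carrier H \<Longrightarrow> g \<noteq> \<one> \<Longrightarrow> \<exists>x\<in>carrier H. \<phi> g (x \<otimes> g) \<noteq> \<phi> g x"
    by metis
  \<comment> \<open>No function separates the identity from itself, so U is its member of the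
    covering.\<close>
  define O' where "O' g = (if g = \<one> then U else {h \<in> carrier H. \<exists>x\<in>carrier H. \<phi> g (x \<otimes> h) \<noteq> \<phi> g x})" for g
  have O': "openin T (O' g) \<and> g \<in> O' g" if g: "g \<in> carrier H" for g
  proof (cases "g = \<one>")
    case False
    have C\<phi>: "C (\<phi> g)" using \<phi>(1)[OF g False] by (simp add: rep_fun_def)
    have "openin T {h \<in> topspace T. \<phi> g (x \<otimes> h) \<in> - {\<phi> g x}}" if "x \<in> carrier H" for x
      by (rule openin_continuous_map_preimage[OF C_ltrans[OF C\<phi> that]]) auto
    then have "openin T (\<Union>x\<in>carrier H. {h \<in> topspace T. \<phi> g (x \<otimes> h) \<in> - {\<phi> g x}})" by blast
    also have "(\<Union>x\<in>carrier H. {h \<in> topspace T. \<phi> g (x \<otimes> h) \<in> - {\<phi> g x}}) = O' g"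
      using False by (auto simp: O'_def)
    finally show ?thesis using \<phi>(2)[OF g False] g False by (simp add: O'_def)
  qed (use U in \<open>simp add: O'_def\<close>)
  obtain X where X: "finite X" "X \<subseteq> carrier H" "carrier H \<subseteq> (\<Union>g\<in>X. O' g)" using finite_subcover[OF O'] by blast
  let ?\<Phi> = "\<phi> ` (X - {\<one>})"
  have \<Phi>: "finite ?\<Phi>" "\<And>\<psi>. \<psi> \<in> ?\<Phi> \<Longrightarrow> rep_fun \<psi>" using X \<phi>(1) by auto
  define K where "K = {h \<in> carrier H. \<forall>\<psi>\<in>?\<Phi>. \<forall>x\<in>carrier H. \<psi> (x \<otimes> h) = \<psi> x}"
  have "subgroup K H"
  proof (rule subgroupI)
    show "K \<subseteq> carrier H" "K \<noteq> {}" by (auto simp: K_def intro!: exI[of _ \<one>])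
    fix a assume a: "a \<in> K"
    have "\<psi> (x \<otimes> inv a) = \<psi> x" if "\<psi> \<in> ?\<Phi>" "x \<in> carrier H" for \<psi> x
    proof -
      have aH: "a \<in> carrier H" using a by (simp add: K_def)
      then have "\<psi> ((x \<otimes> inv a) \<otimes> a) = \<psi> (x \<otimes> inv a)" using a that unfolding K_def by blast
      then show ?thesis using aH that by (simp add: m_assoc)
    qed
    then show "inv a \<in> K" using a by (auto simp: K_def)
    fix b assume b: "b \<in> K"
    have "\<psi> (x \<otimes> (a \<otimes> b)) = \<psi> x" if "\<psi> \<in> ?\<Phi>" "x \<in> carrier H" for \<psi> x
    proof -
      have ab: "a \<in> carrier H" "b \<in> carrier H" using a b by (auto simp: K_def)
      then have "\<psi> ((x \<otimes> a) \<otimes> b) = \<psi> (x \<otimes> a)" using b that unfolding K_def by blast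
      also have "\<dots> = \<psi> x" using a that unfolding K_def by blast
      finally show ?thesis using ab that by (simp add: m_assoc)
    qed
    then show "a \<otimes> b \<in> K" using a b by (auto simp: K_def)
  qed
  moreover have "K \<subseteq> U"
  proof
    fix h assume h: "h \<in> K"
    then have "h \<in> (\<Union>g\<in>X. O' g)" using X(3) unfolding K_def by blast
    then obtain g where g: "g \<in> X" "h \<in> O' g" by blast
    have "g = \<one>"
    proof (rule ccontr)
      assume "g \<noteq> \<one>"
      then have "\<phi> g \<in> ?\<Phi>" "\<exists>x\<in>carrier H. \<phi> g (x \<otimes> h) \<noteq> \<phi> g x" using g by (auto simp: O'_def)
      then show False using h unfolding K_def by blast
    qed
    then show "h \<in> U" using g(2) by (simp add: O'_def)
  qed
  ultimately have K1: "K = {\<one>}" by (rule U(3))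
  obtain m \<pi> and v :: "('a \<Rightarrow> real) \<Rightarrow> nat \<Rightarrow> real" where \<pi>: "orthogonal_rep m \<pi>"
    and v: "\<forall>\<psi>\<in>?\<Phi>. \<forall>g\<in>carrier H.
      (\<forall>i<m. (\<Sum>j<m. \<pi> g i j * v \<psi> j) = v \<psi> i) \<longleftrightarrow> (\<forall>x\<in>carrier H. \<psi> (x \<otimes> g) = \<psi> x)"
    by (rule matrix_representation[OF \<Phi>(1)], erule \<Phi>(2), rule that)
  have "g = \<one>" if g: "g \<in> carrier H" and id: "\<forall>i<m. \<forall>j<m. \<pi> g i j = (if i = j then 1 else 0)" for g
  proof -
    have "(\<Sum>j<m. \<pi> g i j * w j) = w i" if "i < m" for i w
    proof -
      have "(\<Sum>j<m. \<pi> g i j * w j) = (\<Sum>j<m. if j = i then w j else 0)" using id that by (intro sum.cong) auto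
      then show ?thesis using that by simp
    qed
    then have "\<psi> (x \<otimes> g) = \<psi> x" if "\<psi> \<in> ?\<Phi>" "x \<in> carrier H" for \<psi> x
      using bspec[OF bspec[OF v that(1)] g] that(2) by simp
    then have "g \<in> K" unfolding K_def using g by blast
    with K1 show ?thesis by simp
  qed
  with \<pi> show ?thesis by (intro that[of m \<pi>]) auto
qed

theorem theorem3:
  fixes H :: "'h monoid" and TH :: "'h topology"
  assumes "compact_lie_group H TH"
  shows "\<exists>N. \<forall>n\<ge>N. \<exists>(m::nat) \<rho> (v :: nat \<Rightarrow> complex).
           SU_rep n m \<rho> \<and>
           (\<exists>f. f \<in> iso H (mat_group n (stabilizer n m \<rho> v)) \<and>
                homeomorphic_map TH (top_of_set (stabilizer n m \<rho> v)) f)"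
proof -
  have lie: "lie_group H TH" and "compact_space TH" using assms by (auto simp: compact_lie_group_def)
  note L = lie[unfolded lie_group_def]
  interpret group H by (rule L[THEN conjunct1])
  interpret H: compact_group H TH
    by unfold_locales (use L \<open>compact_space TH\<close> in blast)+
  obtain m \<pi> where rep: "H.orthogonal_rep m \<pi>"
    and faithful: "\<forall>g\<in>carrier H. (\<forall>i<m. \<forall>j<m. \<pi> g i j = (if i = j then 1 else 0)) \<longrightarrow> g = \<one>\<^bsub>H\<^esub>"
    by (rule faithful_representation[OF assms], rule that)
  note \<pi> = H.orthogonal_repD[OF rep]
  show ?thesis
  \<comment> \<open>Two copies of \<pi> occupy 2m coordinates and an identity block fills the rest,
    so the same \<pi> serves for every n.\<close>
  proof (rule exI[of _ "2 * m"], intro allI impI)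
    fix n assume n: "2 * m \<le> n"
    define f where "f g = double_embed n m (\<pi> g)" for g
    have f_SU: "f g \<in> SU n" if g: "g \<in> carrier H" for g
      unfolding f_def
    proof (rule double_embed_in_SU[OF n])
      fix i j assume ij: "i < m" "j < m"
      have "(\<Sum>k<m. \<pi> g i k * \<pi> g j k) = \<pi> (g \<otimes>\<^bsub>H\<^esub> inv\<^bsub>H\<^esub> g) i j"
        using \<pi>(1)[OF ij g inv_closed[OF g]] \<pi>(3)[OF _ ij(2) g] by simp
      then show "(\<Sum>k<m. \<pi> g i k * \<pi> g j k) = (if i = j then 1 else 0)" using \<pi>(2)[OF ij] g by simp
    qed
    have f_mult: "f (g \<otimes>\<^bsub>H\<^esub> h) = mat_mult n (f g) (f h)" if "g \<in> carrier H" "h \<in> carrier H" for g h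
      unfolding f_def by (rule double_embed_mult[OF n, symmetric]) (rule \<pi>(1)[OF _ _ that])
    have f_one: "f \<one>\<^bsub>H\<^esub> = mat_one n" unfolding f_def by (rule double_embed_one[OF n \<pi>(2)])
    have entry: "continuous_map TH euclidean (\<lambda>g. f g i j)" for i j
    proof -
      have of_real: "continuous_map TH euclidean (\<lambda>g. complex_of_real (\<pi> g i j))" if "i < m" "j < m" for i j
        using continuous_map_compose[OF \<pi>(4)[OF that], of euclidean complex_of_real]
        by (simp add: o_def continuous_on_of_real)
      show ?thesis
        unfolding f_def double_embed_def using of_real[of i j] of_real[of "i - m" "j - m"] by auto
    qed
    have "continuous_map TH euclidean (\<lambda>g. f g i)" for i
      unfolding euclidean_product_topology[symmetric] continuous_map_componentwise_UNIV using entry by simp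
    then have f_cont: "continuous_map TH euclidean f"
      unfolding euclidean_product_topology[symmetric] continuous_map_componentwise_UNIV by simp
    have inj: "inj_on f (carrier H)"
    proof (rule inj_onI)
      fix g h assume gh: "g \<in> carrier H" "h \<in> carrier H" "f g = f h"
      have hi: "inv\<^bsub>H\<^esub> h \<in> carrier H" using gh by simp
      have "f (g \<otimes>\<^bsub>H\<^esub> inv\<^bsub>H\<^esub> h) = f (h \<otimes>\<^bsub>H\<^esub> inv\<^bsub>H\<^esub> h)"
        unfolding f_mult[OF gh(1) hi] f_mult[OF gh(2) hi] gh(3) ..
      then have eq: "double_embed n m (\<pi> (g \<otimes>\<^bsub>H\<^esub> inv\<^bsub>H\<^esub> h)) = double_embed n m (\<pi> \<one>\<^bsub>H\<^esub>)"
        using gh by (simp add: f_def)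
      have "\<pi> (g \<otimes>\<^bsub>H\<^esub> inv\<^bsub>H\<^esub> h) i j = (if i = j then 1 else 0)" if "i < m" "j < m" for i j
        using double_embed_inj[OF n eq that] \<pi>(2)[OF that] by simp
      then have "g \<otimes>\<^bsub>H\<^esub> inv\<^bsub>H\<^esub> h = \<one>\<^bsub>H\<^esub>" using gh faithful by simp
      from inv_equality[OF this hi gh(1)] show "g = h" using gh by simp
    qed
    from closed_subgroup_is_stabilizer[OF H.compact_group_axioms f_SU f_mult f_one f_cont]
    obtain k \<rho> v where \<rho>: "SU_rep n k \<rho>" "stabilizer n k \<rho> v = f ` carrier H" by blast
    have "f \<in> iso H (mat_group n (f ` carrier H))"
      using inj f_mult by (auto simp: iso_def hom_def bij_betw_def mat_group_def)
    moreover have "homeomorphic_map TH (top_of_set (f ` carrier H)) f"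
    proof (rule continuous_imp_homeomorphic_map)
      show "continuous_map TH (top_of_set (f ` carrier H)) f"
        using f_cont H.topspace by (auto simp: continuous_map_in_subtopology)
      show "f ` topspace TH = topspace (top_of_set (f ` carrier H))" by simp
      show "inj_on f (topspace TH)" using inj by simp
      show "compact_space TH" by fact
      show "Hausdorff_space (top_of_set (f ` carrier H))" by (simp add: Hausdorff_space_subtopology)
    qed
    ultimately show "\<exists>(m::nat) \<rho> (v :: nat \<Rightarrow> complex). SU_rep n m \<rho> \<and>
           (\<exists>f. f \<in> iso H (mat_group n (stabilizer n m \<rho> v)) \<and>
                homeomorphic_map TH (top_of_set (stabilizer n m \<rho> v)) f)"
      using \<rho> by (intro exI[of _ k] exI[of _ \<rho>] exI[of _ v]) auto
  qed
qed

end
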